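(* Let $n\ge2$ be an integer, let $\varphi_n\in\mathcal{C}(\overline{\mathbb{D}})$, let $\varphi_k\in\mathcal{C}(\mathbb{T})$ for $k\in\{1,\ldots,n-1\}$, and let $\varphi_0\in\mathcal{C}(\mathbb{T})$ be differentiable. Suppose that $f$ is a solution to the inhomogeneous polyharmonic equation $\Delta^nf=\Delta(\Delta^{n-1}f)=\varphi_n$ in $\mathbb{D}$ satisfying $\Delta^{n-1}f=\varphi_{n-1},\ \ldots,\ \Delta^1f=\varphi_1,\ \Delta^0f=\varphi_0$ on $\mathbb{T}$. Then $f$ is Lipschitz continuous in $\mathbb{D}$ if and only if the Hilbert transform of $d\varphi_0(e^{i\theta})/d\theta$ belongs to $L^\infty(\mathbb{T})$.
   Context: $\mathbb{D}$ is the open unit disk in $\mathbb{C}$, $\mathbb{T}=\partial\mathbb{D}$, $\overline{\mathbb{D}}=\mathbb{D}\cup\mathbb{T}$. $\mathcal{C}(D)$ denotes the continuous complex-valued functions on $D$. The (periodic) Hilbert transformation of a $2\pi$-periodic function $\Psi\in L^1(\mathbb{T})$ is $$H(\Psi)(\theta)=-\frac1\pi\int_0^\pi\frac{\Psi(\theta+t)-\Psi(\theta-t)}{2\tan(t/2)}\,dt.$$ $\Delta f=f_{xx}+f_{yy}=4f_{z\overline z}$, $\Delta^0f=f$, $\Delta^{j}=\Delta\Delta^{j-1}$; $f\in\mathcal{C}^{2n}(\mathbb{D})$ is complex-valued. "$\Delta^{j-1}f=\varphi_{j-1}$ on $\mathbb{T}$" means $\lim_{r\to1}\Delta^{j-1}f(r\zeta)=\varphi_{j-1}(\zeta)$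 for all $\zeta\in\mathbb{T}$, $j\in\{1,\ldots,n\}$. Let $G(z,\zeta)=\frac1{2\pi}\log\left|\frac{1-z\overline\zeta}{z-\zeta}\right|$, $P(z,e^{it})=\frac1{2\pi}\frac{1-|z|^2}{|1-ze^{-it}|^2}$, $P[\varphi](z)=\int_0^{2\pi}P(z,e^{it})\varphi(e^{it})\,dt$, and let $d\sigma$ be Lebesgue area measure. The solutions $f$ of the boundary value problem are those given by $f=P[\varphi_0]+\sum_{k=1}^n(-1)^kG_k[\varphi_k]$ in $\mathbb{D}$, where for $1\le k\le n-1$ $$G_k[\varphi_k](z)=\int_{\mathbb{D}}\cdots\int_{\mathbb{D}}G(z,\xi_1)G(\xi_1,\xi_2)\cdots G(\xi_{k-1},\xi_k)\,P[\varphi_k](\xi_k)\,d\sigma(\xi_k)\cdots d\sigma(\xi_1)$$ and $$G_n[\varphi_n](z)=\int_{\mathbb{D}}\cdots\int_{\mathbb{D}}G(z,\zeta_1)G(\zeta_1,\zeta_2)\cdots G(\zeta_{n-1},\zeta_n)\,\varphi_n(\zeta_n)\,d\sigma(\zeta_n)\cdots d\sigma(\zeta_1).$$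
   Formalization: The derivative of φ_0(e^{iθ}) is assumed to be bounded, in addition to φ_0 being differentiable; without this a differentiable φ_0 with unbounded derivative and bounded Hilbert transform of it gives a non-Lipschitz f. *)

theory Defs
  imports "HOL-Analysis.Analysis"
begin

definition partial_x :: "(complex \<Rightarrow> complex) \<Rightarrow> complex \<Rightarrow> complex" where
  "partial_x f z = vector_derivative (\<lambda>t. f (z + of_real t)) (at 0)"

definition partial_y :: "(complex \<Rightarrow> complex) \<Rightarrow> complex \<Rightarrow> complex" where
  "partial_y f z = vector_derivative (\<lambda>t. f (z + \<i> * of_real t)) (at 0)"

text \<open>Functions of class \<open>C\<close>-\<open>k\<close> on an open set, in the sense of the real variables
  \<open>x = Re z\<close> and \<open>y = Im z\<close>: all partial derivatives of order at most \<open>k\<close> exist and are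
  continuous.\<close>

fun Ck_on :: "nat \<Rightarrow> (complex \<Rightarrow> complex) \<Rightarrow> complex set \<Rightarrow> bool" where
  "Ck_on 0 f S \<longleftrightarrow> continuous_on S f"
| "Ck_on (Suc k) f S \<longleftrightarrow> continuous_on S f \<and>
     (\<forall>z\<in>S. (\<lambda>t::real. f (z + of_real t)) differentiable at 0 \<and>
            (\<lambda>t::real. f (z + \<i> * of_real t)) differentiable at 0) \<and>
     Ck_on k (partial_x f) S \<and> Ck_on k (partial_y f) S"

definition laplacian :: "(complex \<Rightarrow> complex) \<Rightarrow> complex \<Rightarrow> complex" where
  "laplacian f z = partial_x (partial_x f) z + partial_y (partial_y f) z"

definition green :: "complex \<Rightarrow> complex \<Rightarrow> real" where
  "green z \<zeta> = 1 / (2 * pi) * ln (cmod ((1 - z * cnj \<zeta>) / (z - \<zeta>)))"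

definition poisson_kernel :: "complex \<Rightarrow> complex \<Rightarrow> real" where
  "poisson_kernel z \<zeta> = 1 / (2 * pi) * ((1 - (cmod z)\<^sup>2) / (cmod (1 - z * cnj \<zeta>))\<^sup>2)"

definition poisson_integral :: "(complex \<Rightarrow> complex) \<Rightarrow> complex \<Rightarrow> complex" where
  "poisson_integral \<phi> z =
     (LINT t:{0..2*pi}|lebesgue. poisson_kernel z (cis t) *\<^sub>R \<phi> (cis t))"

definition green_potential :: "(complex \<Rightarrow> complex) \<Rightarrow> complex \<Rightarrow> complex" where
  "green_potential h z = (LINT \<xi>:ball 0 1|lebesgue. green z \<xi> *\<^sub>R h \<xi>)"

text \<open>The \<open>k\<close>-fold iterated integral of
  \<open>G(z, \<xi>\<^sub>1) G(\<xi>\<^sub>1, \<xi>\<^sub>2) \<dots> G(\<xi>\<^sub>k\<^sub>-\<^sub>1, \<xi>\<^sub>k) h(\<xi>\<^sub>k)\<close>, the innermost integration being with respect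
  to \<open>\<xi>\<^sub>k\<close>; the factors that do not depend on the inner variables are taken out of the inner
  integrals.\<close>

definition iterated_green_potential ::
    "nat \<Rightarrow> (complex \<Rightarrow> complex) \<Rightarrow> complex \<Rightarrow> complex" where
  "iterated_green_potential k h = (green_potential ^^ k) h"

text \<open>The right-hand side of the representation formula; the datum \<open>\<phi> n\<close> lives on the closed
  disk, the data \<open>\<phi> k\<close> with \<open>k < n\<close> on the unit circle.\<close>

definition polyharmonic_representation ::
    "nat \<Rightarrow> (nat \<Rightarrow> complex \<Rightarrow> complex) \<Rightarrow> complex \<Rightarrow> complex" where
  "polyharmonic_representation n \<phi> z =
     poisson_integral (\<phi> 0) z
     + (\<Sum>k = 1..n-1. (-1) ^ k * iterated_green_potential k (poisson_integral (\<phi> k)) z)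
     + (-1) ^ n * iterated_green_potential n (\<phi> n) z"

text \<open>A solution of the boundary value problem. Radial limits at every boundary point do not
  determine a solution (\<open>Im (z / (1 - z)\<^sup>2)\<close> is harmonic with radial limit \<open>0\<close>
  everywhere on the circle), so the representation formula is part of the notion.\<close>

definition polyharmonic_solution ::
    "nat \<Rightarrow> (nat \<Rightarrow> complex \<Rightarrow> complex) \<Rightarrow> (complex \<Rightarrow> complex) \<Rightarrow> bool" where
  "polyharmonic_solution n \<phi> f \<longleftrightarrow>
     Ck_on (2 * n) f (ball 0 1) \<and>
     (\<forall>z\<in>ball 0 1. (laplacian ^^ n) f z = \<phi> n z) \<and>
     (\<forall>j\<in>{1..n}. \<forall>\<zeta>\<in>sphere 0 1.
        ((\<lambda>r. (laplacian ^^ (j - 1)) f (of_real r * \<zeta>)) \<longlongrightarrow> \<phi> (j - 1) \<zeta>) (at_left 1)) \<and>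
     (\<forall>z\<in>ball 0 1. f z = polyharmonic_representation n \<phi> z)"

text \<open>The derivative of \<open>\<phi>(e\<^sup>i\<^sup>\<theta>)\<close> with respect to \<open>\<theta>\<close>. Differentiability at every point does not
  make this function bounded, not even when it is integrable with bounded Hilbert transform,
  whereas Lipschitz continuity of a Poisson integral forces it to be bounded.\<close>

definition circle_deriv :: "(complex \<Rightarrow> complex) \<Rightarrow> real \<Rightarrow> complex" where
  "circle_deriv \<phi> \<theta> = vector_derivative (\<lambda>t. \<phi> (cis t)) (at \<theta>)"

text \<open>The singular integral over \<open>{0..pi}\<close> is improper at \<open>0\<close>. For \<open>2 * pi\<close>-periodic integrable
  \<open>\<Psi>\<close> the limit exists for almost every \<open>\<theta>\<close>, but not in general for every \<open>\<theta>\<close>.\<close>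

definition hilbert_transform :: "(real \<Rightarrow> complex) \<Rightarrow> real \<Rightarrow> complex" where
  "hilbert_transform \<Psi> \<theta> =
     - (1 / pi) *\<^sub>R Lim (at_right 0) (\<lambda>\<epsilon>. LINT t:{\<epsilon>..pi}|lebesgue.
         (\<Psi> (\<theta> + t) - \<Psi> (\<theta> - t)) /\<^sub>R (2 * tan (t / 2)))"

text \<open>Membership in \<open>L\<close>-\<open>\<infinity>\<close> of the circle, for \<open>2 * pi\<close>-periodic functions of the angle.\<close>

definition Linfty_circle :: "(real \<Rightarrow> complex) \<Rightarrow> bool" where
  "Linfty_circle g \<longleftrightarrow> g \<in> borel_measurable (lebesgue_on {0..2*pi}) \<and>
     (\<exists>C. AE \<theta> in lebesgue_on {0..2*pi}. norm (g \<theta>) \<le> C)"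

end

theory Submission
  imports Defs "HOL-Complex_Analysis.Complex_Analysis"
begin

text \<open>Green potentials of bounded functions are Lipschitz: \<open>\<bar>ln x - ln y\<bar> \<le> \<bar>x - y\<bar> (1/x + 1/y)\<close> and
  \<open>\<bar>1 - z cnj w\<bar> \<ge> \<bar>z - w\<bar>\<close> bound the increments of \<open>G(\<cdot>, w)\<close> by those of \<open>ln \<bar>z - w\<bar>\<close>, and
  \<open>1/\<bar>z - w\<bar>\<close> is integrable. So \<open>f\<close> is Lipschitz iff \<open>u = P[\<phi>\<^sub>0]\<close> is.

  Write \<open>g(t) = \<phi>\<^sub>0(e\<^sup>i\<^sup>t)\<close> and \<open>\<psi> = g'\<close>. As \<open>g\<close> is Lipschitz, \<open>u\<^sub>\<theta>\<close> is bounded, so \<open>u\<close> is Lipschitz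
  iff \<open>r u\<^sub>r\<close> is bounded. Both \<open>u\<^sub>\<theta>\<close> and \<open>r u\<^sub>r\<close> are integrals of \<open>g\<close> against the imaginary and real part of
  the Koebe function \<open>k(z) = z/(1 - z)\<^sup>2\<close>. Integration by parts in the truncated Hilbert transform shows
  that the radial limits of \<open>r u\<^sub>r\<close>, where they exist, are the values of \<open>H(\<psi>)\<close>. To see that they exist
  almost everywhere, note that \<open>u\<^sub>\<theta>\<close> has the radial limits \<open>\<psi>\<close> boundedly, hence in \<open>L\<^sup>2\<close>, and that
  \<open>r u\<^sub>r\<close> is the conjugate of \<open>u\<^sub>\<theta>\<close>; so \<open>r u\<^sub>r\<close> also converges in \<open>L\<^sup>2\<close>, to \<open>h\<close> say, and \<open>r u\<^sub>r = P[V]\<^sub>\<theta>\<close>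
  with \<open>V\<close> a primitive of \<open>h\<close>. Radial convergence holds wherever \<open>V' = h\<close>, and \<open>h = H(\<psi>)\<close> is essentially
  bounded iff \<open>V\<close> is Lipschitz iff \<open>r u\<^sub>r\<close> is bounded.\<close>

section \<open>Green potentials of bounded functions\<close>

text \<open>The obstacle is that \<open>hilbert_transform\<close> is a \<open>Lim\<close>, without
  meaning at angles where the truncated integrals diverge, so their convergence almost everywhere
  has to be derived for a density \<psi> that is only a bounded derivative. Matching truncation at
  \<epsilon> with radius 1 - \<epsilon> shows that the truncated integral plus \<open>pi\<close>
  times \<open>radial_op g\<close> tends to 0 at every angle; the task thus moves to radial limits
  of a harmonic function. No density enters the kernel integrals: the primitives \<open>g\<close>
  and \<open>V\<close> are integrated against the Koebe kernel, that is, against derivatives of the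
  Poisson kernel. One Fatou theorem, \<open>angular_op_tendsto\<close>, which asks for
  differentiability at a single point, then serves twice: for \<open>g\<close> with derivative
  \<psi>, and for \<open>V\<close> with derivative \<open>h\<close> almost everywhere. The bridge
  between them needs no Fourier series: for holomorphic X, Y vanishing at 0 the mean value property
  makes the circle integral of X Y vanish, so X + cnj Y and X - cnj Y have equal
  \<open>L\<^sup>2\<close> norms.\<close>

lemma dyadic_shell:
  fixes d :: real
  assumes "0 < d" "d < 2"
  obtains j :: nat where "(1/2)^j \<le> d" "d < 2 * (1/2)^j"
proof -
  obtain n where n: "(1/2::real)^n < d" using real_arch_pow_inv[of d "1/2"] assms by auto
  define j where "j = (LEAST n. (1/2::real)^n \<le> d)"
  have 1: "(1/2)^j \<le> d" unfolding j_def by (rule LeastI[of _ n]) (use n in simp)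
  moreover have "d < 2 * (1/2)^j"
  proof (cases j)
    case 0 then show ?thesis using assms by simp
  next
    case (Suc i)
    then have "\<not> (1/2::real)^i \<le> d" using not_less_Least[of i "\<lambda>n. (1/2::real)^n \<le> d"]
      unfolding j_def[symmetric] by simp
    then show ?thesis using Suc by simp
  qed
  ultimately show ?thesis using that by blast
qed

text \<open>Dyadic shells around \<open>z\<close>, starting at radius 2 because the disk has
  diameter 2: on shell \<open>j\<close> the integrand is at most \<open>2^j\<close>, and the ball
  containing the shell has area \<open>4 * pi * (1/4)^j\<close>. Summing gives a bound that does not
  depend on \<open>z\<close>.\<close>

lemma nn_integral_inverse_dist_le:
  assumes "cmod z < 1"
  shows "(\<integral>\<^sup>+\<xi>. ennreal (indicator (ball 0 1) \<xi> * (1 / cmod (z - \<xi>))) \<partial>lborel) \<le> ennreal (8 * pi)"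
proof -
  have term_le: "F j \<le> suminf F" for F :: "nat \<Rightarrow> ennreal" and j
    using sum_le_suminf[of F "{j}"] by simp
  have "(\<integral>\<^sup>+\<xi>. ennreal (indicator (ball 0 1) \<xi> * (1 / cmod (z - \<xi>))) \<partial>lborel)
     \<le> (\<integral>\<^sup>+\<xi>. (\<Sum>j. ennreal (2^j) * indicator (ball z (2 * (1/2)^j)) \<xi>) \<partial>lborel)"
  proof (rule nn_integral_mono)
    fix \<xi> :: complex
    show "ennreal (indicator (ball 0 1) \<xi> * (1 / cmod (z - \<xi>)))
      \<le> (\<Sum>j. ennreal (2^j) * indicator (ball z (2 * (1/2)^j)) \<xi>)"
    proof (cases "cmod \<xi> < 1 \<and> \<xi> \<noteq> z")
      case True
      then have d: "0 < cmod (z - \<xi>)" "cmod (z - \<xi>) < 2"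
        using assms norm_triangle_ineq4[of z \<xi>] by auto
      obtain j where j: "(1/2)^j \<le> cmod (z - \<xi>)" "cmod (z - \<xi>) < 2 * (1/2)^j"
        using dyadic_shell[OF d] .
      have "1 / cmod (z - \<xi>) \<le> 1 / (1/2)^j"
        using j(1) d(1) by (intro divide_left_mono) (auto intro!: mult_pos_pos)
      then have "ennreal (indicator (ball 0 1) \<xi> * (1 / cmod (z - \<xi>)))
          \<le> ennreal (2^j) * indicator (ball z (2 * (1/2)^j)) \<xi>"
        using j True by (simp add: dist_norm power_one_over ennreal_leI)
      also have "\<dots> \<le> (\<Sum>j. ennreal (2^j) * indicator (ball z (2 * (1/2)^j)) \<xi>)"
        by (rule term_le)
      finally show ?thesis .
    \<comment> \<open>Outside the disk, and at \<open>\<xi> = z\<close> where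
      \<open>1 / 0 = 0\<close>, the integrand vanishes.\<close>
    qed (auto simp: indicator_def)
  qed
  also have "\<dots> = (\<Sum>j. \<integral>\<^sup>+\<xi>. ennreal (2^j) * indicator (ball z (2 * (1/2)^j)) \<xi> \<partial>lborel)"
    by (rule nn_integral_suminf) (intro borel_measurable_times_ennreal borel_measurable_indicator, auto)
  also have "\<dots> = (\<Sum>j. ennreal (4 * pi * (1/2)^j))"
  proof (rule suminf_cong)
    fix j :: nat
    have "(\<integral>\<^sup>+\<xi>. ennreal (2^j) * indicator (ball z (2 * (1/2)^j)) \<xi> \<partial>lborel)
        = ennreal (2^j) * emeasure lborel (ball z (2 * (1/2)^j))"
      by (rule nn_integral_cmult_indicator) auto
    also have "\<dots> = ennreal (2^j * (pi * (2 * (1/2)^j)^2))"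
      by (subst emeasure_ball) (auto simp: unit_ball_vol_2 ennreal_mult)
    also have "2^j * (pi * (2 * (1/2::real)^j)^2) = 4 * pi * (1/2)^j"
      by (simp add: power2_eq_square power_one_over)
    finally show "(\<integral>\<^sup>+\<xi>. ennreal (2^j) * indicator (ball z (2 * (1/2)^j)) \<xi> \<partial>lborel)
      = ennreal (4 * pi * (1/2)^j)" .
  qed
  also have "\<dots> = ennreal (\<Sum>j. 4 * pi * (1/2)^j)"
    by (rule suminf_ennreal2) (auto intro!: summable_mult summable_geometric)
  also have "(\<Sum>j. 4 * pi * (1/2::real)^j) = 8 * pi"
    by (subst suminf_mult) (auto simp: suminf_geometric intro!: summable_geometric)
  finally show ?thesis .
qed

lemma inverse_dist_integrable:
  assumes "cmod z < 1"
  shows "set_integrable lebesgue (ball 0 1) (\<lambda>\<xi>. 1 / cmod (z - \<xi>))"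
    and "(LINT \<xi>:ball 0 1|lebesgue. 1 / cmod (z - \<xi>)) \<le> 8 * pi"
proof -
  let ?f = "\<lambda>\<xi>. indicator (ball 0 1) \<xi> * (1 / cmod (z - \<xi>))"
  have "(\<lambda>\<xi>. 1 / cmod (z - \<xi>)) \<in> borel_measurable lborel"
    by (intro borel_measurable_divide borel_measurable_norm borel_measurable_diff) auto
  then have m: "?f \<in> borel_measurable lborel"
    by (intro borel_measurable_times borel_measurable_indicator) auto
  have i: "integrable lborel ?f"
    using nn_integral_inverse_dist_le[OF assms]
    by (intro integrableI_nonneg m) (auto simp: less_top[symmetric] top_unique indicator_def)
  then show "set_integrable lebesgue (ball 0 1) (\<lambda>\<xi>. 1 / cmod (z - \<xi>))"
    unfolding set_integrable_def using i m by (simp add: integrable_completion)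
  have "(LINT \<xi>:ball 0 1|lebesgue. 1 / cmod (z - \<xi>)) = integral\<^sup>L lborel ?f"
    unfolding set_lebesgue_integral_def using m by (simp add: integral_completion)
  also have "\<dots> \<le> 8 * pi"
    using nn_integral_inverse_dist_le[OF assms] nn_integral_eq_integral[OF i]
    by (auto simp: indicator_def)
  finally show "(LINT \<xi>:ball 0 1|lebesgue. 1 / cmod (z - \<xi>)) \<le> 8 * pi" .
qed

section \<open>Pointwise estimates for the Green function\<close>

lemma abs_ln_diff_le:
  fixes x y :: real
  assumes "x > 0" "y > 0"
  shows "\<bar>ln x - ln y\<bar> \<le> \<bar>x - y\<bar> * (1 / x + 1 / y)"
proof -
  have *: "ln x - ln y \<le> \<bar>x - y\<bar> * (1 / x + 1 / y)" if "x > 0" "y > 0" for x y :: real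
  proof -
    have "ln x - ln y = ln (x / y)" using that by (simp add: ln_div)
    also have "\<dots> \<le> x / y - 1" using that by (intro ln_le_minus_one) simp
    also have "\<dots> = (x - y) / y" using that by (simp add: field_simps)
    also have "\<dots> \<le> \<bar>x - y\<bar> / y" using that by (intro divide_right_mono) auto
    also have "\<dots> \<le> \<bar>x - y\<bar> * (1 / x + 1 / y)" using that by (simp add: field_simps)
    finally show ?thesis .
  qed
  show ?thesis using *[of x y] *[of y x] assms by (auto simp: abs_real_def algebra_simps split: if_splits)
qed

text \<open>The difference of the squares factors into two nonnegative terms. Consequently the
  reflected logarithm in the Green function is never more singular than the logarithm of
  \<open>cmod (z - w)\<close>.\<close>

lemma cmod_diff_le_cmod_one_minus:
  assumes "cmod z \<le> 1" "cmod w \<le> 1"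
  shows "cmod (z - w) \<le> cmod (1 - z * cnj w)"
proof -
  have "(cmod (1 - z * cnj w))\<^sup>2 - (cmod (z - w))\<^sup>2 = (1 - (cmod z)\<^sup>2) * (1 - (cmod w)\<^sup>2)"
    unfolding cmod_power2 by (simp add: algebra_simps power2_eq_square)
  also have "\<dots> \<ge> 0" using assms by (intro mult_nonneg_nonneg) (auto simp: power_le_one)
  finally have "(cmod (z - w))\<^sup>2 \<le> (cmod (1 - z * cnj w))\<^sup>2" by linarith
  then show ?thesis by (rule power2_le_imp_le) simp
qed

lemma green_eq_ln_diff:
  assumes "cmod z < 1" "cmod w < 1" "z \<noteq> w"
  shows "green z w = (ln (cmod (1 - z * cnj w)) - ln (cmod (z - w))) / (2 * pi)"
proof -
  have "0 < cmod (z - w)" using assms by simp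
  moreover have "0 < cmod (1 - z * cnj w)"
    using cmod_diff_le_cmod_one_minus[of z w] assms calculation by linarith
  ultimately show ?thesis unfolding green_def by (simp add: norm_divide ln_div)
qed

text \<open>The two moduli under the logarithms differ by at most 2, and both reciprocals are at
  most \<open>1 / cmod (z - w)\<close>; the factor \<open>1 / (2 * pi)\<close> is simply bounded by
  1.\<close>

lemma abs_green_le:
  assumes "cmod z < 1" "cmod w < 1"
  shows "\<bar>green z w\<bar> \<le> 4 * (1 / cmod (z - w))"
proof (cases "z = w")
  case False
  then have p: "0 < cmod (z - w)" using assms by simp
  have q: "cmod (z - w) \<le> cmod (1 - z * cnj w)"
    using cmod_diff_le_cmod_one_minus[of z w] assms by simp
  have "cmod (1 - z * cnj w) \<le> 1 + cmod z * cmod w"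
    using norm_triangle_ineq4[of 1 "z * cnj w"] by (simp add: norm_mult)
  moreover have "cmod z * cmod w \<le> 1" using assms by (intro mult_le_one) auto
  ultimately have r: "\<bar>cmod (1 - z * cnj w) - cmod (z - w)\<bar> \<le> 2" using p q by linarith
  have s: "1 / cmod (1 - z * cnj w) \<le> 1 / cmod (z - w)" using p q by (intro divide_left_mono) (auto intro!: mult_pos_pos)
  have "\<bar>ln (cmod (1 - z * cnj w)) - ln (cmod (z - w))\<bar>
     \<le> \<bar>cmod (1 - z * cnj w) - cmod (z - w)\<bar> * (1 / cmod (1 - z * cnj w) + 1 / cmod (z - w))"
    using p q by (intro abs_ln_diff_le) auto
  also have "\<dots> \<le> 2 * (1 / cmod (z - w) + 1 / cmod (z - w))"
    using r s p q by (intro mult_mono) auto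
  finally have t: "\<bar>ln (cmod (1 - z * cnj w)) - ln (cmod (z - w))\<bar> \<le> 4 * (1 / cmod (z - w))" by simp
  have "\<bar>green z w\<bar> = \<bar>ln (cmod (1 - z * cnj w)) - ln (cmod (z - w))\<bar> / (2 * pi)"
    using green_eq_ln_diff[OF assms False] by simp
  also have "\<dots> \<le> \<bar>ln (cmod (1 - z * cnj w)) - ln (cmod (z - w))\<bar> / 1"
    using pi_gt3 by (intro divide_left_mono) auto
  finally show ?thesis using t by simp
\<comment> \<open>On the diagonal both sides are 0, by \<open>x / 0 = 0\<close> and
  \<open>ln 0 = 0\<close>.\<close>
qed (simp add: green_def)

lemma abs_green_diff_le:
  assumes "cmod z < 1" "cmod z' < 1" "cmod w < 1" "w \<noteq> z" "w \<noteq> z'"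
  shows "\<bar>green z w - green z' w\<bar> \<le> 2 * cmod (z - z') * (1 / cmod (z - w) + 1 / cmod (z' - w))"
proof -
  have p: "0 < cmod (z - w)" "0 < cmod (z' - w)" using assms by auto
  have q: "cmod (z - w) \<le> cmod (1 - z * cnj w)" "cmod (z' - w) \<le> cmod (1 - z' * cnj w)"
    using cmod_diff_le_cmod_one_minus[of _ w] assms by auto
  have "\<bar>ln (cmod (z - w)) - ln (cmod (z' - w))\<bar>
      \<le> \<bar>cmod (z - w) - cmod (z' - w)\<bar> * (1 / cmod (z - w) + 1 / cmod (z' - w))"
    using p by (intro abs_ln_diff_le) auto
  also have "\<dots> \<le> cmod (z - z') * (1 / cmod (z - w) + 1 / cmod (z' - w))"
    using norm_triangle_ineq3[of "z - w" "z' - w"] by (intro mult_right_mono) auto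
  finally have A: "\<bar>ln (cmod (z - w)) - ln (cmod (z' - w))\<bar>
      \<le> cmod (z - z') * (1 / cmod (z - w) + 1 / cmod (z' - w))" .
  have "\<bar>ln (cmod (1 - z * cnj w)) - ln (cmod (1 - z' * cnj w))\<bar>
      \<le> \<bar>cmod (1 - z * cnj w) - cmod (1 - z' * cnj w)\<bar>
         * (1 / cmod (1 - z * cnj w) + 1 / cmod (1 - z' * cnj w))"
    using p q by (intro abs_ln_diff_le) auto
  also have "\<dots> \<le> cmod (z - z') * (1 / cmod (z - w) + 1 / cmod (z' - w))"
  proof (rule mult_mono)
    \<comment> \<open>Multiplication by \<open>cnj w\<close> contracts distances, so the reflected
      logarithm obeys the same bound as the singular one.\<close>
    have "\<bar>cmod (1 - z * cnj w) - cmod (1 - z' * cnj w)\<bar> \<le> cmod ((1 - z * cnj w) - (1 - z' * cnj w))"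
      by (rule norm_triangle_ineq3)
    also have "\<dots> = cmod ((z' - z) * cnj w)" by (simp add: algebra_simps)
    also have "\<dots> = cmod (z - z') * cmod w" by (simp add: norm_mult norm_minus_commute)
    also have "\<dots> \<le> cmod (z - z') * 1" using assms by (intro mult_left_mono) auto
    finally show "\<bar>cmod (1 - z * cnj w) - cmod (1 - z' * cnj w)\<bar> \<le> cmod (z - z')" by simp
    show "1 / cmod (1 - z * cnj w) + 1 / cmod (1 - z' * cnj w) \<le> 1 / cmod (z - w) + 1 / cmod (z' - w)"
      using p q by (intro add_mono divide_left_mono mult_pos_pos) auto
  qed (use p q in auto)
  finally have B: "\<bar>ln (cmod (1 - z * cnj w)) - ln (cmod (1 - z' * cnj w))\<bar>
      \<le> cmod (z - z') * (1 / cmod (z - w) + 1 / cmod (z' - w))" .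
  define X where "X = (ln (cmod (1 - z * cnj w)) - ln (cmod (1 - z' * cnj w)))
     - (ln (cmod (z - w)) - ln (cmod (z' - w)))"
  have "green z w - green z' w = X / (2 * pi)"
    using green_eq_ln_diff[of z w] green_eq_ln_diff[of z' w] assms
    by (auto simp: X_def diff_divide_distrib)
  then have "\<bar>green z w - green z' w\<bar> = \<bar>X\<bar> / (2 * pi)" by simp
  also have "\<dots> \<le> \<bar>X\<bar> / 1" using pi_gt3 by (intro divide_left_mono) auto
  also have "\<bar>X\<bar> \<le> 2 * (cmod (z - z') * (1 / cmod (z - w) + 1 / cmod (z' - w)))"
    using A B unfolding X_def by linarith
  finally show ?thesis by simp
qed

section \<open>The Green potential as an operator on bounded functions\<close>

lemma green_potential_integrable:
  assumes "h \<in> borel_measurable (lebesgue_on (ball 0 1))" "\<And>w. cmod w < 1 \<Longrightarrow> cmod (h w) \<le> M" "cmod z < 1"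
  shows "set_integrable lebesgue (ball 0 1) (\<lambda>w. green z w *\<^sub>R h w)"
proof (rule measurable_bounded_by_integrable_imp_absolutely_integrable)
  have [measurable]: "(\<lambda>w. green z w) \<in> borel_measurable borel"
  proof -
    have [measurable]: "cnj \<in> borel_measurable borel"
      by (intro borel_measurable_continuous_onI continuous_intros)
    have [measurable]: "(\<lambda>w. z - w) \<in> borel_measurable borel"
      by (intro borel_measurable_continuous_onI continuous_intros)
    show ?thesis unfolding green_def by measurable
  qed
  then have "(\<lambda>w. green z w) \<in> borel_measurable (lebesgue_on (ball 0 1))"
    by (intro measurable_restrict_space1 measurable_completion) simp
  then show "(\<lambda>w. green z w *\<^sub>R h w) \<in> borel_measurable (lebesgue_on (ball 0 1))"
    using assms(1) by measurable
  show "(\<lambda>w. 4 * \<bar>M\<bar> * (1 / cmod (z - w))) integrable_on ball 0 1"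
    using integrable_cmul[OF set_lebesgue_integral_eq_integral(1)[OF inverse_dist_integrable(1)[OF assms(3)]], of "4 * \<bar>M\<bar>"]
    by simp
  fix w :: complex assume "w \<in> ball 0 1"
  then have w: "cmod w < 1" by simp
  have "norm (green z w *\<^sub>R h w) = \<bar>green z w\<bar> * cmod (h w)" by simp
  also have "\<dots> \<le> (4 * (1 / cmod (z - w))) * \<bar>M\<bar>"
    using abs_green_le[OF assms(3) w] assms(2)[OF w] by (intro mult_mono) auto
  finally show "norm (green z w *\<^sub>R h w) \<le> 4 * \<bar>M\<bar> * (1 / cmod (z - w))" by simp
qed auto

text \<open>The constant is 4 from \<open>abs_green_le\<close> times \<open>8 * pi\<close> from the
  integral of the inverse distance.\<close>

lemma green_potential_bounded:
  assumes "h \<in> borel_measurable (lebesgue_on (ball 0 1))" "\<And>w. cmod w < 1 \<Longrightarrow> cmod (h w) \<le> M" "cmod z < 1"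
  shows "cmod (green_potential h z) \<le> 32 * pi * M"
proof -
  have M: "M \<ge> 0" using assms(2)[of 0] norm_ge_zero[of "h 0"] by (simp del: norm_ge_zero)
  note int = inverse_dist_integrable[OF assms(3)]
  have "cmod (green_potential h z) = norm (integral (ball 0 1) (\<lambda>w. green z w *\<^sub>R h w))"
    unfolding green_potential_def
    by (subst set_lebesgue_integral_eq_integral(2)) (use green_potential_integrable[OF assms] in auto)
  also have "\<dots> \<le> integral (ball 0 1) (\<lambda>w. (4 * M) * (1 / cmod (z - w)))"
  proof (rule integral_norm_bound_integral)
    show "(\<lambda>w. green z w *\<^sub>R h w) integrable_on ball 0 1"
      using green_potential_integrable[OF assms] set_lebesgue_integral_eq_integral(1) by blast
    show "(\<lambda>w. 4 * M * (1 / cmod (z - w))) integrable_on ball 0 1"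
      using integrable_cmul[OF set_lebesgue_integral_eq_integral(1)[OF int(1)], of "4 * M"] by simp
    fix w :: complex assume "w \<in> ball 0 1"
    then have w: "cmod w < 1" by simp
    have "norm (green z w *\<^sub>R h w) = \<bar>green z w\<bar> * cmod (h w)" by simp
    also have "\<dots> \<le> (4 * (1 / cmod (z - w))) * M"
      using abs_green_le[OF assms(3) w] assms(2)[OF w] by (intro mult_mono) auto
    finally show "norm (green z w *\<^sub>R h w) \<le> 4 * M * (1 / cmod (z - w))" by simp
  qed
  also have "\<dots> = (4 * M) * integral (ball 0 1) (\<lambda>w. 1 / cmod (z - w))"
    by (rule integral_mult_right)
  also have "\<dots> \<le> (4 * M) * (8 * pi)"
    using int set_lebesgue_integral_eq_integral(2)[OF int(1)] M by (intro mult_left_mono) auto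
  finally show ?thesis by (simp add: mult_ac)
qed

text \<open>The constant is 2 from \<open>abs_green_diff_le\<close> times the sum of two inverse
  distance integrals, each at most \<open>8 * pi\<close>.\<close>

lemma green_potential_diff_le:
  assumes h: "h \<in> borel_measurable (lebesgue_on (ball 0 1))" "\<And>w. cmod w < 1 \<Longrightarrow> cmod (h w) \<le> M"
    and z: "cmod z < 1" "cmod z' < 1"
  shows "cmod (green_potential h z - green_potential h z') \<le> 32 * pi * M * cmod (z - z')"
proof -
  have M: "M \<ge> 0" using h(2)[of 0] norm_ge_zero[of "h 0"] by (simp del: norm_ge_zero)
  note int = inverse_dist_integrable[OF z(1)] inverse_dist_integrable[OF z(2)]
  note gi = green_potential_integrable[OF h z(1)] green_potential_integrable[OF h z(2)]
  note gi' = gi[THEN set_lebesgue_integral_eq_integral(1)]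
  note ii = int(1,3)[THEN set_lebesgue_integral_eq_integral(1)]
  have neg: "negligible {z, z'}" by simp
  have "green_potential h z - green_potential h z'
     = integral (ball 0 1) (\<lambda>w. green z w *\<^sub>R h w - green z' w *\<^sub>R h w)"
    unfolding green_potential_def using gi'
    by (simp add: integral_diff set_lebesgue_integral_eq_integral(2)[OF gi(1)]
      set_lebesgue_integral_eq_integral(2)[OF gi(2)])
  \<comment> \<open>The integrand is set to 0 at the two points where
    \<open>abs_green_diff_le\<close> does not apply.\<close>
  also have "\<dots> = integral (ball 0 1) (\<lambda>w. if w \<in> {z, z'} then 0 else green z w *\<^sub>R h w - green z' w *\<^sub>R h w)"
    by (rule integral_spike[OF neg]) auto
  finally have eq: "green_potential h z - green_potential h z'
     = integral (ball 0 1) (\<lambda>w. if w \<in> {z, z'} then 0 else green z w *\<^sub>R h w - green z' w *\<^sub>R h w)" .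
  have "norm (integral (ball 0 1) (\<lambda>w. if w \<in> {z, z'} then 0 else green z w *\<^sub>R h w - green z' w *\<^sub>R h w))
     \<le> integral (ball 0 1) (\<lambda>w. (2 * M * cmod (z - z')) * (1 / cmod (z - w) + 1 / cmod (z' - w)))"
  proof (rule integral_norm_bound_integral)
    show "(\<lambda>w. if w \<in> {z, z'} then 0 else green z w *\<^sub>R h w - green z' w *\<^sub>R h w) integrable_on ball 0 1"
      by (rule integrable_spike[OF integrable_diff[OF gi'] neg]) auto
    show "(\<lambda>w. (2 * M * cmod (z - z')) * (1 / cmod (z - w) + 1 / cmod (z' - w))) integrable_on ball 0 1"
      using integrable_cmul[OF integrable_add[OF ii], of "2 * M * cmod (z - z')"] by simp
    fix w :: complex assume "w \<in> ball 0 1"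
    then have w: "cmod w < 1" by simp
    show "norm (if w \<in> {z, z'} then 0 else green z w *\<^sub>R h w - green z' w *\<^sub>R h w)
       \<le> (2 * M * cmod (z - z')) * (1 / cmod (z - w) + 1 / cmod (z' - w))"
    proof (cases "w \<in> {z, z'}")
      case False
      have "norm (green z w *\<^sub>R h w - green z' w *\<^sub>R h w) = \<bar>green z w - green z' w\<bar> * cmod (h w)"
        by (simp add: scaleR_left_diff_distrib[symmetric])
      also have "\<dots> \<le> (2 * cmod (z - z') * (1 / cmod (z - w) + 1 / cmod (z' - w))) * M"
        using False by (intro mult_mono abs_green_diff_le h(2) z w) auto
      finally show ?thesis using False by (simp add: algebra_simps)
    qed (use M in auto)
  qed
  also have "\<dots> = (2 * M * cmod (z - z')) * (integral (ball 0 1) (\<lambda>w. 1 / cmod (z - w)) + integral (ball 0 1) (\<lambda>w. 1 / cmod (z' - w)))"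
    using integral_add[OF ii] by (simp only: integral_mult_right)
  also have "\<dots> \<le> (2 * M * cmod (z - z')) * (8 * pi + 8 * pi)"
    using int set_lebesgue_integral_eq_integral(2)[OF int(1)] set_lebesgue_integral_eq_integral(2)[OF int(3)] M
    by (intro mult_left_mono add_mono) auto
  finally show ?thesis unfolding eq by (simp add: algebra_simps)
qed

text \<open>The induction carries boundedness along with the Lipschitz property: the first supplies
  the bound on the next integrand, the second its continuity and hence measurability. It runs over
  \<open>Suc j\<close> because \<open>h\<close> itself is only continuous and bounded.\<close>

lemma iterated_green_potential_lipschitz:
  assumes "continuous_on (ball 0 1) h" "\<And>w. cmod w < 1 \<Longrightarrow> cmod (h w) \<le> M" "k \<ge> 1"
  shows "\<exists>L. L-lipschitz_on (ball 0 1) (iterated_green_potential k h)"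
proof -
  have step: "(\<exists>L. L-lipschitz_on (ball 0 1) (green_potential g)) \<and> (\<exists>M. \<forall>w. cmod w < 1 \<longrightarrow> cmod (green_potential g w) \<le> M)"
    if g: "continuous_on (ball 0 1) g" and M: "\<And>w. cmod w < 1 \<Longrightarrow> cmod (g w) \<le> M" for g M
  proof -
    have m: "g \<in> borel_measurable (lebesgue_on (ball 0 1))"
      using g by (intro continuous_imp_measurable_on_sets_lebesgue) auto
    have "M \<ge> 0" using M[of 0] norm_ge_zero[of "g 0"] by (simp del: norm_ge_zero)
    then have "(32 * pi * M)-lipschitz_on (ball 0 1) (green_potential g)"
      using green_potential_diff_le[OF m M] by (intro lipschitz_onI) (auto simp: dist_norm)
    then show ?thesis using green_potential_bounded[OF m M] by blast
  qed
  have "(\<exists>L. L-lipschitz_on (ball 0 1) ((green_potential ^^ Suc j) h))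
      \<and> (\<exists>M. \<forall>w. cmod w < 1 \<longrightarrow> cmod ((green_potential ^^ Suc j) h w) \<le> M)" for j
  proof (induction j)
    case 0 then show ?case using step[OF assms(1,2)] by simp
  next
    case (Suc j)
    then obtain L M where L: "L-lipschitz_on (ball 0 1) ((green_potential ^^ Suc j) h)"
      and M: "\<And>w. cmod w < 1 \<Longrightarrow> cmod ((green_potential ^^ Suc j) h w) \<le> M" by blast
    show ?case using step[OF lipschitz_on_continuous_on[OF L] M] by simp
  qed
  from this[of "k - 1"] show ?thesis using assms(3) by (simp add: iterated_green_potential_def)
qed

section \<open>The Koebe kernel\<close>

lemma periodic_integral_shift:
  fixes F :: "real \<Rightarrow> complex"
  assumes cont: "continuous_on UNIV F" and per: "\<And>t. F (t + 2 * pi) = F t"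
  shows "integral {a..a + 2 * pi} F = integral {0..2 * pi} F"
proof -
  \<comment> \<open>Wide enough that \<open>x\<close> and \<open>x + 2 * pi\<close> are interior
    points for every \<open>x\<close> between 0 and \<open>a\<close>, so that the primitive
    \<open>G\<close> has two-sided derivatives there.\<close>
  define N where "N = \<bar>a\<bar> + 2 * pi + 1"
  have N: "N > 0" unfolding N_def using pi_gt_zero by linarith
  obtain G where G: "\<And>x. x \<in> {-N..N} \<Longrightarrow> (G has_vector_derivative F x) (at x within {-N..N})"
    using antiderivative_continuous[OF continuous_on_subset[OF cont]] by blast
  have G': "(G has_vector_derivative F x) (at x)" if "x \<in> {-N<..<N}" for x
    using G[of x] that by (auto simp: at_within_Icc_at)
  have int: "integral {c..c + 2 * pi} F = G (c + 2 * pi) - G c" if "c \<in> {min a 0..max a 0}" for c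
  proof (rule integral_unique, rule fundamental_theorem_of_calculus)
    show "(G has_vector_derivative F x) (at x within {c..c + 2 * pi})" if "x \<in> {c..c + 2 * pi}" for x
      using that \<open>c \<in> _\<close> pi_gt3
      by (intro has_vector_derivative_at_within[OF G']) (auto simp: N_def min_def max_def abs_real_def split: if_splits)
  qed (use pi_gt_zero in auto)
  \<comment> \<open>By periodicity of \<open>F\<close> the increment of \<open>G\<close> over one
    period has derivative 0, so its values at \<open>a\<close> and at 0 agree.\<close>
  obtain k where "\<And>x. x \<in> {min a 0..max a 0} \<Longrightarrow> G (x + 2 * pi) - G x = k"
  proof (rule has_vector_derivative_zero_constant[of "{min a 0..max a 0}" "\<lambda>x. G (x + 2 * pi) - G x"])
    show "((\<lambda>x. G (x + 2 * pi) - G x) has_vector_derivative 0) (at x within {min a 0..max a 0})"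
      if x: "x \<in> {min a 0..max a 0}" for x
    proof -
      have "(G has_vector_derivative F (x + 2 * pi)) (at (x + 2 * pi))"
        using x pi_gt3 by (intro G') (auto simp: N_def min_def max_def abs_real_def split: if_splits)
      then have "((G \<circ> (\<lambda>x. x + 2 * pi)) has_vector_derivative 1 *\<^sub>R F (x + 2 * pi)) (at x)"
        by (intro vector_diff_chain_at) (auto intro!: derivative_eq_intros)
      moreover have "(G has_vector_derivative F x) (at x)"
        using x pi_gt3 by (intro G') (auto simp: N_def min_def max_def abs_real_def split: if_splits)
      ultimately have "((\<lambda>x. G (x + 2 * pi) - G x) has_vector_derivative F (x + 2 * pi) - F x) (at x)"
        unfolding o_def by (auto intro!: derivative_eq_intros)
      then show ?thesis using per by (simp add: has_vector_derivative_at_within)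
    qed
  qed auto
  from this[of a] this[of 0] show ?thesis using int[of a] int[of 0] by simp
qed

text \<open>Folding the circle at \<open>\<theta>\<close> turns a convolution into an integral over
  \<open>{0..pi}\<close> in which \<open>g\<close> enters through a symmetric sum or difference,
  according to the parity of the kernel.\<close>

lemma periodic_integral_fold:
  fixes F :: "real \<Rightarrow> complex"
  assumes cont: "continuous_on UNIV F" and per: "\<And>t. F (t + 2 * pi) = F t"
  shows "integral {0..2 * pi} F = integral {0..pi} (\<lambda>s. F (\<theta> + s) + F (\<theta> - s))"
proof -
  have i: "F integrable_on {c..d}" for c d
    by (rule integrable_continuous_interval) (rule continuous_on_subset[OF cont], simp)
  have c: "continuous_on A (\<lambda>s. F (\<theta> + s))" "continuous_on A (\<lambda>s. F (\<theta> - s))" for A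
    by (intro continuous_on_compose2[OF cont] continuous_intros subset_UNIV)+
  have "integral {0..2 * pi} F = integral {\<theta> - pi..\<theta> + pi} F"
    using periodic_integral_shift[OF assms, of "\<theta> - pi"] by (simp add: algebra_simps)
  also have "\<dots> = integral {\<theta> - pi..\<theta>} F + integral {\<theta>..\<theta> + pi} F"
    using pi_gt_zero by (intro Henstock_Kurzweil_Integration.integral_combine[symmetric] i) auto
  also have "integral {\<theta>..\<theta> + pi} F = integral {0..pi} (\<lambda>s. F (\<theta> + s))"
    using integral_shift_real_ivl[of \<theta> \<theta> "\<theta> + pi" F] by (simp add: add.commute)
  also have "integral {\<theta> - pi..\<theta>} F = integral {-pi..0} (\<lambda>s. F (\<theta> + s))"
    using integral_shift_real_ivl[of "\<theta> - pi" \<theta> \<theta> F] by (simp add: add.commute)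
  also have "\<dots> = integral {0..pi} (\<lambda>s. F (\<theta> - s))"
    using Henstock_Kurzweil_Integration.integral_reflect_real[of pi 0 "\<lambda>s. F (\<theta> - s)"] by simp
  finally show ?thesis
    using c by (subst integral_add) (auto intro!: integrable_continuous_interval)
qed

text \<open>This is \<open>z\<close> times the derivative of the Cauchy kernel
  \<open>1 / (1 - z)\<close>. Its real and imaginary parts therefore appear when a Poisson integral
  is differentiated in the radial and angular directions.\<close>

definition koebe :: "complex \<Rightarrow> complex" where
  "koebe z = z / (1 - z)\<^sup>2"

lemma one_minus_neq_zero: "cmod z < 1 \<Longrightarrow> 1 - z \<noteq> 0"
  by (metis eq_iff_diff_eq_0 less_irrefl norm_one)

lemma cnj_koebe: "cnj (koebe z) = koebe (cnj z)"
  by (simp add: koebe_def)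

text \<open>Boundary data are functions of the angle from here on. A Poisson integral is the
  transform of \<open>g\<close> plus the conjugate of the transform of the conjugate of
  \<open>g\<close>, up to a constant; see \<open>poisson_integral_eq\<close>.\<close>

definition cauchy_transform :: "(real \<Rightarrow> complex) \<Rightarrow> complex \<Rightarrow> complex" where
  "cauchy_transform g z = integral {0..2*pi} (\<lambda>t. g t / (1 - z * cis (-t))) / (2 * pi)"

definition koebe_transform :: "(real \<Rightarrow> complex) \<Rightarrow> complex \<Rightarrow> complex" where
  "koebe_transform g z = integral {0..2*pi} (\<lambda>t. g t * koebe (z * cis (-t))) / (2 * pi)"

lemma cauchy_transform_has_derivative:
  assumes g: "continuous_on {0..2*pi} g" and z: "cmod z < 1"
  obtains D where "(cauchy_transform g has_field_derivative D) (at z)" "z * D = koebe_transform g z"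
proof -
  let ?D = "integral (cbox 0 (2*pi)) (\<lambda>t. g t * cis (-t) / (1 - z * cis (-t))\<^sup>2)"
  have nz: "1 - w * cis (-t) \<noteq> 0" if "w \<in> ball 0 1" for w t
    by (rule one_minus_neq_zero) (use that in \<open>simp add: norm_mult\<close>)
  have "((\<lambda>w. integral (cbox 0 (2*pi)) (\<lambda>t. g t / (1 - w * cis (-t)))) has_field_derivative ?D) (at z within ball 0 1)"
  proof (rule leibniz_rule_field_derivative[where fx = "\<lambda>w t. g t * cis (-t) / (1 - w * cis (-t))\<^sup>2"])
    show "((\<lambda>w. g t / (1 - w * cis (-t))) has_field_derivative g t * cis (-t) / (1 - w * cis (-t))\<^sup>2) (at w within ball 0 1)"
      if "w \<in> ball 0 1" for w t
      using nz[OF that, of t] by (auto intro!: derivative_eq_intros simp: power2_eq_square)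
    show "(\<lambda>t. g t / (1 - w * cis (-t))) integrable_on cbox 0 (2*pi)" if "w \<in> ball 0 1" for w
      using nz[OF that] g by (intro integrable_continuous continuous_intros) auto
    have "continuous_on (ball 0 1 \<times> cbox 0 (2*pi)) (\<lambda>p. g (snd p))"
      by (rule continuous_on_compose2[OF g]) (auto intro!: continuous_intros)
    then show "continuous_on (ball 0 1 \<times> cbox 0 (2*pi)) (\<lambda>(w,t). g t * cis (-t) / (1 - w * cis (-t))\<^sup>2)"
      using nz unfolding split_beta by (intro continuous_intros) auto
  qed (use z in auto)
  then have d: "((\<lambda>w. integral {0..2*pi} (\<lambda>t. g t / (1 - w * cis (-t)))) has_field_derivative ?D) (at z)"
    using z by (subst (asm) at_within_open) auto
  have der: "(cauchy_transform g has_field_derivative ?D / (2*pi)) (at z)"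
    unfolding cauchy_transform_def by (rule DERIV_cdivide[OF d])
  have "koebe_transform g z = integral {0..2*pi} (\<lambda>t. z * (g t * cis (-t) / (1 - z * cis (-t))\<^sup>2)) / (2*pi)"
    unfolding koebe_transform_def koebe_def by (simp add: mult_ac)
  also have "\<dots> = z * (?D / (2*pi))"
    by (subst integral_mult_right) simp
  finally have "z * (?D / (2*pi)) = koebe_transform g z" ..
  then show ?thesis using that der by blast
qed

lemma cauchy_transform_holomorphic:
  assumes "continuous_on {0..2*pi} g"
  shows "cauchy_transform g holomorphic_on ball 0 1"
  using cauchy_transform_has_derivative[OF assms]
  by (metis field_differentiable_at_within field_differentiable_def holomorphic_on_def mem_ball_0)

lemma koebe_transform_eq_deriv:
  assumes "continuous_on {0..2*pi} g" "cmod z < 1"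
  shows "koebe_transform g z = z * deriv (cauchy_transform g) z"
  using cauchy_transform_has_derivative[OF assms] by (metis DERIV_imp_deriv)

lemma koebe_transform_holomorphic:
  assumes "continuous_on {0..2*pi} g"
  shows "koebe_transform g holomorphic_on ball 0 1"
proof -
  have "(\<lambda>z. z * deriv (cauchy_transform g) z) holomorphic_on ball 0 1"
    by (intro holomorphic_intros cauchy_transform_holomorphic[OF assms]) auto
  then show ?thesis
    by (rule holomorphic_transform) (simp add: koebe_transform_eq_deriv[OF assms])
qed

lemma circle_mean_value:
  fixes h :: "complex \<Rightarrow> complex"
  assumes h: "continuous_on (cball 0 1) h" "h holomorphic_on ball 0 1"
  shows "((\<lambda>t. h (cis t)) has_integral 2 * pi * h 0) {0..2*pi}"
proof -
  have "((\<lambda>u. h u / (u - 0)) has_contour_integral (2 * of_real pi * \<i> * h 0)) (circlepath 0 1)"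
    by (rule Cauchy_integral_circlepath[OF h]) simp
  then have "((\<lambda>t. h (cis t) * \<i>) has_integral 2 * of_real pi * \<i> * h 0) {0..2*pi}"
    unfolding circlepath_def by (simp add: has_contour_integral_part_circlepath_iff)
  from has_integral_mult_left[OF this, of "-\<i>"] show ?thesis by (simp add: mult_ac)
qed

text \<open>Cauchy's formula for the derivative: the kernel equals
  \<open>z * cis t / (cis t - z)^2\<close>, and the factor \<open>cis t\<close> is what the
  parametrization of the circle contributes.\<close>

lemma koebe_transform_cis:
  assumes h: "continuous_on (cball 0 1) h" "h holomorphic_on ball 0 1" and z: "cmod z < 1"
  shows "koebe_transform (\<lambda>t. h (cis t)) z = z * deriv h z"
proof -
  have "(\<lambda>u. h u / (u - z)\<^sup>2) contour_integrable_on circlepath 0 1"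
    using Cauchy_derivative_integral_circlepath(1)[OF h] z by simp
  then have "((\<lambda>u. h u / (u - z)\<^sup>2) has_contour_integral (2 * pi * \<i>) * deriv h z) (circlepath 0 1)"
    using Cauchy_contour_integral_circlepath_2[OF h] z has_contour_integral_integral by fastforce
  then have "((\<lambda>t. h (cis t) / (cis t - z)\<^sup>2 * \<i> * cis t) has_integral 2 * pi * \<i> * deriv h z) {0..2*pi}"
    unfolding circlepath_def by (simp add: has_contour_integral_part_circlepath_iff)
  from has_integral_mult_left[OF this, of "-\<i> * z"]
  have "((\<lambda>t. h (cis t) / (cis t - z)\<^sup>2 * cis t * z) has_integral 2 * pi * (z * deriv h z)) {0..2*pi}"
    by (simp add: mult_ac)
  also have "(\<lambda>t. h (cis t) / (cis t - z)\<^sup>2 * cis t * z) = (\<lambda>t. h (cis t) * koebe (z * cis (-t)))"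
  proof
    fix t
    have "cis t - z = cis t * (1 - z * cis (-t))" by (simp add: algebra_simps cis_mult)
    then have "(cis t - z)\<^sup>2 = cis t * (cis t * (1 - z * cis (-t))\<^sup>2)"
      by (simp add: power2_eq_square mult_ac)
    then have "h (cis t) / (cis t - z)\<^sup>2 * cis t * z = h (cis t) * (z / (cis t * (1 - z * cis (-t))\<^sup>2))"
      by simp
    also have "z / (cis t * (1 - z * cis (-t))\<^sup>2) = koebe (z * cis (-t))"
      by (simp add: koebe_def cis_inverse[symmetric] field_simps del: cis_inverse)
    finally show "h (cis t) / (cis t - z)\<^sup>2 * cis t * z = h (cis t) * koebe (z * cis (-t))" .
  qed
  finally show ?thesis unfolding koebe_transform_def by (simp add: integral_unique)
qed

text \<open>Antiholomorphic boundary values are annihilated: the conjugate of the integrand is the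
  boundary value of \<open>h w * koebe (cnj z * w)\<close>, which is holomorphic and vanishes at 0,
  so its mean over the circle is 0.\<close>

lemma koebe_transform_cnj_cis:
  assumes h: "continuous_on (cball 0 1) h" "h holomorphic_on ball 0 1" and z: "cmod z < 1"
  shows "koebe_transform (\<lambda>t. cnj (h (cis t))) z = 0"
proof -
  let ?H = "\<lambda>w. h w * koebe (cnj z * w)"
  have nz: "1 - cnj z * w \<noteq> 0" if "cmod w \<le> 1" for w
  proof (rule one_minus_neq_zero)
    have "cmod (cnj z * w) \<le> cmod z * 1" unfolding norm_mult using that by (intro mult_mono) auto
    then show "cmod (cnj z * w) < 1" using z by simp
  qed
  have "((\<lambda>t. ?H (cis t)) has_integral 2 * pi * ?H 0) {0..2*pi}"
  proof (rule circle_mean_value)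
    show "continuous_on (cball 0 1) ?H"
      unfolding koebe_def using nz by (intro continuous_intros h) auto
    show "?H holomorphic_on ball 0 1"
      unfolding koebe_def using nz by (intro holomorphic_intros h) (auto simp: less_imp_le)
  qed
  then have "((\<lambda>t. cnj (?H (cis t))) has_integral cnj (2 * pi * ?H 0)) {0..2*pi}"
    by (subst has_integral_cnj[unfolded o_def])
  then have "((\<lambda>t. cnj (?H (cis t))) has_integral 0) {0..2*pi}"
    by (simp add: koebe_def)
  then show ?thesis
    unfolding koebe_transform_def by (simp add: integral_unique cnj_koebe cis_cnj)
qed

text \<open>For \<open>u = P[\<phi>]\<close> and \<open>g(t) = \<phi>(e\<^sup>i\<^sup>t)\<close> these are \<open>r u\<^sub>r\<close> and \<open>u\<^sub>\<theta>\<close>.\<close>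

definition radial_op :: "(real \<Rightarrow> complex) \<Rightarrow> complex \<Rightarrow> complex" where
  "radial_op g z = koebe_transform g z + cnj (koebe_transform (\<lambda>t. cnj (g t)) z)"

definition angular_op :: "(real \<Rightarrow> complex) \<Rightarrow> complex \<Rightarrow> complex" where
  "angular_op g z = \<i> * (koebe_transform g z - cnj (koebe_transform (\<lambda>t. cnj (g t)) z))"

section \<open>The real kernels in polar coordinates\<close>

lemma continuous_koebe_cis:
  assumes "cmod z < 1"
  shows "continuous_on A (\<lambda>t. koebe (z * cis (-t)))"
proof -
  have "1 - z * cis (-t) \<noteq> 0" for t
    by (rule one_minus_neq_zero) (use assms in \<open>simp add: norm_mult\<close>)
  then show ?thesis unfolding koebe_def by (intro continuous_intros) auto
qed

lemma koebe_transform_cnj: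
  assumes "continuous_on {0..2*pi} g" "cmod z < 1"
  shows "cnj (koebe_transform (\<lambda>t. cnj (g t)) z) = integral {0..2*pi} (\<lambda>t. g t * cnj (koebe (z * cis (-t)))) / (2 * pi)"
  unfolding koebe_transform_def by (simp add: integral_cnj)

lemma radial_op_eq:
  assumes "continuous_on {0..2*pi} g" "cmod z < 1"
  shows "radial_op g z = integral {0..2*pi} (\<lambda>t. g t * Re (koebe (z * cis (-t)))) / pi"
proof -
  have c: "continuous_on {0..2*pi} (\<lambda>t. g t * koebe (z * cis (-t)))" "continuous_on {0..2*pi} (\<lambda>t. g t * cnj (koebe (z * cis (-t))))"
    using assms continuous_koebe_cis by (auto intro!: continuous_intros)
  have "radial_op g z = integral {0..2*pi} (\<lambda>t. g t * koebe (z * cis (-t)) + g t * cnj (koebe (z * cis (-t)))) / (2 * pi)"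
    unfolding radial_op_def koebe_transform_cnj[OF assms] using c
    by (subst integral_add) (auto intro!: integrable_continuous_interval simp: koebe_transform_def add_divide_distrib)
  also have "(\<lambda>t. g t * koebe (z * cis (-t)) + g t * cnj (koebe (z * cis (-t)))) = (\<lambda>t. 2 * (g t * Re (koebe (z * cis (-t)))))"
    by (simp add: fun_eq_iff complex_add_cnj flip: distrib_left)
  finally show ?thesis by simp
qed

lemma angular_op_eq:
  assumes "continuous_on {0..2*pi} g" "cmod z < 1"
  shows "angular_op g z = - integral {0..2*pi} (\<lambda>t. g t * Im (koebe (z * cis (-t)))) / pi"
proof -
  have c: "continuous_on {0..2*pi} (\<lambda>t. g t * koebe (z * cis (-t)))" "continuous_on {0..2*pi} (\<lambda>t. g t * cnj (koebe (z * cis (-t))))"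
    using assms continuous_koebe_cis by (auto intro!: continuous_intros)
  have "angular_op g z = \<i> * integral {0..2*pi} (\<lambda>t. g t * koebe (z * cis (-t)) - g t * cnj (koebe (z * cis (-t)))) / (2 * pi)"
    unfolding angular_op_def koebe_transform_cnj[OF assms] using c
    by (subst integral_diff) (auto intro!: integrable_continuous_interval simp: koebe_transform_def diff_divide_distrib right_diff_distrib)
  also have "(\<lambda>t. g t * koebe (z * cis (-t)) - g t * cnj (koebe (z * cis (-t)))) = (\<lambda>t. (2 * \<i>) * (g t * Im (koebe (z * cis (-t)))))"
    by (simp add: fun_eq_iff complex_diff_cnj flip: right_diff_distrib)
  finally show ?thesis by (simp only: integral_mult_right) simp
qed

lemma koebe_polar:
  fixes r :: real
  assumes "0 \<le> r" "r < 1"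
  shows "Re (koebe (r * cis s)) = r * ((1 + r\<^sup>2) * cos s - 2 * r) / (1 - 2 * r * cos s + r\<^sup>2)\<^sup>2"
    and "Im (koebe (r * cis s)) = r * (1 - r\<^sup>2) * sin s / (1 - 2 * r * cos s + r\<^sup>2)\<^sup>2"
proof -
  let ?z = "r * cis s"
  have sc: "(sin s)\<^sup>2 = 1 - (cos s)\<^sup>2" by (simp add: sin_squared_eq)
  have n: "(cmod (1 - ?z))\<^sup>2 = 1 - 2 * r * cos s + r\<^sup>2"
    unfolding cmod_power2 by (simp add: power2_diff power_mult_distrib sc algebra_simps)
  have "koebe ?z = ?z * cnj ((1 - ?z)\<^sup>2) / of_real ((1 - 2 * r * cos s + r\<^sup>2)\<^sup>2)"
    unfolding koebe_def by (subst complex_div_cnj) (simp add: norm_power n)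
  also have "?z * cnj ((1 - ?z)\<^sup>2) = ?z - 2 * (?z * cnj ?z) + ?z * cnj ?z * cnj ?z"
    by (simp add: power2_eq_square algebra_simps)
  also have "?z * cnj ?z = of_real (r\<^sup>2)"
    by (simp only: complex_norm_square[symmetric] norm_mult norm_of_real norm_cis) simp
  also have "?z - 2 * of_real (r\<^sup>2) + of_real (r\<^sup>2) * cnj ?z
      = Complex (r * ((1 + r\<^sup>2) * cos s - 2 * r)) (r * (1 - r\<^sup>2) * sin s)"
    by (simp add: complex_eq_iff power2_eq_square algebra_simps)
  finally have "koebe ?z = Complex (r * ((1 + r\<^sup>2) * cos s - 2 * r)) (r * (1 - r\<^sup>2) * sin s) / of_real ((1 - 2 * r * cos s + r\<^sup>2)\<^sup>2)"
    by simp
  then show "Re (koebe ?z) = r * ((1 + r\<^sup>2) * cos s - 2 * r) / (1 - 2 * r * cos s + r\<^sup>2)\<^sup>2"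
    and "Im (koebe ?z) = r * (1 - r\<^sup>2) * sin s / (1 - 2 * r * cos s + r\<^sup>2)\<^sup>2"
    by (simp_all only: Re_divide_of_real Im_divide_of_real complex.sel)
qed

lemma koebe_neg: "koebe (of_real r * cis (-s)) = cnj (koebe (of_real r * cis s))"
  by (simp add: cnj_koebe cis_cnj)

text \<open>Replacing \<open>cos s\<close> by the larger \<open>cos \<delta>\<close> leaves
  \<open>(r - cos \<delta>)^2 + (sin \<delta>)^2\<close>. The bound is uniform in \<open>r\<close>,
  so away from \<open>s = 0\<close> the kernels stay bounded as \<open>r\<close> tends to 1.\<close>

lemma poisson_denominator_ge:
  assumes "0 \<le> (r::real)" "0 \<le> \<delta>" "\<delta> \<le> s" "s \<le> pi"
  shows "(sin \<delta>)\<^sup>2 \<le> 1 - 2 * r * cos s + r\<^sup>2"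
proof -
  have "cos s \<le> cos \<delta>" using assms by (intro cos_monotone_0_pi_le) auto
  then have "r * cos s \<le> r * cos \<delta>" using assms by (intro mult_left_mono) auto
  moreover have "0 \<le> (r - cos \<delta>)\<^sup>2" by simp
  ultimately show ?thesis by (simp add: power2_diff mult.assoc sin_squared_eq)
qed

text \<open>The real part of the kernel is even in the angle and the imaginary part odd
  (\<open>koebe_neg\<close>), hence the sum of two values of \<open>g\<close> here and the
  difference in \<open>angular_op_polar\<close>.\<close>

lemma radial_op_polar:
  fixes g :: "real \<Rightarrow> complex" and r :: real
  assumes g: "continuous_on UNIV g" "\<And>t. g (t + 2 * pi) = g t" and r: "0 \<le> r" "r < 1"
  shows "radial_op g (r * cis \<theta>) = integral {0..pi} (\<lambda>s. (g (\<theta> + s) + g (\<theta> - s)) * Re (koebe (r * cis s))) / pi"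
proof -
  let ?F = "\<lambda>t. g t * Re (koebe (r * cis (\<theta> - t)))"
  have z: "cmod (r * cis \<theta>) < 1" using r by (simp add: norm_mult)
  have e: "r * cis \<theta> * cis (-t) = r * cis (\<theta> - t)" for t by (simp add: cis_mult mult.assoc)
  have "continuous_on UNIV (\<lambda>t. koebe (r * cis (\<theta> - t)))"
    using continuous_koebe_cis[OF z] by (simp only: e)
  then have c: "continuous_on UNIV ?F" by (intro continuous_intros g)
  have p: "?F (t + 2 * pi) = ?F t" for t
    by (simp add: g(2) cis.ctr cos_diff sin_diff)
  have "radial_op g (r * cis \<theta>) = integral {0..2*pi} ?F / pi"
    by (subst radial_op_eq) (use z g(1) in \<open>auto simp: e intro: continuous_on_subset\<close>)
  also have "integral {0..2*pi} ?F = integral {0..pi} (\<lambda>s. ?F (\<theta> + s) + ?F (\<theta> - s))"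
    by (rule periodic_integral_fold[OF c p])
  also have "(\<lambda>s. ?F (\<theta> + s) + ?F (\<theta> - s)) = (\<lambda>s. (g (\<theta> + s) + g (\<theta> - s)) * Re (koebe (r * cis s)))"
    using koebe_neg[of r] by (simp add: fun_eq_iff algebra_simps)
  finally show ?thesis .
qed

lemma angular_op_polar:
  fixes g :: "real \<Rightarrow> complex" and r :: real
  assumes g: "continuous_on UNIV g" "\<And>t. g (t + 2 * pi) = g t" and r: "0 \<le> r" "r < 1"
  shows "angular_op g (r * cis \<theta>) = integral {0..pi} (\<lambda>s. (g (\<theta> + s) - g (\<theta> - s)) * Im (koebe (r * cis s))) / pi"
proof -
  let ?F = "\<lambda>t. g t * Im (koebe (r * cis (\<theta> - t)))"
  have z: "cmod (r * cis \<theta>) < 1" using r by (simp add: norm_mult)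
  have e: "r * cis \<theta> * cis (-t) = r * cis (\<theta> - t)" for t by (simp add: cis_mult mult.assoc)
  have "continuous_on UNIV (\<lambda>t. koebe (r * cis (\<theta> - t)))"
    using continuous_koebe_cis[OF z] by (simp only: e)
  then have c: "continuous_on UNIV ?F" by (intro continuous_intros g)
  have p: "?F (t + 2 * pi) = ?F t" for t
    by (simp add: g(2) cis.ctr cos_diff sin_diff)
  have "angular_op g (r * cis \<theta>) = - integral {0..2*pi} ?F / pi"
    by (subst angular_op_eq) (use z g(1) in \<open>auto simp: e intro: continuous_on_subset\<close>)
  also have "integral {0..2*pi} ?F = integral {0..pi} (\<lambda>s. ?F (\<theta> + s) + ?F (\<theta> - s))"
    by (rule periodic_integral_fold[OF c p])
  also have "(\<lambda>s. ?F (\<theta> + s) + ?F (\<theta> - s)) = (\<lambda>s. - ((g (\<theta> + s) - g (\<theta> - s)) * Im (koebe (r * cis s))))"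
    using koebe_neg[of r] by (simp add: fun_eq_iff algebra_simps)
  finally show ?thesis by simp
qed

lemma continuous_koebe_polar:
  fixes r :: real
  assumes "0 \<le> r" "r < 1"
  shows "continuous_on A (\<lambda>s. koebe (r * cis s))"
proof -
  have "1 - r * cis s \<noteq> 0" for s
    by (rule one_minus_neq_zero) (use assms in \<open>simp add: norm_mult\<close>)
  then show ?thesis unfolding koebe_def by (intro continuous_intros) auto
qed

lemma integral_of_real_eq:
  assumes "f integrable_on S"
  shows "integral S (\<lambda>x. complex_of_real (f x)) = of_real (integral S f)"
  by (rule integral_unique) (rule has_integral_of_real[OF integrable_integral[OF assms]])

text \<open>The radial derivative of a constant is 0. This is what allows
  \<open>2 * g \<theta>\<close> to be subtracted in the folded integral, so that a second difference
  of \<open>g\<close> faces the singularity.\<close>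

lemma integral_Re_koebe:
  fixes r :: real
  assumes r: "0 \<le> r" "r < 1"
  shows "integral {0..pi} (\<lambda>s. Re (koebe (r * cis s))) = 0"
proof -
  have "koebe_transform (\<lambda>t. 1) (of_real r) = 0"
    using koebe_transform_cis[of "\<lambda>_. 1" "of_real r"] r by simp
  then have "radial_op (\<lambda>_. 1) (r * cis 0) = 0" by (simp add: radial_op_def)
  moreover have "radial_op (\<lambda>_. 1) (r * cis 0)
      = integral {0..pi} (\<lambda>s. (1 + 1) * complex_of_real (Re (koebe (r * cis s)))) / complex_of_real pi"
    by (rule radial_op_polar) (use r in auto)
  ultimately have "integral {0..pi} (\<lambda>s. 2 * of_real (Re (koebe (r * cis s)))) = (0::complex)"
    by simp
  then have "of_real (integral {0..pi} (\<lambda>s. 2 * Re (koebe (r * cis s)))) = (0::complex)"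
    by (subst integral_of_real_eq[symmetric])
      (use r in \<open>auto intro!: integrable_continuous_interval continuous_intros continuous_koebe_polar\<close>)
  then show ?thesis by simp
qed

text \<open>Tested on \<open>cis\<close>, whose harmonic extension is the identity,
  \<open>angular_op\<close> gives \<open>\<i> * z\<close>; at \<open>z = r\<close> this is the
  integral. Scaled by \<open>2 / pi\<close> the weight is a kernel of mass \<open>r\<close>.\<close>

lemma integral_sin_Im_koebe:
  fixes r :: real
  assumes r: "0 \<le> r" "r < 1"
  shows "integral {0..pi} (\<lambda>s. sin s * Im (koebe (r * cis s))) = pi * r / 2"
proof -
  have "koebe_transform cis (of_real r) = r"
    using koebe_transform_cis[of "\<lambda>z. z" "of_real r"] r by (simp add: continuous_on_id)
  moreover have "koebe_transform (\<lambda>t. cnj (cis t)) (of_real r) = 0"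
    using koebe_transform_cnj_cis[of "\<lambda>z. z" "of_real r"] r by (simp add: continuous_on_id)
  ultimately have "angular_op cis (r * cis 0) = \<i> * r" by (simp add: angular_op_def)
  moreover have "cis (t + 2 * pi) = cis t" for t by (simp add: complex_eq_iff)
  then have "angular_op cis (r * cis 0) = integral {0..pi} (\<lambda>s. (cis (0 + s) - cis (0 - s)) * of_real (Im (koebe (r * cis s)))) / pi"
    by (intro angular_op_polar) (use r in \<open>auto intro!: continuous_intros\<close>)
  moreover have "(\<lambda>s. (cis (0 + s) - cis (0 - s)) * of_real (Im (koebe (r * cis s))))
      = (\<lambda>s. (2 * \<i>) * of_real (sin s * Im (koebe (r * cis s))))"
    by (simp add: fun_eq_iff complex_eq_iff)
  ultimately have "integral {0..pi} (\<lambda>s. (2 * \<i>) * of_real (sin s * Im (koebe (r * cis s)))) / pi = \<i> * r"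
    by (simp only:)
  then have "integral {0..pi} (\<lambda>s. (2 * \<i>) * of_real (sin s * Im (koebe (r * cis s)))) = \<i> * r * pi"
    by (simp only: nonzero_divide_eq_eq of_real_eq_0_iff pi_neq_zero not_False_eq_True)
  then have "2 * \<i> * of_real (integral {0..pi} (\<lambda>s. sin s * Im (koebe (r * cis s)))) = \<i> * r * pi"
    unfolding integral_mult_right
    by (subst integral_of_real_eq[symmetric])
      (use r in \<open>auto intro!: integrable_continuous_interval continuous_intros continuous_koebe_polar\<close>)
  then show ?thesis by (simp add: complex_eq_iff field_simps)
qed

section \<open>Boundary behaviour and the Hilbert transform\<close>

lemma mult_cos_le_sin:
  assumes "0 \<le> x" "x \<le> pi"
  shows "x * cos x \<le> sin x"
proof -
  have "sin 0 - 0 * cos 0 \<le> sin x - x * cos x"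
  proof (rule DERIV_nonneg_imp_nondecreasing[OF assms(1)])
    fix y assume y: "0 \<le> y" "y \<le> x"
    have "((\<lambda>y. sin y - y * cos y) has_real_derivative y * sin y) (at y)"
      by (auto intro!: derivative_eq_intros)
    then show "\<exists>d. ((\<lambda>y. sin y - y * cos y) has_real_derivative d) (at y) \<and> 0 \<le> d"
      using y assms by (intro exI[of _ "y * sin y"] conjI mult_nonneg_nonneg sin_ge_zero) auto
  qed
  then show ?thesis by simp
qed

text \<open>Using \<open>mult_cos_le_sin\<close> at \<open>x / 2\<close> leaves the factor
  \<open>(cos (x/2))^2 = (1 + cos x) / 2\<close>, which is at least 1/2 up to \<open>pi / 2\<close>.
  The constant is not sharp.\<close>

lemma half_le_sin:
  assumes "0 \<le> x" "x \<le> pi / 2"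
  shows "x / 2 \<le> sin x"
proof -
  have c: "0 \<le> cos (x/2)" using assms by (intro cos_ge_zero) auto
  have "x / 2 \<le> x * ((1 + cos x) / 2)"
    using assms cos_ge_zero[of x] by (simp add: mult_left_mono field_simps)
  also have "(1 + cos x) / 2 = cos (x/2) * cos (x/2)"
    using cos_double_cos[of "x/2"] by (simp add: power2_eq_square)
  also have "x * (cos (x/2) * cos (x/2)) = 2 * (x/2 * cos (x/2)) * cos (x/2)" by simp
  also have "\<dots> \<le> 2 * sin (x/2) * cos (x/2)"
    using mult_cos_le_sin[of "x/2"] assms c by (intro mult_right_mono) auto
  also have "\<dots> = sin x" using sin_double[of "x/2"] by simp
  finally show ?thesis .
qed

text \<open>The bound also has to decay as \<open>s\<close> approaches \<open>pi\<close>, where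
  \<open>\<theta> + s\<close> and \<open>\<theta> - s\<close> become the same point of the circle.
  The weight \<open>sin s\<close> is chosen because its integral against the kernel is known
  exactly.\<close>

lemma lipschitz_symmetric_diff:
  fixes g :: "real \<Rightarrow> complex"
  assumes per: "\<And>t. g (t + 2 * pi) = g t" and lip: "C-lipschitz_on UNIV g" and s: "0 \<le> s" "s \<le> pi"
  shows "cmod (g (\<theta> + s) - g (\<theta> - s)) \<le> 4 * C * sin s"
proof -
  have C: "C \<ge> 0" using lip by (rule lipschitz_on_nonneg)
  have l: "cmod (g x - g y) \<le> C * \<bar>x - y\<bar>" for x y
    using lipschitz_onD[OF lip, of x y] by (simp add: dist_norm)
  show ?thesis
  proof (cases "s \<le> pi / 2")
    case True
    have "cmod (g (\<theta> + s) - g (\<theta> - s)) \<le> C * (2 * s)"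
      using l[of "\<theta> + s" "\<theta> - s"] s by simp
    also have "\<dots> \<le> C * (4 * sin s)" using half_le_sin[of s] s True C by (intro mult_left_mono) auto
    finally show ?thesis by simp
  next
    case False
    \<comment> \<open>After a shift by one period the two arguments are only
      \<open>2 * (pi - s)\<close> apart.\<close>
    have "cmod (g (\<theta> + s) - g (\<theta> - s)) = cmod (g (\<theta> + s) - g (\<theta> - s + 2 * pi))" by (simp only: per)
    also have "\<dots> \<le> C * (2 * (pi - s))"
      using l[of "\<theta> + s" "\<theta> - s + 2 * pi"] s by simp
    also have "\<dots> \<le> C * (4 * sin (pi - s))"
      using half_le_sin[of "pi - s"] s False C by (intro mult_left_mono) auto
    finally show ?thesis by simp
  qed
qed

lemma has_vector_derivative_translate:
  fixes g :: "real \<Rightarrow> 'a::real_normed_vector"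
  assumes "(g has_vector_derivative c) (at (\<theta> + s))"
  shows "((\<lambda>s. g (\<theta> + s)) has_vector_derivative c) (at s)"
proof -
  have "((\<lambda>s. \<theta> + s) has_vector_derivative 1) (at s)"
    by (auto intro!: derivative_eq_intros)
  from vector_diff_chain_at[OF this] assms show ?thesis by (auto simp: o_def)
qed

lemma has_vector_derivative_reflect_about:
  fixes g :: "real \<Rightarrow> 'a::real_normed_vector"
  assumes "(g has_vector_derivative c) (at (\<theta> - s))"
  shows "((\<lambda>s. g (\<theta> - s)) has_vector_derivative - c) (at s)"
proof -
  have "((\<lambda>s. \<theta> - s) has_vector_derivative -1) (at s)"
    by (auto intro!: derivative_eq_intros)
  from vector_diff_chain_at[OF this] assms show ?thesis by (auto simp: o_def)
qed

lemma Im_koebe_nonneg: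
  fixes r :: real
  assumes r: "0 \<le> r" "r < 1" and s: "0 \<le> s" "s \<le> pi"
  shows "0 \<le> Im (koebe (r * cis s))"
  using r s by (simp add: koebe_polar sin_ge_zero power_le_one)

text \<open>The kernel is nonnegative on \<open>{0..pi}\<close>, so the bound
  \<open>4 * C * sin s\<close> on the difference integrates to at most
  \<open>4 * C * pi / 2\<close>, uniformly in \<open>r\<close> and \<open>\<theta>\<close>.\<close>

lemma angular_op_bounded:
  fixes g :: "real \<Rightarrow> complex" and r :: real
  assumes per: "\<And>t. g (t + 2 * pi) = g t" and lip: "C-lipschitz_on UNIV g" and r: "0 \<le> r" "r < 1"
  shows "cmod (angular_op g (r * cis \<theta>)) \<le> 2 * C"
proof -
  have g: "continuous_on UNIV g" using lip by (rule lipschitz_on_continuous_on)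
  have cg: "continuous_on A (\<lambda>s. g (\<theta> + s))" "continuous_on A (\<lambda>s. g (\<theta> - s))" for A
    by (intro continuous_on_compose2[OF g] continuous_intros subset_UNIV)+
  have C: "C \<ge> 0" using lip by (rule lipschitz_on_nonneg)
  have "cmod (integral {0..pi} (\<lambda>s. (g (\<theta> + s) - g (\<theta> - s)) * Im (koebe (r * cis s))))
      \<le> integral {0..pi} (\<lambda>s. (4 * C) * (sin s * Im (koebe (r * cis s))))"
  proof (rule integral_norm_bound_integral)
    fix s assume s: "s \<in> {0..pi}"
    have "norm ((g (\<theta> + s) - g (\<theta> - s)) * Im (koebe (r * cis s)))
       = cmod (g (\<theta> + s) - g (\<theta> - s)) * Im (koebe (r * cis s))"
      using Im_koebe_nonneg[OF r] s by (simp add: norm_mult)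
    also have "\<dots> \<le> (4 * C * sin s) * Im (koebe (r * cis s))"
      using lipschitz_symmetric_diff[OF per lip] Im_koebe_nonneg[OF r] s by (intro mult_right_mono) auto
    finally show "norm ((g (\<theta> + s) - g (\<theta> - s)) * Im (koebe (r * cis s)))
       \<le> (4 * C) * (sin s * Im (koebe (r * cis s)))" by (simp add: mult_ac)
  qed (use r in \<open>auto intro!: integrable_continuous_interval continuous_intros cg continuous_koebe_polar\<close>)
  also have "\<dots> = (4 * C) * (pi * r / 2)"
    by (simp only: integral_mult_right integral_sin_Im_koebe[OF r])
  also have "\<dots> \<le> (4 * C) * (pi * 1 / 2)"
    using C r by (intro mult_left_mono) auto
  finally have "cmod (integral {0..pi} (\<lambda>s. (g (\<theta> + s) - g (\<theta> - s)) * Im (koebe (r * cis s)))) \<le> 2 * C * pi"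
    by simp
  then show ?thesis
    unfolding angular_op_polar[OF g per r] by (simp add: norm_divide divide_le_eq)
qed

text \<open>A Fatou theorem for a density given through its primitive:
  \<open>sin s * Im (koebe (r * cis s))\<close> is a positive weight concentrating at
  \<open>s = 0\<close>, and the symmetric difference of \<open>g\<close> divided by
  \<open>2 * sin s\<close> tends to \<open>c\<close> there.\<close>

lemma angular_op_tendsto:
  fixes g :: "real \<Rightarrow> complex"
  assumes g: "continuous_on UNIV g" and per: "\<And>t. g (t + 2 * pi) = g t"
    and d: "(g has_vector_derivative c) (at \<theta>)"
  shows "((\<lambda>r. angular_op g (of_real r * cis \<theta>)) \<longlongrightarrow> c) (at_left 1)"
proof (rule tendstoI)
  fix e :: real assume e: "e > 0"
  \<comment> \<open>Comparison with \<open>2 * c * sin s\<close> rather than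
    \<open>2 * c * s\<close> keeps the main term explicit: by \<open>integral_sin_Im_koebe\<close>
    it contributes exactly \<open>c * r\<close>.\<close>
  define R where "R s = g (\<theta> + s) - g (\<theta> - s) - 2 * c * sin s" for s
  have cg: "continuous_on A (\<lambda>s. g (\<theta> + s))" "continuous_on A (\<lambda>s. g (\<theta> - s))" for A
    by (intro continuous_on_compose2[OF g] continuous_intros subset_UNIV)+
  have cR: "continuous_on A R" for A unfolding R_def by (intro continuous_intros cg)
  have "compact (R ` {0..pi})" by (intro compact_continuous_image cR) auto
  then obtain B where B: "\<And>s. s \<in> {0..pi} \<Longrightarrow> cmod (R s) \<le> B"
    by (meson bounded_iff compact_imp_bounded image_eqI)
  have B0: "B \<ge> 0" using B[of 0] norm_ge_zero[of "R 0"] by (simp del: norm_ge_zero)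
  have "(R has_vector_derivative 0) (at 0)"
  proof -
    have "((\<lambda>s. g (\<theta> + s)) has_vector_derivative c) (at 0)"
         "((\<lambda>s. g (\<theta> - s)) has_vector_derivative - c) (at 0)"
      using has_vector_derivative_translate[of g c \<theta> 0] has_vector_derivative_reflect_about[of g c \<theta> 0] d by auto
    moreover have "((\<lambda>s. 2 * c * complex_of_real (sin s)) has_vector_derivative 2 * c * complex_of_real 1) (at 0)"
      by (intro has_vector_derivative_mult_right has_vector_derivative_of_real)
         (auto intro!: derivative_eq_intros)
    ultimately show ?thesis unfolding R_def by (auto intro!: derivative_eq_intros)
  qed
  then have "(R has_derivative (\<lambda>_. 0)) (at 0)" by (simp add: has_vector_derivative_def)
  then obtain d0 where d0: "d0 > 0" "\<And>s. \<bar>s\<bar> < d0 \<Longrightarrow> cmod (R s) \<le> (e/4) * \<bar>s\<bar>"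
  proof -
    assume "(R has_derivative (\<lambda>_. 0)) (at 0)"
    then have *: "\<forall>e>0. \<exists>d>0. \<forall>s. \<bar>s\<bar> < d \<longrightarrow> cmod (R s - R 0) \<le> e * \<bar>s\<bar>"
      unfolding has_derivative_at_alt by simp
    have "R 0 = 0" by (simp add: R_def)
    then show ?thesis using *[rule_format, of "e/4"] e that by auto
  qed
  define \<delta> where "\<delta> = min (d0/2) (pi/2)"
  have \<delta>: "\<delta> > 0" "\<delta> < d0" "\<delta> \<le> pi/2" using d0(1) by (auto simp: \<delta>_def)
  have sd: "sin \<delta> > 0" using \<delta> by (intro sin_gt_zero) (use pi_gt_zero in linarith)+
  have small: "cmod (R s) \<le> (e/2) * sin s" if "0 \<le> s" "s \<le> \<delta>" for s
  proof -
    have "cmod (R s) \<le> (e/4) * s" using d0(2)[of s] that \<delta> by simp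
    also have "\<dots> \<le> (e/4) * (2 * sin s)" using half_le_sin[of s] that \<delta> e by (intro mult_left_mono) auto
    finally show ?thesis by simp
  qed
  \<comment> \<open>Beyond \<open>\<delta>\<close> the remainder is at most \<open>B\<close> and the
    kernel at most \<open>2 * (1 - r) / (sin \<delta>)^4\<close>.\<close>
  define K where "K = 2 * B / (sin \<delta>)^4"
  have K0: "K \<ge> 0" using B0 sd by (simp add: K_def)
  \<comment> \<open>The part near 0 contributes \<open>(e/2) * (pi * r / 2) / pi\<close>, which is
    at most \<open>e / 4\<close>; the term \<open>cmod c * (1 - r)\<close> appears because the
    weight has mass \<open>r\<close> instead of 1.\<close>
  have est: "cmod (angular_op g (of_real r * cis \<theta>) - c) \<le> e / 4 + (K + cmod c) * (1 - r)"
    if r: "0 \<le> r" "r < 1" for r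
  proof -
    let ?k = "\<lambda>s. Im (koebe (of_real r * cis s))"
    have ck: "continuous_on A ?k" for A by (intro continuous_intros continuous_koebe_polar r)
    have "integral {0..pi} (\<lambda>s. R s * ?k s)
       = integral {0..pi} (\<lambda>s. (g (\<theta> + s) - g (\<theta> - s)) * ?k s) - integral {0..pi} (\<lambda>s. 2 * c * of_real (sin s * ?k s))"
    proof (subst integral_diff[symmetric])
      show "integral {0..pi} (\<lambda>s. R s * ?k s)
         = integral {0..pi} (\<lambda>s. (g (\<theta> + s) - g (\<theta> - s)) * ?k s - 2 * c * of_real (sin s * ?k s))"
        by (rule arg_cong[where f = "integral {0..pi}"]) (simp add: R_def fun_eq_iff algebra_simps)
    qed (auto intro!: integrable_continuous_interval continuous_intros cg ck)
    also have "integral {0..pi} (\<lambda>s. 2 * c * of_real (sin s * ?k s)) = 2 * c * of_real (integral {0..pi} (\<lambda>s. sin s * ?k s))"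
      unfolding integral_mult_right
      by (subst integral_of_real_eq) (auto intro!: integrable_continuous_interval continuous_intros ck)
    also have "\<dots> = c * r * pi" unfolding integral_sin_Im_koebe[OF r] by simp
    finally have "integral {0..pi} (\<lambda>s. R s * ?k s) / pi = angular_op g (of_real r * cis \<theta>) - c * r"
      unfolding angular_op_polar[OF g per r] by (simp add: diff_divide_distrib)
    then have "cmod (angular_op g (of_real r * cis \<theta>) - c * r) = cmod (integral {0..pi} (\<lambda>s. R s * ?k s)) / pi"
      by (metis norm_divide norm_of_real abs_of_pos pi_gt_zero)
    also have "cmod (integral {0..pi} (\<lambda>s. R s * ?k s)) \<le> integral {0..pi} (\<lambda>s. (e/2) * (sin s * ?k s) + K * (1 - r))"
    proof (rule integral_norm_bound_integral)
      fix s assume s: "s \<in> {0..pi}"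
      have k0: "0 \<le> ?k s" using Im_koebe_nonneg[OF r] s by simp
      have s0: "0 \<le> sin s" using s by (intro sin_ge_zero) auto
      have "cmod (R s) * ?k s \<le> (e/2) * (sin s * ?k s) + K * (1 - r)"
      proof (cases "s \<le> \<delta>")
        case True
        then have "cmod (R s) * ?k s \<le> ((e/2) * sin s) * ?k s"
          using small[of s] s k0 by (intro mult_right_mono) auto
        moreover have "0 \<le> K * (1 - r)" using K0 r by simp
        ultimately show ?thesis by (simp add: mult.assoc)
      next
        case False
        have "(sin \<delta>)\<^sup>2 \<le> 1 - 2 * r * cos s + r\<^sup>2"
          using poisson_denominator_ge[of r \<delta> s] r \<delta> s False by simp
        then have "((sin \<delta>)\<^sup>2)\<^sup>2 \<le> (1 - 2 * r * cos s + r\<^sup>2)\<^sup>2" by (intro power_mono) auto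
        then have den: "(sin \<delta>)^4 \<le> (1 - 2 * r * cos s + r\<^sup>2)\<^sup>2" by (simp add: power_mult[symmetric])
        have "r * (1 - r\<^sup>2) * sin s \<le> 1 * (2 * (1 - r)) * 1"
        proof (intro mult_mono)
          have "1 - r\<^sup>2 = (1 + r) * (1 - r)" by (simp add: power2_eq_square algebra_simps)
          also have "\<dots> \<le> 2 * (1 - r)" using r by (intro mult_right_mono) auto
          finally show "1 - r\<^sup>2 \<le> 2 * (1 - r)" .
        qed (use r s0 in \<open>auto simp: power_le_one\<close>)
        then have "?k s \<le> 2 * (1 - r) / (sin \<delta>)^4"
          unfolding koebe_polar[OF r] using den sd r by (intro frac_le) auto
        then have "cmod (R s) * ?k s \<le> B * (2 * (1 - r) / (sin \<delta>)^4)"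
          using B[OF s] k0 B0 by (intro mult_mono) auto
        also have "\<dots> = K * (1 - r)" by (simp add: K_def)
        finally show ?thesis using e s0 k0 by (simp add: add_increasing)
      qed
      then show "norm (R s * ?k s) \<le> (e/2) * (sin s * ?k s) + K * (1 - r)"
        using k0 by (simp add: norm_mult)
    qed (auto intro!: integrable_continuous_interval continuous_intros cR ck)
    also have "\<dots> = (e/2) * (pi * r / 2) + pi * (K * (1 - r))"
      by (subst integral_add) (auto intro!: integrable_continuous_interval continuous_intros ck
          simp: integral_sin_Im_koebe[OF r] simp del: times_divide_eq_left)
    finally have "cmod (angular_op g (of_real r * cis \<theta>) - c * r) \<le> ((e/2) * (pi * r / 2) + pi * (K * (1 - r))) / pi"
      by (simp add: divide_right_mono)
    also have "\<dots> = e * r / 4 + K * (1 - r)" by (simp add: add_divide_distrib)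
    finally have "cmod (angular_op g (of_real r * cis \<theta>) - c * r) \<le> e * r / 4 + K * (1 - r)" .
    moreover have "e * r \<le> e" using e r by simp
    moreover have "cmod (c * r - c) = cmod c * (1 - r)"
    proof -
      have "c * r - c = - (c * of_real (1 - r))" by (simp add: algebra_simps)
      then show ?thesis using r by (simp only: norm_minus_cancel norm_mult norm_of_real)
    qed
    moreover have "cmod (angular_op g (of_real r * cis \<theta>) - c) \<le> cmod (angular_op g (of_real r * cis \<theta>) - c * r) + cmod (c * r - c)"
      using norm_triangle_ineq[of "angular_op g (of_real r * cis \<theta>) - c * r" "c * r - c"] by simp
    ultimately show ?thesis by (simp add: algebra_simps)
  qed
  have "((\<lambda>r. e / 4 + (K + cmod c) * (1 - r)) \<longlongrightarrow> e / 4 + (K + cmod c) * (1 - 1)) (at_left 1)"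
    by (intro tendsto_intros)
  then have "eventually (\<lambda>r. e / 4 + (K + cmod c) * (1 - r) < e) (at_left 1)"
    by (rule order_tendstoD) (use e in simp)
  moreover have "eventually (\<lambda>r. 0 \<le> r \<and> r < (1::real)) (at_left 1)"
    using eventually_at_left_real[of 0 1] by (auto elim: eventually_mono)
  ultimately show "eventually (\<lambda>r. dist (angular_op g (of_real r * cis \<theta>)) c < e) (at_left 1)"
    by eventually_elim (use est in \<open>auto simp: dist_norm intro: le_less_trans\<close>)
qed

section \<open>Truncated Hilbert integrals compared with radial derivatives\<close>

lemma has_real_derivative_cot_half:
  assumes "sin (s/2) \<noteq> 0"
  shows "((\<lambda>s::real. cos (s/2) / (2 * sin (s/2))) has_real_derivative - 1 / (4 * (sin (s/2))\<^sup>2)) (at s)"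
proof -
  have "((\<lambda>s. cos (s/2) / (2 * sin (s/2))) has_real_derivative
     ((- (sin (s/2)) * (1/2)) * (2 * sin (s/2)) - cos (s/2) * (2 * (cos (s/2) * (1/2)))) / (2 * sin (s/2) * (2 * sin (s/2)))) (at s)"
    using assms by (auto intro!: derivative_eq_intros)
  also have "((- a * (1/2)) * (2 * a) - b * (2 * (b * (1/2)))) / (2 * a * (2 * a)) = - (a\<^sup>2 + b\<^sup>2) / (4 * a\<^sup>2)"
    for a b :: real
    by (simp add: power2_eq_square algebra_simps)
  finally show ?thesis by simp
qed

text \<open>Integration by parts: the factor \<open>q\<close>, half the cotangent of
  \<open>s / 2\<close>, moves the derivative from \<open>D\<close> to itself. Subtracting the
  constant \<open>2 * g \<theta>\<close> in \<open>D\<close> does not affect the identity but makes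
  \<open>D \<epsilon>\<close> small against \<open>\<epsilon>\<close>, which tames the boundary
  term.\<close>

lemma hilbert_truncation:
  fixes g \<psi> :: "real \<Rightarrow> complex" and \<theta> :: real
  assumes d: "\<And>t. (g has_vector_derivative \<psi> t) (at t)" and M: "\<And>t. cmod (\<psi> t) \<le> M"
    and \<epsilon>: "0 < \<epsilon>" "\<epsilon> \<le> pi"
  defines "D \<equiv> \<lambda>s. g (\<theta> + s) + g (\<theta> - s) - 2 * g \<theta>"
  shows "(LINT t:{\<epsilon>..pi}|lebesgue. (\<psi> (\<theta> + t) - \<psi> (\<theta> - t)) /\<^sub>R (2 * tan (t/2)))
     = integral {\<epsilon>..pi} (\<lambda>s. (1 / (4 * (sin (s/2))\<^sup>2)) *\<^sub>R D s) - (cos (\<epsilon>/2) / (2 * sin (\<epsilon>/2))) *\<^sub>R D \<epsilon>"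
proof -
  define q where "q s = cos (s/2) / (2 * sin (s/2))" for s :: real
  have g: "continuous_on UNIV g"
    using d by (meson continuous_at_imp_continuous_on has_vector_derivative_continuous)
  have cg: "continuous_on A (\<lambda>s. g (\<theta> + s))" "continuous_on A (\<lambda>s. g (\<theta> - s))" for A
    by (intro continuous_on_compose2[OF g] continuous_intros subset_UNIV)+
  have sn: "sin (s/2) \<noteq> 0" if "s \<in> {\<epsilon>..pi}" for s
    using that \<epsilon> sin_gt_zero[of "s/2"] by auto
  have dD: "(D has_vector_derivative \<psi> (\<theta> + s) - \<psi> (\<theta> - s)) (at s)" for s
    using has_vector_derivative_translate[OF d] has_vector_derivative_reflect_about[OF d] unfolding D_def
    by (auto intro!: derivative_eq_intros)
  have dq: "(q has_real_derivative - 1 / (4 * (sin (s/2))\<^sup>2)) (at s)" if "s \<in> {\<epsilon>..pi}" for s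
    unfolding q_def by (rule has_real_derivative_cot_half[OF sn[OF that]])
  have "((\<lambda>s. q s *\<^sub>R (\<psi> (\<theta> + s) - \<psi> (\<theta> - s)) + (- 1 / (4 * (sin (s/2))\<^sup>2)) *\<^sub>R D s) has_integral q pi *\<^sub>R D pi - q \<epsilon> *\<^sub>R D \<epsilon>) {\<epsilon>..pi}"
  proof (rule fundamental_theorem_of_calculus[OF \<epsilon>(2)])
    fix s assume "s \<in> {\<epsilon>..pi}"
    then show "((\<lambda>s. q s *\<^sub>R D s) has_vector_derivative q s *\<^sub>R (\<psi> (\<theta> + s) - \<psi> (\<theta> - s)) + (- 1 / (4 * (sin (s/2))\<^sup>2)) *\<^sub>R D s) (at s within {\<epsilon>..pi})"
      by (intro has_vector_derivative_at_within[OF has_vector_derivative_scaleR] dq dD)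
  qed
  moreover have i2: "(\<lambda>s. (1 / (4 * (sin (s/2))\<^sup>2)) *\<^sub>R D s) integrable_on {\<epsilon>..pi}"
    unfolding D_def using sn by (intro integrable_continuous_interval continuous_intros cg) auto
  ultimately have "((\<lambda>s. (q s *\<^sub>R (\<psi> (\<theta> + s) - \<psi> (\<theta> - s)) + (- 1 / (4 * (sin (s/2))\<^sup>2)) *\<^sub>R D s) + (1 / (4 * (sin (s/2))\<^sup>2)) *\<^sub>R D s)
      has_integral (q pi *\<^sub>R D pi - q \<epsilon> *\<^sub>R D \<epsilon>) + integral {\<epsilon>..pi} (\<lambda>s. (1 / (4 * (sin (s/2))\<^sup>2)) *\<^sub>R D s)) {\<epsilon>..pi}"
    by (intro has_integral_add integrable_integral)
  \<comment> \<open>The boundary term at \<open>pi\<close> drops out because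
    \<open>cos (pi/2) = 0\<close>.\<close>
  then have I: "((\<lambda>s. q s *\<^sub>R (\<psi> (\<theta> + s) - \<psi> (\<theta> - s))) has_integral
      integral {\<epsilon>..pi} (\<lambda>s. (1 / (4 * (sin (s/2))\<^sup>2)) *\<^sub>R D s) - q \<epsilon> *\<^sub>R D \<epsilon>) {\<epsilon>..pi}"
    by (simp add: q_def)
  \<comment> \<open>So far the integral is a gauge integral of a derivative. Boundedness of
    \<open>\<psi>\<close> makes it absolutely convergent, as the Lebesgue integral in the definition
    requires.\<close>
  have "(\<lambda>s. q s *\<^sub>R (\<psi> (\<theta> + s) - \<psi> (\<theta> - s))) absolutely_integrable_on {\<epsilon>..pi}"
  proof (rule measurable_bounded_by_integrable_imp_absolutely_integrable)
    show "(\<lambda>s. q s *\<^sub>R (\<psi> (\<theta> + s) - \<psi> (\<theta> - s))) \<in> borel_measurable (lebesgue_on {\<epsilon>..pi})"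
      by (rule integrable_imp_measurable) (use I in blast)
    show "(\<lambda>s. \<bar>q s\<bar> * (M + M)) integrable_on {\<epsilon>..pi}"
      unfolding q_def using sn by (intro integrable_continuous_interval continuous_intros) auto
    show "norm (q s *\<^sub>R (\<psi> (\<theta> + s) - \<psi> (\<theta> - s))) \<le> \<bar>q s\<bar> * (M + M)" for s
      using norm_triangle_le_diff[OF add_mono[OF M M]] by (auto intro!: mult_left_mono)
  qed auto
  then have "(LINT s:{\<epsilon>..pi}|lebesgue. q s *\<^sub>R (\<psi> (\<theta> + s) - \<psi> (\<theta> - s)))
     = integral {\<epsilon>..pi} (\<lambda>s. (1 / (4 * (sin (s/2))\<^sup>2)) *\<^sub>R D s) - q \<epsilon> *\<^sub>R D \<epsilon>"
    using I by (simp add: set_lebesgue_integral_eq_integral(2) integral_unique)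
  \<comment> \<open>At \<open>t = pi\<close> both sides are 0 as well: there
    \<open>tan (pi/2) = 0\<close> through division by \<open>cos (pi/2) = 0\<close>, and the
    reciprocal of 0 is 0.\<close>
  moreover have "(\<lambda>t. (\<psi> (\<theta> + t) - \<psi> (\<theta> - t)) /\<^sub>R (2 * tan (t/2))) = (\<lambda>s. q s *\<^sub>R (\<psi> (\<theta> + s) - \<psi> (\<theta> - s)))"
    by (simp add: fun_eq_iff q_def tan_def field_simps)
  ultimately show ?thesis by (simp add: q_def)
qed

text \<open>At radius 1 the kernel is \<open>- 1 / (4 * \<sigma>)\<close> with
  \<open>\<sigma> = (sin (s/2))^2\<close>, and the error is quadratic in \<open>\<epsilon>\<close>.
  From \<open>\<epsilon> \<le> s\<close> comes the bound 28 = 16 + 12 in the numerator, from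
  \<open>\<epsilon> \<le> 1/2\<close> the bound \<open>2 * \<sigma> \<le> \<Delta>\<close>; together
  with \<open>s\<^sup>2 / 16 \<le> \<sigma>\<close> the constant is (28 / 16) * 256 = 448.\<close>

lemma Re_koebe_plus_bound:
  fixes \<epsilon> s :: real
  assumes "0 < \<epsilon>" "\<epsilon> \<le> 1/2" "\<epsilon> \<le> s" "s \<le> pi"
  shows "\<bar>Re (koebe (of_real (1 - \<epsilon>) * cis s)) + 1 / (4 * (sin (s/2))\<^sup>2)\<bar> \<le> 448 * \<epsilon>\<^sup>2 / s^4"
proof -
  define r where "r = 1 - \<epsilon>"
  define \<sigma> where "\<sigma> = (sin (s/2))\<^sup>2"
  define \<Delta> where "\<Delta> = 1 - 2 * r * cos s + r\<^sup>2"
  have r: "1/2 \<le> r" "r < 1" using assms by (auto simp: r_def)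
  have "s / 4 \<le> sin (s/2)" using half_le_sin[of "s/2"] assms by simp
  then have "(s/4)\<^sup>2 \<le> \<sigma>" unfolding \<sigma>_def using assms by (intro power_mono) auto
  then have \<sigma>: "s\<^sup>2 / 16 \<le> \<sigma>" by (simp add: power_divide)
  have "\<epsilon>\<^sup>2 \<le> s\<^sup>2" using assms by (intro power_mono) auto
  then have e\<sigma>: "\<epsilon>\<^sup>2 \<le> 16 * \<sigma>" using \<sigma> by simp
  have s2: "0 < s\<^sup>2" using assms by simp
  then have \<sigma>0: "0 < \<sigma>" using \<sigma> by linarith
  have \<sigma>1: "\<sigma> \<le> 1" unfolding \<sigma>_def by (simp add: abs_square_le_1)
  have cs: "cos s = 1 - 2 * \<sigma>" using cos_double_sin[of "s/2"] by (simp add: \<sigma>_def)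
  have \<Delta>: "\<Delta> = \<epsilon>\<^sup>2 + 4 * r * \<sigma>" unfolding \<Delta>_def cs r_def by (simp add: power2_eq_square algebra_simps)
  have r\<sigma>: "2 * \<sigma> \<le> 4 * r * \<sigma>" using r \<sigma>0 by simp
  then have \<Delta>\<sigma>: "2 * \<sigma> \<le> \<Delta>" unfolding \<Delta> by (simp add: add_increasing)
  then have \<Delta>0: "0 < \<Delta>" using \<sigma>0 by linarith
  have "Re (koebe (of_real r * cis s)) + 1 / (4 * \<sigma>) = r * ((1 + r\<^sup>2) * cos s - 2 * r) / \<Delta>\<^sup>2 + 1 / (4 * \<sigma>)"
    using koebe_polar(1)[of r s] r by (simp add: \<Delta>_def)
  also have "\<dots> = (4 * \<sigma> * (r * ((1 + r\<^sup>2) * cos s - 2 * r)) + \<Delta>\<^sup>2) / (4 * \<sigma> * \<Delta>\<^sup>2)"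
    using \<sigma>0 \<Delta>0 by (simp add: field_simps)
  \<comment> \<open>All terms of order 0 and 1 in \<open>\<epsilon>\<close> cancel here.\<close>
  also have "4 * \<sigma> * (r * ((1 + r\<^sup>2) * cos s - 2 * r)) + \<Delta>\<^sup>2 = \<epsilon>\<^sup>2 * (\<epsilon>\<^sup>2 + 12 * r * \<sigma> - 8 * r * \<sigma>\<^sup>2)"
    unfolding \<Delta> cs r_def by algebra
  finally have eq: "Re (koebe (of_real r * cis s)) + 1 / (4 * \<sigma>) = \<epsilon>\<^sup>2 * (\<epsilon>\<^sup>2 + 12 * r * \<sigma> - 8 * r * \<sigma>\<^sup>2) / (4 * \<sigma> * \<Delta>\<^sup>2)" .
  have "r * \<sigma>\<^sup>2 \<le> r * \<sigma>" using \<sigma>0 \<sigma>1 r by (simp add: power2_eq_square mult_left_le)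
  moreover have "0 \<le> r * \<sigma>" "0 \<le> r * \<sigma>\<^sup>2" "r * \<sigma> \<le> \<sigma>" using \<sigma>0 r by auto
  moreover have "0 \<le> \<epsilon>\<^sup>2" by simp
  ultimately have n: "0 \<le> \<epsilon>\<^sup>2 + 12 * r * \<sigma> - 8 * r * \<sigma>\<^sup>2" "\<epsilon>\<^sup>2 + 12 * r * \<sigma> - 8 * r * \<sigma>\<^sup>2 \<le> 28 * \<sigma>"
    using e\<sigma> by linarith+
  have "(2 * \<sigma>)\<^sup>2 \<le> \<Delta>\<^sup>2" using \<Delta>\<sigma> \<sigma>0 by (intro power_mono) auto
  then have "4 * \<sigma> * (4 * \<sigma>\<^sup>2) \<le> 4 * \<sigma> * \<Delta>\<^sup>2" using \<sigma>0 by (intro mult_left_mono) (auto simp: power_mult_distrib)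
  then have "\<epsilon>\<^sup>2 * (\<epsilon>\<^sup>2 + 12 * r * \<sigma> - 8 * r * \<sigma>\<^sup>2) / (4 * \<sigma> * \<Delta>\<^sup>2) \<le> \<epsilon>\<^sup>2 * (28 * \<sigma>) / (4 * \<sigma> * (4 * \<sigma>\<^sup>2))"
  proof (rule frac_le[rotated 3])
    show "\<epsilon>\<^sup>2 * (\<epsilon>\<^sup>2 + 12 * r * \<sigma> - 8 * r * \<sigma>\<^sup>2) \<le> \<epsilon>\<^sup>2 * (28 * \<sigma>)"
      by (rule mult_left_mono[OF n(2)]) simp
  qed (use \<sigma>0 in auto)
  moreover have "0 \<le> \<epsilon>\<^sup>2 * (\<epsilon>\<^sup>2 + 12 * r * \<sigma> - 8 * r * \<sigma>\<^sup>2) / (4 * \<sigma> * \<Delta>\<^sup>2)"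
    using n(1) \<sigma>0 by (intro divide_nonneg_nonneg mult_nonneg_nonneg) auto
  ultimately have "\<bar>Re (koebe (of_real r * cis s)) + 1 / (4 * \<sigma>)\<bar> \<le> \<epsilon>\<^sup>2 * (28 * \<sigma>) / (4 * \<sigma> * (4 * \<sigma>\<^sup>2))"
    unfolding eq by linarith
  also have "\<dots> = (7/4) * \<epsilon>\<^sup>2 / \<sigma>\<^sup>2" using \<sigma>0 by (simp add: field_simps power2_eq_square)
  also have "\<dots> \<le> (7/4) * \<epsilon>\<^sup>2 / (s\<^sup>2/16)\<^sup>2"
    using \<sigma> s2 \<sigma>0 by (intro divide_left_mono power_mono mult_pos_pos) auto
  also have "\<dots> = 448 * \<epsilon>\<^sup>2 / s^4" by (simp add: power_divide flip: power_mult)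
  finally show ?thesis by (simp add: \<sigma>_def r_def)
qed

lemma integral_inverse_cube_le:
  fixes \<epsilon> :: real
  assumes "0 < \<epsilon>" "\<epsilon> \<le> b"
  shows "integral {\<epsilon>..b} (\<lambda>s. 1 / s^3) \<le> 1 / (2 * \<epsilon>\<^sup>2)"
proof -
  have "((\<lambda>s. 1 / s^3) has_integral (- 1 / (2 * b\<^sup>2)) - (- 1 / (2 * \<epsilon>\<^sup>2))) {\<epsilon>..b}"
  proof (rule fundamental_theorem_of_calculus[OF assms(2)])
    fix s assume "s \<in> {\<epsilon>..b}"
    then have "s \<noteq> 0" using assms by auto
    then have "((\<lambda>s. - 1 / (2 * s\<^sup>2)) has_real_derivative 1 / s^3) (at s)"
      by (auto intro!: derivative_eq_intros simp: field_simps power2_eq_square power3_eq_cube)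
    then show "((\<lambda>s. - 1 / (2 * s\<^sup>2)) has_vector_derivative 1 / s^3) (at s within {\<epsilon>..b})"
      by (simp add: has_real_derivative_iff_has_vector_derivative has_vector_derivative_at_within)
  qed
  then show ?thesis by (simp add: integral_unique)
qed

lemma norm_koebe_le:
  assumes "cmod z \<le> 1 - \<epsilon>" "0 < \<epsilon>"
  shows "cmod (koebe z) \<le> 1 / \<epsilon>\<^sup>2"
proof -
  have "\<epsilon> \<le> cmod (1 - z)" using norm_triangle_ineq2[of 1 z] assms by simp
  then have "\<epsilon>\<^sup>2 \<le> (cmod (1 - z))\<^sup>2" using assms by (intro power_mono) auto
  then show ?thesis unfolding koebe_def norm_divide norm_power
    using assms by (intro frac_le) auto
qed

text \<open>The sum in parentheses is the truncated Hilbert integral in the form of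
  \<open>hilbert_truncation\<close>. With truncation and distance to the circle both equal to
  \<open>\<epsilon>\<close>, the errors are: \<open>\<eta>\<close> from
  \<open>{0..\<epsilon>}\<close>, where the kernel is at most \<open>1 / \<epsilon>^2\<close>;
  \<open>224 * \<eta>\<close> and the \<open>B\<close> term from the kernel difference on
  \<open>{\<epsilon>..pi}\<close>; and \<open>2 * \<eta>\<close> from the boundary term. The sum 227
  is rounded up to 300.\<close>

lemma radial_op_truncation_bound:
  fixes g :: "real \<Rightarrow> complex" and \<theta> \<epsilon> \<delta> \<eta> B :: real
  assumes g: "continuous_on UNIV g" and per: "\<And>t. g (t + 2 * pi) = g t"
  defines "D \<equiv> \<lambda>s. g (\<theta> + s) + g (\<theta> - s) - 2 * g \<theta>"
  assumes D1: "\<And>s. 0 \<le> s \<Longrightarrow> s \<le> \<delta> \<Longrightarrow> cmod (D s) \<le> \<eta> * s"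
    and D2: "\<And>s. 0 \<le> s \<Longrightarrow> s \<le> pi \<Longrightarrow> cmod (D s) \<le> B"
    and e: "0 < \<epsilon>" "\<epsilon> \<le> 1/2" "\<epsilon> \<le> \<delta>" and \<eta>: "0 \<le> \<eta>"
  shows "cmod (pi * radial_op g (of_real (1 - \<epsilon>) * cis \<theta>)
      + (integral {\<epsilon>..pi} (\<lambda>s. (1 / (4 * (sin (s/2))\<^sup>2)) *\<^sub>R D s) - (cos (\<epsilon>/2) / (2 * sin (\<epsilon>/2))) *\<^sub>R D \<epsilon>))
     \<le> 300 * \<eta> + 448 * pi * (B / \<delta>^4) * \<epsilon>\<^sup>2"
proof -
  define r where "r = 1 - \<epsilon>"
  have r: "0 \<le> r" "r < 1" using e by (auto simp: r_def)
  let ?k = "\<lambda>s. Re (koebe (of_real r * cis s))"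
  have \<epsilon>pi: "\<epsilon> \<le> pi" using e pi_gt3 by linarith
  have B: "0 \<le> B" using D2[of 0] norm_ge_zero[of "D 0"] by (simp del: norm_ge_zero)
  have cg: "continuous_on A (\<lambda>s. g (\<theta> + s))" "continuous_on A (\<lambda>s. g (\<theta> - s))" for A
    by (intro continuous_on_compose2[OF g] continuous_intros subset_UNIV)+
  have cD: "continuous_on A D" for A unfolding D_def by (intro continuous_intros cg)
  have ck: "continuous_on A ?k" for A by (intro continuous_intros continuous_koebe_polar r)
  have cDk: "(\<lambda>s. D s * ?k s) integrable_on {a..b}" for a b
    by (intro integrable_continuous_interval continuous_intros cD ck)
  have sn: "sin (s/2) \<noteq> 0" if "s \<in> {\<epsilon>..pi}" for s
    using that e sin_gt_zero[of "s/2"] by auto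
  have cq: "(\<lambda>s. (1 / (4 * (sin (s/2))\<^sup>2)) *\<^sub>R D s) integrable_on {\<epsilon>..pi}"
    using sn by (intro integrable_continuous_interval continuous_intros cD) auto
  have "integral {0..pi} (\<lambda>s. D s * ?k s)
     = integral {0..pi} (\<lambda>s. (g (\<theta> + s) + g (\<theta> - s)) * ?k s) - integral {0..pi} (\<lambda>s. (2 * g \<theta>) * of_real (?k s))"
  proof (subst integral_diff[symmetric])
    show "integral {0..pi} (\<lambda>s. D s * ?k s)
       = integral {0..pi} (\<lambda>s. (g (\<theta> + s) + g (\<theta> - s)) * ?k s - (2 * g \<theta>) * of_real (?k s))"
      by (rule arg_cong[where f = "integral {0..pi}"]) (simp add: D_def fun_eq_iff algebra_simps)
  qed (auto intro!: integrable_continuous_interval continuous_intros cg ck)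
  also have "integral {0..pi} (\<lambda>s. (2 * g \<theta>) * of_real (?k s)) = 0"
    unfolding integral_mult_right
    by (subst integral_of_real_eq) (auto intro!: integrable_continuous_interval ck simp: integral_Re_koebe[OF r])
  finally have "pi * radial_op g (of_real r * cis \<theta>) = integral {0..pi} (\<lambda>s. D s * ?k s)"
    unfolding radial_op_polar[OF g per r] by simp
  also have "\<dots> = integral {0..\<epsilon>} (\<lambda>s. D s * ?k s) + integral {\<epsilon>..pi} (\<lambda>s. D s * ?k s)"
    using e \<epsilon>pi by (intro Henstock_Kurzweil_Integration.integral_combine[symmetric] cDk) auto
  finally have "pi * radial_op g (of_real r * cis \<theta>) + integral {\<epsilon>..pi} (\<lambda>s. (1 / (4 * (sin (s/2))\<^sup>2)) *\<^sub>R D s)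
     = integral {0..\<epsilon>} (\<lambda>s. D s * ?k s) + integral {\<epsilon>..pi} (\<lambda>s. D s * ?k s + (1 / (4 * (sin (s/2))\<^sup>2)) *\<^sub>R D s)"
    by (simp add: integral_add[OF cDk cq])
  also have "(\<lambda>s. D s * ?k s + (1 / (4 * (sin (s/2))\<^sup>2)) *\<^sub>R D s) = (\<lambda>s. (?k s + 1 / (4 * (sin (s/2))\<^sup>2)) *\<^sub>R D s)"
    by (simp add: scaleR_conv_of_real algebra_simps)
  finally have eq: "pi * radial_op g (of_real r * cis \<theta>) + integral {\<epsilon>..pi} (\<lambda>s. (1 / (4 * (sin (s/2))\<^sup>2)) *\<^sub>R D s)
     = integral {0..\<epsilon>} (\<lambda>s. D s * ?k s) + integral {\<epsilon>..pi} (\<lambda>s. (?k s + 1 / (4 * (sin (s/2))\<^sup>2)) *\<^sub>R D s)" .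
  have b1: "cmod (integral {0..\<epsilon>} (\<lambda>s. D s * ?k s)) \<le> \<eta>"
  proof -
    have "cmod (integral {0..\<epsilon>} (\<lambda>s. D s * ?k s)) \<le> integral {0..\<epsilon>} (\<lambda>s. \<eta> * \<epsilon> * (1 / \<epsilon>\<^sup>2))"
    proof (rule integral_norm_bound_integral[OF cDk])
      fix s assume s: "s \<in> {0..\<epsilon>}"
      have "\<bar>?k s\<bar> \<le> cmod (koebe (of_real r * cis s))" by (rule abs_Re_le_cmod)
      also have "\<dots> \<le> 1 / \<epsilon>\<^sup>2" using e by (intro norm_koebe_le) (auto simp: norm_mult r_def simp del: of_real_diff)
      finally have "\<bar>?k s\<bar> \<le> 1 / \<epsilon>\<^sup>2" .
      moreover have "cmod (D s) \<le> \<eta> * \<epsilon>" using D1[of s] s e \<eta> mult_left_mono[of s \<epsilon> \<eta>] by simp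
      ultimately show "norm (D s * ?k s) \<le> \<eta> * \<epsilon> * (1 / \<epsilon>\<^sup>2)"
        unfolding norm_mult norm_of_real using e \<eta> by (intro mult_mono) auto
    qed auto
    also have "\<dots> = \<eta>" using e by (simp add: power2_eq_square)
    finally show ?thesis .
  qed
  have b2: "cmod (integral {\<epsilon>..pi} (\<lambda>s. (?k s + 1 / (4 * (sin (s/2))\<^sup>2)) *\<^sub>R D s)) \<le> 224 * \<eta> + 448 * pi * (B / \<delta>^4) * \<epsilon>\<^sup>2"
  proof -
    have c3: "(\<lambda>s. 1 / s^3) integrable_on {\<epsilon>..pi}"
      using e by (intro integrable_continuous_interval continuous_intros) auto
    have "cmod (integral {\<epsilon>..pi} (\<lambda>s. (?k s + 1 / (4 * (sin (s/2))\<^sup>2)) *\<^sub>R D s))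
      \<le> integral {\<epsilon>..pi} (\<lambda>s. 448 * \<epsilon>\<^sup>2 * \<eta> * (1 / s^3) + 448 * \<epsilon>\<^sup>2 * (B / \<delta>^4))"
    proof (rule integral_norm_bound_integral)
      show "(\<lambda>s. (?k s + 1 / (4 * (sin (s/2))\<^sup>2)) *\<^sub>R D s) integrable_on {\<epsilon>..pi}"
        using sn by (intro integrable_continuous_interval continuous_intros cD ck) auto
      show "(\<lambda>s. 448 * \<epsilon>\<^sup>2 * \<eta> * (1 / s^3) + 448 * \<epsilon>\<^sup>2 * (B / \<delta>^4)) integrable_on {\<epsilon>..pi}"
        using e by (intro integrable_continuous_interval continuous_intros) auto
      fix s assume s: "s \<in> {\<epsilon>..pi}"
      then have s0: "0 < s" using e by auto
      \<comment> \<open>One bound for both ranges: beyond \<open>\<delta>\<close> the quotient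
        \<open>s^4 / \<delta>^4\<close> is at least 1. The power 4 cancels that in the kernel
        estimate.\<close>
      have "cmod (D s) \<le> \<eta> * s + B / \<delta>^4 * s^4"
      proof (cases "s \<le> \<delta>")
        case True
        then show ?thesis using D1[of s] s0 B by (simp add: add_increasing2)
      next
        case False
        then have "\<delta>^4 \<le> s^4" using e by (intro power_mono) auto
        then have "B * \<delta>^4 \<le> B * s^4" using B by (rule mult_left_mono)
        then have "B \<le> B / \<delta>^4 * s^4" using e by (simp add: field_simps)
        moreover have "0 \<le> \<eta> * s" using \<eta> s0 by simp
        moreover have "cmod (D s) \<le> B" using D2[of s] s s0 by simp
        ultimately show ?thesis by linarith
      qed
      then have "norm ((?k s + 1 / (4 * (sin (s/2))\<^sup>2)) *\<^sub>R D s) \<le> (448 * \<epsilon>\<^sup>2 / s^4) * (\<eta> * s + B / \<delta>^4 * s^4)"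
        unfolding norm_scaleR r_def using e s by (intro mult_mono Re_koebe_plus_bound) auto
      also have "\<dots> = 448 * \<epsilon>\<^sup>2 * \<eta> * (1 / s^3) + 448 * \<epsilon>\<^sup>2 * (B / \<delta>^4)"
        using s0 by (simp add: distrib_left power4_eq_xxxx power3_eq_cube)
      finally show "norm ((?k s + 1 / (4 * (sin (s/2))\<^sup>2)) *\<^sub>R D s) \<le> 448 * \<epsilon>\<^sup>2 * \<eta> * (1 / s^3) + 448 * \<epsilon>\<^sup>2 * (B / \<delta>^4)" .
    qed
    also have "\<dots> = 448 * \<epsilon>\<^sup>2 * \<eta> * integral {\<epsilon>..pi} (\<lambda>s. 1 / s^3) + 448 * \<epsilon>\<^sup>2 * ((pi - \<epsilon>) * (B / \<delta>^4))"
      using c3 \<epsilon>pi integrable_cmul[OF c3, of "448 * \<epsilon>\<^sup>2 * \<eta>"]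
      by (subst integral_add) (simp_all only: integral_mult_right real_scaleR_def integrable_const_ivl integral_const_real content_real)
    also have "\<dots> \<le> 448 * \<epsilon>\<^sup>2 * \<eta> * (1 / (2 * \<epsilon>\<^sup>2)) + 448 * \<epsilon>\<^sup>2 * (pi * (B / \<delta>^4))"
      using integral_inverse_cube_le[OF e(1) \<epsilon>pi] \<eta> e B
      by (intro add_mono mult_left_mono mult_right_mono) auto
    also have "\<dots> = 224 * \<eta> + 448 * pi * (B / \<delta>^4) * \<epsilon>\<^sup>2" using e by (simp add: field_simps)
    finally show ?thesis .
  qed
  have b3: "cmod ((cos (\<epsilon>/2) / (2 * sin (\<epsilon>/2))) *\<^sub>R D \<epsilon>) \<le> 2 * \<eta>"
  proof -
    have s: "\<epsilon> / 4 \<le> sin (\<epsilon>/2)" using half_le_sin[of "\<epsilon>/2"] e pi_gt3 by simp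
    have "\<bar>cos (\<epsilon>/2) / (2 * sin (\<epsilon>/2))\<bar> \<le> 1 / (\<epsilon> / 2)"
      unfolding abs_divide using s e by (intro frac_le) (auto simp: abs_mult)
    then have "cmod ((cos (\<epsilon>/2) / (2 * sin (\<epsilon>/2))) *\<^sub>R D \<epsilon>) \<le> 1 / (\<epsilon>/2) * (\<eta> * \<epsilon>)"
      unfolding norm_scaleR using D1[of \<epsilon>] e by (intro mult_mono) auto
    then show ?thesis using e by simp
  qed
  have "cmod ((pi * radial_op g (of_real r * cis \<theta>) + integral {\<epsilon>..pi} (\<lambda>s. (1 / (4 * (sin (s/2))\<^sup>2)) *\<^sub>R D s))
     - (cos (\<epsilon>/2) / (2 * sin (\<epsilon>/2))) *\<^sub>R D \<epsilon>) \<le> (\<eta> + (224 * \<eta> + 448 * pi * (B / \<delta>^4) * \<epsilon>\<^sup>2)) + 2 * \<eta>"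
    unfolding eq by (rule norm_triangle_le_diff[OF add_mono[OF norm_triangle_le[OF add_mono[OF b1 b2]] b3]])
  then show ?thesis using \<eta> by (simp add: r_def add_diff_eq)
qed

text \<open>Differentiability of \<open>g\<close> at \<open>\<theta>\<close> makes the second
  difference \<open>D s\<close> of smaller order than \<open>s\<close>, so \<open>\<eta>\<close> in
  \<open>radial_op_truncation_bound\<close> may be taken arbitrarily small. Hence the limit of the
  truncated integrals exists as soon as the radial limit does, and \<open>Lim\<close> takes that
  value.\<close>

lemma hilbert_transform_eq:
  fixes g \<psi> :: "real \<Rightarrow> complex" and \<theta> :: real
  assumes per: "\<And>t. g (t + 2 * pi) = g t" and d: "\<And>t. (g has_vector_derivative \<psi> t) (at t)"
    and M: "\<And>t. cmod (\<psi> t) \<le> M"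
    and lim: "((\<lambda>r. radial_op g (of_real r * cis \<theta>)) \<longlongrightarrow> l) (at_left 1)"
  shows "hilbert_transform \<psi> \<theta> = l"
proof -
  define D where "D s = g (\<theta> + s) + g (\<theta> - s) - 2 * g \<theta>" for s
  define I where "I \<epsilon> = (LINT t:{\<epsilon>..pi}|lebesgue. (\<psi> (\<theta> + t) - \<psi> (\<theta> - t)) /\<^sub>R (2 * tan (t / 2)))" for \<epsilon>
  have g: "continuous_on UNIV g"
    using d by (meson continuous_at_imp_continuous_on has_vector_derivative_continuous)
  have cg: "continuous_on A (\<lambda>s. g (\<theta> + s))" "continuous_on A (\<lambda>s. g (\<theta> - s))" for A
    by (intro continuous_on_compose2[OF g] continuous_intros subset_UNIV)+
  have cD: "continuous_on A D" for A unfolding D_def by (intro continuous_intros cg)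
  have "compact (D ` {0..pi})" by (intro compact_continuous_image cD) auto
  then obtain B where B: "\<And>s. s \<in> {0..pi} \<Longrightarrow> cmod (D s) \<le> B"
    by (meson bounded_iff compact_imp_bounded image_eqI)
  have "(D has_vector_derivative \<psi> (\<theta> + 0) - \<psi> (\<theta> - 0)) (at 0)"
    using has_vector_derivative_translate[OF d] has_vector_derivative_reflect_about[OF d] unfolding D_def
    by (auto intro!: derivative_eq_intros)
  then have "(D has_derivative (\<lambda>_. 0)) (at 0)" by (simp add: has_vector_derivative_def)
  moreover have "D 0 = 0" by (simp add: D_def)
  ultimately have D0: "\<forall>e>0. \<exists>d>0. \<forall>s. \<bar>s\<bar> < d \<longrightarrow> cmod (D s) \<le> e * \<bar>s\<bar>"
    unfolding has_derivative_at_alt by simp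
  have lr: "filterlim (\<lambda>\<epsilon>::real. 1 - \<epsilon>) (at_left 1) (at_right 0)"
    unfolding filterlim_at by (auto intro!: tendsto_eq_intros simp: eventually_at_filter)
  have rl: "((\<lambda>\<epsilon>. radial_op g (of_real (1 - \<epsilon>) * cis \<theta>)) \<longlongrightarrow> l) (at_right 0)"
    by (rule filterlim_compose[OF lim lr])
  have "((\<lambda>\<epsilon>. pi * radial_op g (of_real (1 - \<epsilon>) * cis \<theta>) + I \<epsilon>) \<longlongrightarrow> 0) (at_right 0)"
  proof (rule tendstoI)
    fix e :: real assume e: "e > 0"
    \<comment> \<open>With this \<open>\<eta>\<close> the term \<open>300 * \<eta>\<close> is
      \<open>e / 2\<close>.\<close>
    obtain d0 where d0: "d0 > 0" "\<And>s. \<bar>s\<bar> < d0 \<Longrightarrow> cmod (D s) \<le> e / 600 * \<bar>s\<bar>"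
      using D0[rule_format, of "e / 600"] e by auto
    define \<delta> where "\<delta> = d0 / 2"
    have \<delta>: "0 < \<delta>" "\<delta> < d0" using d0 by (auto simp: \<delta>_def)
    have "((\<lambda>\<epsilon>. 300 * (e / 600) + 448 * pi * (B / \<delta>^4) * \<epsilon>\<^sup>2) \<longlongrightarrow> 300 * (e / 600) + 448 * pi * (B / \<delta>^4) * 0\<^sup>2) (at_right 0)"
      by (intro tendsto_intros)
    then have "eventually (\<lambda>\<epsilon>. 300 * (e / 600) + 448 * pi * (B / \<delta>^4) * \<epsilon>\<^sup>2 < e) (at_right 0)"
      by (rule order_tendstoD) (use e in simp)
    moreover have "eventually (\<lambda>\<epsilon>. \<epsilon> \<in> {0<..<min \<delta> (1/2)}) (at_right 0)"
      using \<delta> by (intro eventually_at_right_real) auto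
    ultimately show "eventually (\<lambda>\<epsilon>. dist (pi * radial_op g (of_real (1 - \<epsilon>) * cis \<theta>) + I \<epsilon>) 0 < e) (at_right 0)"
    proof eventually_elim
      case (elim \<epsilon>)
      have "I \<epsilon> = integral {\<epsilon>..pi} (\<lambda>s. (1 / (4 * (sin (s/2))\<^sup>2)) *\<^sub>R D s) - (cos (\<epsilon>/2) / (2 * sin (\<epsilon>/2))) *\<^sub>R D \<epsilon>"
        unfolding I_def D_def using elim pi_gt3 by (intro hilbert_truncation[OF d M]) auto
      moreover have "cmod (pi * radial_op g (of_real (1 - \<epsilon>) * cis \<theta>)
        + (integral {\<epsilon>..pi} (\<lambda>s. (1 / (4 * (sin (s/2))\<^sup>2)) *\<^sub>R D s) - (cos (\<epsilon>/2) / (2 * sin (\<epsilon>/2))) *\<^sub>R D \<epsilon>))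
        \<le> 300 * (e / 600) + 448 * pi * (B / \<delta>^4) * \<epsilon>\<^sup>2"
        unfolding D_def
      proof (rule radial_op_truncation_bound[OF g per])
        show "cmod (g (\<theta> + s) + g (\<theta> - s) - 2 * g \<theta>) \<le> e / 600 * s" if "0 \<le> s" "s \<le> \<delta>" for s
          using d0(2)[of s] that \<delta> by (simp add: D_def)
        show "cmod (g (\<theta> + s) + g (\<theta> - s) - 2 * g \<theta>) \<le> B" if "0 \<le> s" "s \<le> pi" for s
          using B[of s] that by (simp add: D_def)
      qed (use elim e in auto)
      ultimately show ?case using elim by simp
    qed
  qed
  from tendsto_diff[OF this tendsto_mult_left[OF rl, of "of_real pi"]]
  have "(I \<longlongrightarrow> - (pi * l)) (at_right 0)" by simp
  then have "Lim (at_right 0) I = - (pi * l)" by (intro tendsto_Lim) auto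
  then show ?thesis unfolding hilbert_transform_def I_def by (simp add: scaleR_conv_of_real)
qed

section \<open>Poisson integrals\<close>

text \<open>For \<open>w = z * cis (-t)\<close> this is the classical form of the kernel as the real
  part of \<open>(1 + w) / (1 - w)\<close>, split into a holomorphic and an antiholomorphic
  summand.\<close>

lemma poisson_kernel_cis:
  assumes "cmod z < 1"
  shows "of_real (2 * pi * poisson_kernel z (cis t)) = 1 / (1 - z * cis (-t)) + cnj (1 / (1 - z * cis (-t))) - 1"
proof -
  let ?w = "z * cis (-t)"
  have w: "cmod ?w < 1" "cmod ?w = cmod z" using assms by (auto simp: norm_mult)
  have nz1: "1 - ?w \<noteq> 0" using w(1) by (rule one_minus_neq_zero)
  then have nz: "1 - ?w \<noteq> 0" "1 - cnj ?w \<noteq> 0"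
    by (simp, metis complex_cnj_diff complex_cnj_one complex_cnj_zero_iff)
  have "1 / (1 - ?w) + cnj (1 / (1 - ?w)) - 1 = (1 - ?w * cnj ?w) / ((1 - ?w) * cnj (1 - ?w))"
    using nz by (simp add: divide_simps) (simp add: algebra_simps)
  also have "\<dots> = of_real ((1 - (cmod z)\<^sup>2) / (cmod (1 - ?w))\<^sup>2)"
    using w(2) by (simp only: complex_norm_square[symmetric] of_real_divide of_real_diff of_real_1)
  finally show ?thesis by (simp add: poisson_kernel_def cis_cnj)
qed

text \<open>The kernel splits by \<open>poisson_kernel_cis\<close>. Conjugating the second integral
  conjugates the data too, hence the inner \<open>cnj\<close>; the mean value
  \<open>cauchy_transform \<Phi> 0\<close> is counted in both parts and subtracted once.\<close>

lemma poisson_integral_eq: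
  assumes \<phi>: "continuous_on (sphere 0 1) \<phi>" and z: "cmod z < 1"
  defines "\<Phi> \<equiv> \<lambda>t. \<phi> (cis t)"
  shows "poisson_integral \<phi> z = cauchy_transform \<Phi> z + cnj (cauchy_transform (\<lambda>t. cnj (\<Phi> t)) z) - cauchy_transform \<Phi> 0"
proof -
  have c\<Phi>: "continuous_on A \<Phi>" for A
    unfolding \<Phi>_def by (intro continuous_on_compose2[OF \<phi>] continuous_intros) auto
  have nz: "1 - z * cis (-t) \<noteq> 0" for t
    by (rule one_minus_neq_zero) (use z in \<open>simp add: norm_mult\<close>)
  have nz': "1 - cnj z * cnj (cis (-t)) \<noteq> 0" for t
    using nz[of t] by (metis complex_cnj_diff complex_cnj_mult complex_cnj_one complex_cnj_zero_iff)
  let ?f = "\<lambda>t. \<Phi> t / (1 - z * cis (-t)) + cnj (cnj (\<Phi> t) / (1 - z * cis (-t))) - \<Phi> t"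
  have eq: "poisson_kernel z (cis t) *\<^sub>R \<phi> (cis t) = ?f t / (2 * pi)" for t
  proof -
    have "of_real (2 * pi * poisson_kernel z (cis t)) * \<Phi> t = ?f t"
      unfolding poisson_kernel_cis[OF z] by (simp add: algebra_simps)
    then have "?f t / (2 * pi) = of_real (2 * pi * poisson_kernel z (cis t)) * \<Phi> t / (2 * pi)" by simp
    then show ?thesis by (simp add: scaleR_conv_of_real \<Phi>_def)
  qed
  have c: "continuous_on A (\<lambda>t. \<Phi> t / (1 - z * cis (-t)))"
    "continuous_on A (\<lambda>t. cnj (cnj (\<Phi> t) / (1 - z * cis (-t))))" for A
    using nz nz' by (auto intro!: continuous_intros c\<Phi>)
  have "continuous_on A (\<lambda>t. ?f t / (2 * pi))" for A by (intro continuous_intros c c\<Phi>) auto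
  then have "(\<lambda>t. ?f t / (2 * pi)) absolutely_integrable_on {0..2*pi}"
    by (intro absolutely_integrable_continuous_real)
  then have "poisson_integral \<phi> z = integral {0..2*pi} (\<lambda>t. ?f t / (2 * pi))"
    unfolding poisson_integral_def eq by (rule set_lebesgue_integral_eq_integral(2))
  also have "\<dots> = integral {0..2*pi} ?f / (2 * pi)" by simp
  also have "integral {0..2*pi} ?f = integral {0..2*pi} (\<lambda>t. \<Phi> t / (1 - z * cis (-t)))
      + integral {0..2*pi} (\<lambda>t. cnj (cnj (\<Phi> t) / (1 - z * cis (-t)))) - integral {0..2*pi} \<Phi>"
    by (subst integral_diff, (intro integrable_continuous_interval continuous_intros c c\<Phi>)+,
        subst integral_add, (intro integrable_continuous_interval c)+) simp
  also have "integral {0..2*pi} (\<lambda>t. cnj (cnj (\<Phi> t) / (1 - z * cis (-t)))) = cnj (integral {0..2*pi} (\<lambda>t. cnj (\<Phi> t) / (1 - z * cis (-t))))"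
    by (rule integral_cnj[symmetric])
  finally show ?thesis
    unfolding cauchy_transform_def by (simp add: diff_divide_distrib add_divide_distrib)
qed

lemma poisson_kernel_nonneg:
  assumes "cmod z < 1"
  shows "0 \<le> poisson_kernel z w"
  using assms by (simp add: poisson_kernel_def power_le_one)

text \<open>The conjugated kernel is the boundary value of \<open>1 / (1 - cnj z * w)\<close>, whose
  mean is its value 1 at \<open>w = 0\<close>. It follows that the Poisson kernel has integral
  1.\<close>

lemma cauchy_transform_one:
  assumes z: "cmod z < 1"
  shows "cauchy_transform (\<lambda>_. 1) z = 1"
proof -
  let ?h = "\<lambda>w. 1 / (1 - cnj z * w)"
  have nz: "1 - cnj z * w \<noteq> 0" if "cmod w \<le> 1" for w
  proof (rule one_minus_neq_zero)
    have "cmod (cnj z * w) \<le> cmod z * 1" unfolding norm_mult using that by (intro mult_mono) auto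
    then show "cmod (cnj z * w) < 1" using z by simp
  qed
  have "((\<lambda>t. ?h (cis t)) has_integral 2 * pi * ?h 0) {0..2*pi}"
    by (rule circle_mean_value) (use nz in \<open>auto intro!: continuous_intros holomorphic_intros simp: less_imp_le\<close>)
  then have "((\<lambda>t. cnj (?h (cis t))) has_integral cnj (2 * pi * ?h 0)) {0..2*pi}"
    by (subst has_integral_cnj[unfolded o_def])
  then have "((\<lambda>t. 1 / (1 - z * cis (-t))) has_integral 2 * pi) {0..2*pi}" by (simp add: cis_cnj)
  then show ?thesis unfolding cauchy_transform_def by (simp add: integral_unique)
qed

lemma poisson_integral_bounded:
  assumes \<phi>: "continuous_on (sphere 0 1) \<phi>" and z: "cmod z < 1" and B: "\<And>w. cmod w = 1 \<Longrightarrow> cmod (\<phi> w) \<le> B"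
  shows "cmod (poisson_integral \<phi> z) \<le> B"
proof -
  have nz: "1 - z * cnj (cis t) \<noteq> 0" for t
    by (rule one_minus_neq_zero) (use z in \<open>simp add: norm_mult\<close>)
  have c\<phi>: "continuous_on {0..2*pi} (\<lambda>t. \<phi> (cis t))"
    by (intro continuous_on_compose2[OF \<phi>] continuous_intros) auto
  have cP: "continuous_on {0..2*pi} (\<lambda>t. poisson_kernel z (cis t))"
    unfolding poisson_kernel_def using nz by (intro continuous_intros) auto
  have i: "(\<lambda>t. poisson_kernel z (cis t) *\<^sub>R \<phi> (cis t)) absolutely_integrable_on {0..2*pi}"
    by (intro absolutely_integrable_continuous_real continuous_intros cP c\<phi>)
  have "(\<lambda>t. poisson_kernel z (cis t) *\<^sub>R (1::complex)) absolutely_integrable_on {0..2*pi}"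
    by (intro absolutely_integrable_continuous_real continuous_intros cP)
  moreover have "poisson_integral (\<lambda>_. 1) z = 1"
    by (subst poisson_integral_eq) (use z in \<open>auto simp: cauchy_transform_one\<close>)
  ultimately have "integral {0..2*pi} (\<lambda>t. complex_of_real (poisson_kernel z (cis t))) = 1"
    unfolding poisson_integral_def by (simp add: set_lebesgue_integral_eq_integral(2) scaleR_conv_of_real)
  then have one: "integral {0..2*pi} (\<lambda>t. poisson_kernel z (cis t)) = 1"
    by (subst (asm) integral_of_real_eq) (auto intro!: integrable_continuous_interval cP)
  have "cmod (poisson_integral \<phi> z) = cmod (integral {0..2*pi} (\<lambda>t. poisson_kernel z (cis t) *\<^sub>R \<phi> (cis t)))"
    unfolding poisson_integral_def set_lebesgue_integral_eq_integral(2)[OF i] ..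
  also have "\<dots> \<le> integral {0..2*pi} (\<lambda>t. B * poisson_kernel z (cis t))"
  proof (rule integral_norm_bound_integral)
    show "norm (poisson_kernel z (cis t) *\<^sub>R \<phi> (cis t)) \<le> B * poisson_kernel z (cis t)" for t
      using B[of "cis t"] poisson_kernel_nonneg[OF z, of "cis t"] by (simp add: mult.commute[of B] mult_left_mono)
  qed (auto intro!: integrable_continuous_interval continuous_intros c\<phi> cP)
  also have "\<dots> = B" using one by simp
  finally show ?thesis .
qed

lemma poisson_integral_continuous:
  assumes \<phi>: "continuous_on (sphere 0 1) \<phi>"
  shows "continuous_on (ball 0 1) (poisson_integral \<phi>)"
proof -
  have c\<phi>: "continuous_on {0..2*pi} (\<lambda>t. \<phi> (cis t))" "continuous_on {0..2*pi} (\<lambda>t. cnj (\<phi> (cis t)))"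
    by (intro continuous_on_compose2[OF \<phi>] continuous_intros continuous_on_cnj; auto)+
  have "continuous_on (ball 0 1) (\<lambda>z. cauchy_transform (\<lambda>t. \<phi> (cis t)) z + cnj (cauchy_transform (\<lambda>t. cnj (\<phi> (cis t))) z) - cauchy_transform (\<lambda>t. \<phi> (cis t)) 0)"
    by (intro continuous_intros holomorphic_on_imp_continuous_on cauchy_transform_holomorphic c\<phi>)
  then show ?thesis by (rule continuous_on_eq) (simp add: poisson_integral_eq[OF \<phi>])
qed

text \<open>The hypothesis controls the derivative only away from 0, by \<open>2 * K\<close> for
  moduli above 1/2; the inner disk is handled by compactness. Convexity of the disk turns the bound
  on the derivative into a Lipschitz constant.\<close>

lemma holomorphic_lipschitz_of_euler_bounded:
  assumes h: "A holomorphic_on ball 0 1" and K: "\<And>z. cmod z < 1 \<Longrightarrow> cmod (z * deriv A z) \<le> K"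
  shows "\<exists>L. L-lipschitz_on (ball 0 1) A"
proof -
  have "continuous_on (cball 0 (1/2)) (deriv A)"
    by (rule continuous_on_subset[OF holomorphic_on_imp_continuous_on[OF holomorphic_deriv[OF h]]]) auto
  then have "compact (deriv A ` cball 0 (1/2))" by (intro compact_continuous_image) auto
  then obtain B where B: "\<And>z. z \<in> cball 0 (1/2) \<Longrightarrow> cmod (deriv A z) \<le> B"
    by (meson bounded_iff compact_imp_bounded image_eqI)
  have bd: "cmod (deriv A z) \<le> max B (2 * K)" if "z \<in> ball 0 1" for z
  proof (cases "cmod z \<le> 1/2")
    case True then show ?thesis using B[of z] by simp
  next
    case False
    have "1/2 * cmod (deriv A z) \<le> cmod z * cmod (deriv A z)" using False by (intro mult_right_mono) auto
    also have "\<dots> \<le> K" using K[of z] that by (simp add: norm_mult)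
    finally show ?thesis by simp
  qed
  have "cmod (A x - A y) \<le> max B (2 * K) * cmod (x - y)" if "x \<in> ball 0 1" "y \<in> ball 0 1" for x y
    by (rule field_differentiable_bound[of "ball 0 1" A "deriv A"])
       (use that bd h in \<open>auto intro!: holomorphic_derivI[of A "ball 0 1"]\<close>)
  moreover have "0 \<le> max B (2 * K)" using bd[of 0] norm_ge_zero[of "deriv A 0"] by (simp del: norm_ge_zero)
  ultimately show ?thesis by (intro exI lipschitz_onI) (auto simp: dist_norm)
qed

lemma norm_vector_derivative_le_lipschitz:
  fixes p :: "real \<Rightarrow> 'a::real_normed_vector"
  assumes d: "(p has_vector_derivative D) (at x)" and S: "open S" "x \<in> S"
    and lip: "\<And>y. y \<in> S \<Longrightarrow> norm (p y - p x) \<le> L * \<bar>y - x\<bar>"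
  shows "norm D \<le> L"
proof (rule field_le_epsilon)
  fix e :: real assume "e > 0"
  then obtain d1 where d1: "d1 > 0" "\<And>y. \<bar>y - x\<bar> < d1 \<Longrightarrow> norm (p y - p x - (y - x) *\<^sub>R D) \<le> e * \<bar>y - x\<bar>"
    using d unfolding has_vector_derivative_def has_derivative_at_alt by auto
  obtain d2 where d2: "d2 > 0" "ball x d2 \<subseteq> S" using S openE by blast
  define y where "y = x + min d1 d2 / 2"
  have y: "\<bar>y - x\<bar> < d1" "y \<in> S" "\<bar>y - x\<bar> > 0" using d1(1) d2 by (auto simp: y_def dist_norm)
  have "\<bar>y - x\<bar> * norm D = norm ((p y - p x) - (p y - p x - (y - x) *\<^sub>R D))" by simp
  also have "\<dots> \<le> L * \<bar>y - x\<bar> + e * \<bar>y - x\<bar>"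
    by (rule norm_triangle_le_diff[OF add_mono[OF lip[OF y(2)] d1(2)[OF y(1)]]])
  also have "\<dots> = \<bar>y - x\<bar> * (L + e)" by (simp add: algebra_simps)
  finally show "norm D \<le> L + e" using y(3) by (simp only: mult_le_cancel_left_pos)
qed

lemma radial_angular_koebe:
  "koebe_transform g z = (radial_op g z - \<i> * angular_op g z) / 2"
  "cnj (koebe_transform (\<lambda>t. cnj (g t)) z) = (radial_op g z + \<i> * angular_op g z) / 2"
  by (simp_all add: radial_op_def angular_op_def algebra_simps)

text \<open>A Lipschitz constant bounds the derivative along rays, and \<open>radial_op\<close> is
  that derivative times the radius. Conversely, bounds on both operators bound the Koebe transforms
  of the data and of its conjugate separately, by \<open>radial_angular_koebe\<close>, so the
  holomorphic and the antiholomorphic part are each Lipschitz.\<close>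

lemma poisson_integral_lipschitz_iff:
  assumes \<phi>: "continuous_on (sphere 0 1) \<phi>"
  defines "\<Phi> \<equiv> \<lambda>t. \<phi> (cis t)"
  assumes ang: "\<And>z. cmod z < 1 \<Longrightarrow> cmod (angular_op \<Phi> z) \<le> K"
  shows "(\<exists>L. L-lipschitz_on (ball 0 1) (poisson_integral \<phi>)) \<longleftrightarrow> (\<exists>C. \<forall>z. cmod z < 1 \<longrightarrow> cmod (radial_op \<Phi> z) \<le> C)"
proof
  have c\<Phi>: "continuous_on {0..2*pi} \<Phi>" "continuous_on {0..2*pi} (\<lambda>t. cnj (\<Phi> t))"
    unfolding \<Phi>_def by (intro continuous_on_compose2[OF \<phi>] continuous_intros continuous_on_cnj; auto)+
  define A where "A = cauchy_transform \<Phi>"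
  define A' where "A' = cauchy_transform (\<lambda>t. cnj (\<Phi> t))"
  have hA: "A holomorphic_on ball 0 1" "A' holomorphic_on ball 0 1"
    unfolding A_def A'_def by (intro cauchy_transform_holomorphic c\<Phi>)+
  have eA: "z * deriv A z = koebe_transform \<Phi> z" "z * deriv A' z = koebe_transform (\<lambda>t. cnj (\<Phi> t)) z" if "cmod z < 1" for z
    unfolding A_def A'_def using koebe_transform_eq_deriv[OF c\<Phi>(1) that] koebe_transform_eq_deriv[OF c\<Phi>(2) that] by auto
  have u: "poisson_integral \<phi> z = A z + cnj (A' z) - A 0" if "cmod z < 1" for z
    using poisson_integral_eq[OF \<phi> that] by (simp add: A_def A'_def \<Phi>_def)
  {
    assume "\<exists>L. L-lipschitz_on (ball 0 1) (poisson_integral \<phi>)"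
    then obtain L where L: "L-lipschitz_on (ball 0 1) (poisson_integral \<phi>)" by blast
    have "cmod (radial_op \<Phi> z) \<le> L" if z: "cmod z < 1" for z
    proof -
      define w where "w = cis (Arg z)"
      define r where "r = cmod z"
      have zr: "z = of_real r * w" unfolding w_def r_def by (simp only: rcis_def[symmetric] rcis_cmod_Arg)
      have w1: "cmod w = 1" by (simp add: w_def)
      have hd: "(A has_field_derivative deriv A z) (at z)" "(A' has_field_derivative deriv A' z) (at z)"
        using hA z by (auto intro!: holomorphic_derivI[of _ "ball 0 1"])
      have dl: "((\<lambda>s. of_real s * w) has_vector_derivative w) (at r)"
        by (auto intro!: derivative_eq_intros)
      have d1: "((\<lambda>s. A (of_real s * w)) has_vector_derivative w * deriv A z) (at r)"
        using field_vector_diff_chain_at[OF dl, of A "deriv A z"] hd(1) by (simp add: zr o_def)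
      have d2: "((\<lambda>s. A' (of_real s * w)) has_vector_derivative w * deriv A' z) (at r)"
        using field_vector_diff_chain_at[OF dl, of A' "deriv A' z"] hd(2) by (simp add: zr o_def)
      have d: "((\<lambda>s. A (of_real s * w) + cnj (A' (of_real s * w)) - A 0) has_vector_derivative w * deriv A z + cnj (w * deriv A' z)) (at r)"
        by (rule derivative_eq_intros d1 has_vector_derivative_cnj[OF d2] | simp)+
      \<comment> \<open>The whole diameter is used rather than the ray, so that \<open>r = 0\<close>
        is an interior point too.\<close>
      have S: "open {-1<..<1::real}" "r \<in> {-1<..<1}" using z norm_ge_zero[of z] by (auto simp: r_def simp del: norm_ge_zero intro: less_le_trans)
      have "cmod (w * deriv A z + cnj (w * deriv A' z)) \<le> L"
      proof (rule norm_vector_derivative_le_lipschitz[OF d S])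
        fix s :: real assume s: "s \<in> {-1<..<1}"
        have ball: "of_real s * w \<in> ball 0 1" "of_real r * w \<in> ball 0 1" using s S w1 by (auto simp: norm_mult)
        have "cmod (poisson_integral \<phi> (of_real s * w) - poisson_integral \<phi> (of_real r * w)) \<le> L * cmod (of_real s * w - of_real r * w)"
          using lipschitz_onD[OF L ball] by (simp add: dist_norm)
        also have "cmod (of_real s * w - of_real r * w) = \<bar>s - r\<bar>"
          using w1 by (metis left_diff_distrib mult.right_neutral norm_mult norm_of_real of_real_diff)
        finally show "cmod (A (of_real s * w) + cnj (A' (of_real s * w)) - A 0 - (A (of_real r * w) + cnj (A' (of_real r * w)) - A 0)) \<le> L * \<bar>s - r\<bar>"
          using u[of "of_real s * w"] u[of "of_real r * w"] ball by simp
      qed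
      moreover have "radial_op \<Phi> z = of_real r * (w * deriv A z + cnj (w * deriv A' z))"
        unfolding radial_op_def eA(1)[OF z, symmetric] eA(2)[OF z, symmetric]
        by (subst (1 3) zr) (simp add: algebra_simps)
      ultimately have "cmod (radial_op \<Phi> z) \<le> r * L"
        using S by (simp add: norm_mult r_def mult_left_mono del: complex_cnj_mult)
      also have "\<dots> \<le> 1 * L" using lipschitz_on_nonneg[OF L] S by (intro mult_right_mono) auto
      finally show ?thesis by simp
    qed
    then show "\<exists>C. \<forall>z. cmod z < 1 \<longrightarrow> cmod (radial_op \<Phi> z) \<le> C" by blast
  next
    assume "\<exists>C. \<forall>z. cmod z < 1 \<longrightarrow> cmod (radial_op \<Phi> z) \<le> C"
    then obtain C where C: "\<And>z. cmod z < 1 \<Longrightarrow> cmod (radial_op \<Phi> z) \<le> C" by blast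
    have b1: "cmod (z * deriv A z) \<le> (C + K) / 2" if z: "cmod z < 1" for z
    proof -
      have "cmod (radial_op \<Phi> z - \<i> * angular_op \<Phi> z) \<le> C + K"
        using C[OF z] ang[OF z] by (intro norm_triangle_le_diff add_mono) (auto simp: norm_mult)
      then show ?thesis unfolding eA(1)[OF z] radial_angular_koebe(1) by (simp add: norm_divide)
    qed
    have b2: "cmod (z * deriv A' z) \<le> (C + K) / 2" if z: "cmod z < 1" for z
    proof -
      have "cmod (radial_op \<Phi> z + \<i> * angular_op \<Phi> z) \<le> C + K"
        using C[OF z] ang[OF z] by (intro norm_triangle_le add_mono) (auto simp: norm_mult)
      then have "cmod (cnj (koebe_transform (\<lambda>t. cnj (\<Phi> t)) z)) \<le> (C + K) / 2"
        unfolding radial_angular_koebe(2) by (simp add: norm_divide)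
      then show ?thesis unfolding eA(2)[OF z] by simp
    qed
    obtain L1 L2 where L: "L1-lipschitz_on (ball 0 1) A" "L2-lipschitz_on (ball 0 1) A'"
      using holomorphic_lipschitz_of_euler_bounded[OF hA(1) b1] holomorphic_lipschitz_of_euler_bounded[OF hA(2) b2] by blast
    have "(L1 + L2)-lipschitz_on (ball 0 1) (poisson_integral \<phi>)"
    proof (rule lipschitz_onI)
      fix x y :: complex assume xy: "x \<in> ball 0 1" "y \<in> ball 0 1"
      have "poisson_integral \<phi> x - poisson_integral \<phi> y = (A x - A y) + cnj (A' x - A' y)"
        using xy by (simp add: u)
      then have "cmod (poisson_integral \<phi> x - poisson_integral \<phi> y) \<le> cmod (A x - A y) + cmod (A' x - A' y)"
        by (metis complex_mod_cnj norm_triangle_ineq)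
      then show "dist (poisson_integral \<phi> x) (poisson_integral \<phi> y) \<le> (L1 + L2) * dist x y"
        using lipschitz_onD[OF L(1) xy] lipschitz_onD[OF L(2) xy] by (simp add: dist_norm algebra_simps)
    qed (use L[THEN lipschitz_on_nonneg] in simp)
    then show "\<exists>L. L-lipschitz_on (ball 0 1) (poisson_integral \<phi>)" by blast
  }
qed

section \<open>Mean convergence of the radial derivative\<close>

lemma koebe_transform_linear:
  assumes "continuous_on {0..2*pi} g" "continuous_on {0..2*pi} g'" "cmod z < 1"
  shows "koebe_transform (\<lambda>t. a * g t + b * g' t) z = a * koebe_transform g z + b * koebe_transform g' z"
proof -
  note c = continuous_koebe_cis[OF assms(3)]
  have "integral {0..2*pi} (\<lambda>t. (a * g t + b * g' t) * koebe (z * cis (-t)))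
     = integral {0..2*pi} (\<lambda>t. a * (g t * koebe (z * cis (-t))) + b * (g' t * koebe (z * cis (-t))))"
    by (rule arg_cong[where f = "integral {0..2*pi}"]) (simp add: fun_eq_iff algebra_simps)
  also have "\<dots> = a * integral {0..2*pi} (\<lambda>t. g t * koebe (z * cis (-t))) + b * integral {0..2*pi} (\<lambda>t. g' t * koebe (z * cis (-t)))"
    using assms c by (subst integral_add) (auto intro!: integrable_continuous_interval continuous_intros)
  finally show ?thesis unfolding koebe_transform_def by (simp add: add_divide_distrib)
qed

lemma koebe_transform_const:
  assumes "cmod z < 1"
  shows "koebe_transform (\<lambda>_. c) z = 0"
  using koebe_transform_cis[of "\<lambda>_. c" z] assms by simp

text \<open>The isometry of the conjugate function operator. The differences of the Koebe transforms
  at the two radii are holomorphic functions \<open>X\<close>, \<open>Y\<close> vanishing at 0, and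
  the two squared moduli differ by \<open>4 * Re (X * Y)\<close>, whose circle mean is 0.\<close>

lemma radial_minus_angular_L2:
  fixes r s :: real
  assumes g: "continuous_on {0..2*pi} g" and r: "0 \<le> r" "r < 1" "0 \<le> s" "s < 1"
  shows "integral {0..2*pi} (\<lambda>t. (cmod (radial_op g (r * cis t) - radial_op g (s * cis t)))\<^sup>2)
       = integral {0..2*pi} (\<lambda>t. (cmod (angular_op g (r * cis t) - angular_op g (s * cis t)))\<^sup>2)"
proof -
  have g': "continuous_on {0..2*pi} (\<lambda>t. cnj (g t))" using g by (rule continuous_on_cnj)
  define E where "E = koebe_transform g"
  define E' where "E' = koebe_transform (\<lambda>t. cnj (g t))"
  define X where "X z = E (r * z) - E (s * z)" for z :: complex
  define Y where "Y z = E' (r * z) - E' (s * z)" for z :: complex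
  have hE: "E holomorphic_on ball 0 1" "E' holomorphic_on ball 0 1"
    unfolding E_def E'_def using g g' by (auto intro: koebe_transform_holomorphic)
  have sub: "cmod (complex_of_real q * z) < 1" if "0 \<le> q" "q < 1" "cmod z \<le> 1" for q z
  proof -
    have "q * cmod z \<le> q * 1" using that by (intro mult_left_mono) auto
    then show ?thesis using that by (simp add: norm_mult)
  qed
  have scale: "(\<lambda>z. F (of_real q * z)) holomorphic_on ball 0 1" "continuous_on (cball 0 1) (\<lambda>z. F (of_real q * z))"
    if "F holomorphic_on ball 0 1" "0 \<le> q" "q < 1" for F q
    using that sub
    by (auto intro!: holomorphic_on_compose_gen[of _ _ F "ball 0 1", unfolded o_def] holomorphic_intros
        continuous_on_compose2[OF holomorphic_on_imp_continuous_on[of F "ball 0 1"]] continuous_intros)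
  have cX: "continuous_on (cball 0 1) X" "continuous_on (cball 0 1) Y"
    unfolding X_def Y_def using hE r by (auto intro!: continuous_intros scale(2))
  have hX: "X holomorphic_on ball 0 1" "Y holomorphic_on ball 0 1"
    unfolding X_def Y_def using hE r by (auto intro!: holomorphic_intros scale(1))
  have "((\<lambda>t. X (cis t) * Y (cis t)) has_integral 2 * pi * (X 0 * Y 0)) {0..2*pi}"
    by (rule circle_mean_value[of "\<lambda>z. X z * Y z"]) (auto intro!: continuous_intros holomorphic_intros cX hX)
  then have XY: "((\<lambda>t. X (cis t) * Y (cis t)) has_integral 0) {0..2*pi}"
    by (simp add: X_def)
  then have "((\<lambda>t. Re (X (cis t) * Y (cis t))) has_integral 0) {0..2*pi}"
    using has_integral_linear[OF XY bounded_linear_Re] by (simp add: o_def)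
  from has_integral_mult_right[OF this, of 4]
  have ReXY: "((\<lambda>t. 4 * Re (X (cis t) * Y (cis t))) has_integral 0) {0..2*pi}" by simp
  have par: "(cmod (x + cnj y))\<^sup>2 = (cmod (\<i> * (x - cnj y)))\<^sup>2 + 4 * Re (x * y)" for x y
    unfolding cmod_power2 by (simp add: power2_eq_square algebra_simps)
  have rad: "radial_op g (r * cis t) - radial_op g (s * cis t) = X (cis t) + cnj (Y (cis t))" for t
    by (simp add: radial_op_def X_def Y_def E_def E'_def)
  have ang: "angular_op g (r * cis t) - angular_op g (s * cis t) = \<i> * (X (cis t) - cnj (Y (cis t)))" for t
    by (simp add: angular_op_def X_def Y_def E_def E'_def algebra_simps)
  have cc: "continuous_on {0..2*pi} (\<lambda>t. X (cis t))" "continuous_on {0..2*pi} (\<lambda>t. Y (cis t))"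
    by (intro continuous_on_compose2[OF cX(1)] continuous_on_compose2[OF cX(2)] continuous_intros; auto)+
  have "(\<lambda>t. (cmod (\<i> * (X (cis t) - cnj (Y (cis t)))))\<^sup>2) integrable_on {0..2*pi}"
    by (intro integrable_continuous_interval continuous_intros cc)
  from has_integral_add[OF integrable_integral[OF this] ReXY]
  show ?thesis unfolding rad ang par by (simp add: integral_unique)
qed

text \<open>The Riesz-Fischer argument: the telescoping series converges absolutely almost
  everywhere, and the sum of the norms is an integrable majorant of the distances to the
  limit.\<close>

lemma L1_limit:
  fixes f :: "nat \<Rightarrow> 'a \<Rightarrow> 'b::{banach, second_countable_topology}"
  assumes int: "\<And>j. integrable M (f j)"
    and sum: "summable (\<lambda>j. \<integral>x. norm (f (Suc j) x - f j x) \<partial>M)"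
  obtains h where "integrable M h" "(\<lambda>j. \<integral>x. norm (f j x - h x) \<partial>M) \<longlonglongrightarrow> 0"
proof -
  define d where "d j x = f (Suc j) x - f j x" for j x
  have di: "integrable M (d j)" for j unfolding d_def using int by auto
  have dm [measurable]: "d j \<in> borel_measurable M" for j using di by auto
  have "(\<integral>\<^sup>+x. (\<Sum>j. ennreal (norm (d j x))) \<partial>M) = (\<Sum>j. \<integral>\<^sup>+x. ennreal (norm (d j x)) \<partial>M)"
    by (rule nn_integral_suminf) measurable
  also have "\<dots> = (\<Sum>j. ennreal (\<integral>x. norm (d j x) \<partial>M))"
    by (intro suminf_cong nn_integral_eq_integral integrable_norm di) auto
  also have "\<dots> = ennreal (\<Sum>j. \<integral>x. norm (d j x) \<partial>M)"
    by (rule suminf_ennreal2) (use sum in \<open>auto simp: d_def\<close>)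
  finally have "(\<integral>\<^sup>+x. (\<Sum>j. ennreal (norm (d j x))) \<partial>M) \<noteq> \<infinity>" by simp
  then have "AE x in M. (\<Sum>j. ennreal (norm (d j x))) \<noteq> \<infinity>"
    by (intro nn_integral_PInf_AE) measurable
  then have ae: "AE x in M. summable (\<lambda>j. norm (d j x))"
    by eventually_elim (auto intro: summable_suminf_not_top)
  define h where "h x = f 0 x + (\<Sum>j. d j x)" for x
  have si: "integrable M (\<lambda>x. \<Sum>j. d j x)"
    by (rule integrable_suminf[OF di ae]) (use sum in \<open>simp add: d_def\<close>)
  then have hi: "integrable M h" unfolding h_def using int by auto
  have Gi: "integrable M (\<lambda>x. \<Sum>j. norm (d j x))"
    by (rule integrable_suminf[OF integrable_norm[OF di]]) (use ae sum in \<open>simp_all add: d_def\<close>)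
  have tele: "f j x = f 0 x + (\<Sum>i<j. d i x)" for j x
    by (induction j) (auto simp: d_def)
  have "(\<lambda>j. \<integral>x. norm (f j x - h x) \<partial>M) \<longlonglongrightarrow> (\<integral>x. 0 \<partial>M)"
  proof (rule integral_dominated_convergence[OF _ _ Gi])
    show "AE x in M. (\<lambda>j. norm (f j x - h x)) \<longlonglongrightarrow> 0"
      using ae
    proof eventually_elim
      case (elim x)
      have "(\<lambda>j. f 0 x + (\<Sum>i<j. d i x)) \<longlonglongrightarrow> h x"
        unfolding h_def by (intro tendsto_intros summable_LIMSEQ summable_norm_cancel[OF elim])
      then have "(\<lambda>j. f j x) \<longlonglongrightarrow> h x" unfolding tele[symmetric] .
      then show ?case using LIM_zero tendsto_norm_zero by blast
    qed
    show "AE x in M. norm (norm (f j x - h x)) \<le> (\<Sum>j. norm (d j x))" for j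
      using ae
    proof eventually_elim
      case (elim x)
      have s: "summable (\<lambda>i. d i x)" by (rule summable_norm_cancel[OF elim])
      have "f j x - h x = - (\<Sum>i. d (i + j) x)"
        unfolding h_def suminf_split_initial_segment[OF s, of j] by (subst tele) simp
      then have "norm (f j x - h x) = norm (\<Sum>i. d (i + j) x)" by simp
      also have "\<dots> \<le> (\<Sum>i. norm (d (i + j) x))"
        by (rule summable_norm[OF summable_ignore_initial_segment[OF elim]])
      also have "\<dots> \<le> (\<Sum>i<j. norm (d i x)) + (\<Sum>i. norm (d (i + j) x))" by (simp add: sum_nonneg)
      also have "\<dots> = (\<Sum>i. norm (d i x))"
        using suminf_split_initial_segment[OF elim, of j] by simp
      finally show ?case by simp
    qed
  qed (use int hi in auto)
  then show ?thesis using that[OF hi] by simp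
qed

text \<open>Lebesgue's differentiation theorem, assembled from one-sided statements: right
  difference quotients of the integral of \<open>f\<close>, and left ones through the reflected
  function.\<close>

lemma has_vector_derivative_indefinite_integral_ae:
  fixes h :: "real \<Rightarrow> 'a::euclidean_space"
  assumes h: "h integrable_on {0..b}"
  obtains N where "negligible N" "\<And>x. x \<in> {0<..<b} \<Longrightarrow> x \<notin> N \<Longrightarrow> ((\<lambda>x. integral {0..x} h) has_vector_derivative h x) (at x)"
proof -
  \<comment> \<open>Extension by 0 makes the function integrable on every interval, as needed around
    arbitrary points and after reflection.\<close>
  define f where "f x = (if x \<in> {0..b} then h x else 0)" for x
  have fi: "f integrable_on {c..d}" for c d
    using integrable_altD(1)[OF h, of c d] unfolding f_def[abs_def] by (simp only: interval_cbox)
  have fi': "(\<lambda>x. f (- x)) integrable_on {c..d}" for c d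
    using fi[of "-d" "-c"] Henstock_Kurzweil_Integration.integrable_reflect_real[where f = f and a = "-d" and b = "-c"] by simp
  obtain N1 where N1: "negligible N1"
    "\<And>x e. x \<notin> N1 \<Longrightarrow> 0 < e \<Longrightarrow> \<exists>d>0. \<forall>k. 0 < k \<and> k < d \<longrightarrow> norm (integral {x..x + k} f /\<^sub>R k - f x) < e"
    using integrable_ccontinuous_explicit[of f] fi by auto
  obtain N2 where N2: "negligible N2"
    "\<And>x e. x \<notin> N2 \<Longrightarrow> 0 < e \<Longrightarrow> \<exists>d>0. \<forall>k. 0 < k \<and> k < d \<longrightarrow> norm (integral {x..x + k} (\<lambda>x. f (- x)) /\<^sub>R k - f (- x)) < e"
    using integrable_ccontinuous_explicit[of "\<lambda>x. f (- x)"] fi' by auto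
  have "negligible (uminus ` N2)"
    by (rule negligible_differentiable_image_negligible[OF _ N2(1)]) (auto intro!: derivative_intros)
  then have "negligible (N1 \<union> uminus ` N2)" using N1(1) by simp
  moreover have "((\<lambda>x. integral {0..x} h) has_vector_derivative h x) (at x)"
    if x: "x \<in> {0<..<b}" "x \<notin> N1 \<union> uminus ` N2" for x
    unfolding has_vector_derivative_def has_derivative_at_alt
  proof (intro conjI allI impI)
    fix e :: real assume e: "e > 0"
    have nx: "x \<notin> N1" "- x \<notin> N2" using x(2) by (auto simp: image_iff)
    obtain d1 where d1: "d1 > 0" "\<And>k. 0 < k \<Longrightarrow> k < d1 \<Longrightarrow> norm (integral {x..x + k} f /\<^sub>R k - f x) < e"
      using N1(2)[OF nx(1) e] by blast
    obtain d2 where d2: "d2 > 0" "\<And>k. 0 < k \<Longrightarrow> k < d2 \<Longrightarrow> norm (integral {- x..- x + k} (\<lambda>x. f (- x)) /\<^sub>R k - f x) < e"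
      using N2(2)[OF nx(2) e] by auto
    have fx: "f x = h x" using x by (simp add: f_def)
    have hi: "h integrable_on {c..d}" if "0 \<le> c" "d \<le> b" for c d
      by (rule integrable_on_subinterval[OF h]) (use that in auto)
    have comb: "integral {0..d} h - integral {0..c} h = integral {c..d} f" if "0 \<le> c" "c \<le> d" "d \<le> b" for c d
    proof -
      have "integral {0..c} h + integral {c..d} h = integral {0..d} h"
        using that by (intro Henstock_Kurzweil_Integration.integral_combine hi) auto
      moreover have "integral {c..d} f = integral {c..d} h"
        by (rule Henstock_Kurzweil_Integration.integral_cong) (use that in \<open>auto simp: f_def\<close>)
      ultimately show ?thesis by (simp add: algebra_simps)
    qed
    have scal: "norm (I - k *\<^sub>R c) \<le> e * k" if "norm (I /\<^sub>R k - c) < e" "0 < k" for I c :: 'a and k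
    proof -
      have "I - k *\<^sub>R c = k *\<^sub>R (I /\<^sub>R k - c)" using that by (simp add: algebra_simps)
      then have "norm (I - k *\<^sub>R c) = k * norm (I /\<^sub>R k - c)" using that by simp
      also have "\<dots> \<le> k * e" using that by (intro mult_left_mono) auto
      finally show ?thesis by (simp add: mult.commute)
    qed
    show "\<exists>d>0. \<forall>y. norm (y - x) < d \<longrightarrow>
        norm (integral {0..y} h - integral {0..x} h - (y - x) *\<^sub>R h x) \<le> e * norm (y - x)"
    proof (intro exI[of _ "min (min d1 d2) (min x (b - x))"] conjI allI impI)
      show "0 < min (min d1 d2) (min x (b - x))" using d1(1) d2(1) x by simp
      fix y assume y: "norm (y - x) < min (min d1 d2) (min x (b - x))"
      consider "y = x" | "y > x" | "y < x" by linarith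
      then show "norm (integral {0..y} h - integral {0..x} h - (y - x) *\<^sub>R h x) \<le> e * norm (y - x)"
      proof cases
        case 2
        have "norm (integral {x..x + (y - x)} f - (y - x) *\<^sub>R h x) \<le> e * (y - x)"
          using d1(2)[of "y - x"] y 2 fx by (intro scal) auto
        then show ?thesis using comb[of x y] 2 y x by simp
      next
        case 3
        have "integral {- x..- x + (x - y)} (\<lambda>x. f (- x)) = integral {y..x} f"
          using Henstock_Kurzweil_Integration.integral_reflect_real[of x y f] by simp
        then have "norm (integral {y..x} f - (x - y) *\<^sub>R h x) \<le> e * (x - y)"
          using d2(2)[of "x - y"] y 3 fx by (intro scal) auto
        then have "norm (integral {0..x} h - integral {0..y} h - (x - y) *\<^sub>R h x) \<le> e * (x - y)"
          using comb[of y x] 3 y x by simp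
        moreover have "integral {0..x} h - integral {0..y} h - (x - y) *\<^sub>R h x = - (integral {0..y} h - integral {0..x} h - (y - x) *\<^sub>R h x)"
          by (simp add: algebra_simps)
        ultimately show ?thesis using 3 by (simp only: norm_minus_cancel) simp
      qed simp
    qed
  qed (rule bounded_linear_scaleR_left)
  ultimately show ?thesis using that by blast
qed

text \<open>Up to an additive constant the harmonic conjugate of the Poisson integral of
  \<open>g\<close>: that integral plus \<open>\<i>\<close> times this function is twice
  \<open>cauchy_transform g\<close> up to a constant. By the Cauchy-Riemann equations its angular
  derivative is \<open>radial_op g\<close>.\<close>

definition conjugate_transform :: "(real \<Rightarrow> complex) \<Rightarrow> complex \<Rightarrow> complex" where
  "conjugate_transform g z = - \<i> * cauchy_transform g z + \<i> * cnj (cauchy_transform (\<lambda>t. cnj (g t)) z)"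

lemma conjugate_transform_has_vector_derivative:
  assumes g: "continuous_on {0..2*pi} g" and s: "0 \<le> s" "s < (1::real)"
  shows "((\<lambda>t. conjugate_transform g (s * cis t)) has_vector_derivative radial_op g (s * cis t)) (at t)"
proof -
  have g': "continuous_on {0..2*pi} (\<lambda>t. cnj (g t))" using g by (rule continuous_on_cnj)
  have z: "cmod (s * cis t) < 1" using s by (simp add: norm_mult)
  have dc: "((\<lambda>t. s * cis t) has_vector_derivative \<i> * (s * cis t)) (at t)"
    unfolding has_vector_derivative_def
    by (auto intro!: derivative_eq_intros simp: scaleR_conv_of_real mult_ac)
  obtain D where D: "(cauchy_transform g has_field_derivative D) (at (s * cis t))" "(s * cis t) * D = koebe_transform g (s * cis t)"
    using cauchy_transform_has_derivative[OF g z] .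
  obtain D' where D': "(cauchy_transform (\<lambda>t. cnj (g t)) has_field_derivative D') (at (s * cis t))"
    "(s * cis t) * D' = koebe_transform (\<lambda>t. cnj (g t)) (s * cis t)"
    using cauchy_transform_has_derivative[OF g' z] .
  have 1: "((\<lambda>t. cauchy_transform g (s * cis t)) has_vector_derivative \<i> * koebe_transform g (s * cis t)) (at t)"
    using field_vector_diff_chain_at[OF dc D(1)] D(2) by (simp add: o_def mult.assoc)
  have 2: "((\<lambda>t. cauchy_transform (\<lambda>t. cnj (g t)) (s * cis t)) has_vector_derivative \<i> * koebe_transform (\<lambda>t. cnj (g t)) (s * cis t)) (at t)"
    using field_vector_diff_chain_at[OF dc D'(1)] D'(2) by (simp add: o_def mult.assoc)
  have "((\<lambda>t. conjugate_transform g (s * cis t)) has_vector_derivative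
      - \<i> * (\<i> * koebe_transform g (s * cis t)) + \<i> * cnj (\<i> * koebe_transform (\<lambda>t. cnj (g t)) (s * cis t))) (at t)"
    unfolding conjugate_transform_def
    by (intro has_vector_derivative_add has_vector_derivative_mult_right has_vector_derivative_cnj 1 2)
  then show ?thesis by (simp add: radial_op_def mult.assoc[symmetric])
qed

text \<open>The conjugate function restricted to the circle of radius \<open>s\<close> is smooth
  boundary data whose harmonic extension is its own dilation. The constant \<open>c\<close> is free
  because constants are annihilated; it serves to normalize at angle 0.\<close>

lemma angular_op_conjugate_transform:
  assumes g: "continuous_on {0..2*pi} g" and s: "0 \<le> s" "s < (1::real)" and z: "cmod z < 1"
  shows "angular_op (\<lambda>t. conjugate_transform g (s * cis t) - c) z = radial_op g (s * z)"
proof -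
  have g': "continuous_on {0..2*pi} (\<lambda>t. cnj (g t))" using g by (rule continuous_on_cnj)
  have sub: "cmod (complex_of_real s * w) < 1" if "cmod w \<le> 1" for w
  proof -
    have "s * cmod w \<le> s * 1" using that s by (intro mult_left_mono) auto
    then show ?thesis using s by (simp add: norm_mult)
  qed
  have *: "continuous_on (cball 0 1) (\<lambda>w::complex. cauchy_transform k (s * w))"
      "(\<lambda>w::complex. cauchy_transform k (s * w)) holomorphic_on ball 0 1"
      "z * deriv (\<lambda>w::complex. cauchy_transform k (s * w)) z = koebe_transform k (s * z)"
      "continuous_on {0..2*pi} (\<lambda>t. cauchy_transform k (s * cis t))"
    if k: "continuous_on {0..2*pi} k" for k
  proof -
    show c: "continuous_on (cball 0 1) (\<lambda>w::complex. cauchy_transform k (s * w))"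
      by (rule continuous_on_compose2[OF holomorphic_on_imp_continuous_on[OF cauchy_transform_holomorphic[OF k]]])
         (auto intro!: continuous_intros sub)
    show "(\<lambda>w::complex. cauchy_transform k (s * w)) holomorphic_on ball 0 1"
      by (rule holomorphic_on_compose_gen[OF _ cauchy_transform_holomorphic[OF k], unfolded o_def])
         (auto intro!: holomorphic_intros sub)
    obtain D where D: "(cauchy_transform k has_field_derivative D) (at (s * z))" "(s * z) * D = koebe_transform k (s * z)"
      using cauchy_transform_has_derivative[OF k, of "s * z"] sub[of z] z by auto
    have "((\<lambda>w::complex. cauchy_transform k (s * w)) has_field_derivative D * (s * 1)) (at z)"
      by (rule DERIV_chain2[of "cauchy_transform k" D "\<lambda>w. s * w" z, OF D(1)]) (auto intro!: derivative_eq_intros)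
    then show "z * deriv (\<lambda>w::complex. cauchy_transform k (s * w)) z = koebe_transform k (s * z)"
      using D(2) by (simp add: DERIV_imp_deriv mult_ac)
    show "continuous_on {0..2*pi} (\<lambda>t. cauchy_transform k (s * cis t))"
      by (rule continuous_on_compose2[OF c, of "{0..2*pi}" cis]) (auto intro!: continuous_intros)
  qed
  note A = *[OF g] and B = *[OF g']
  let ?a = "\<lambda>t. cauchy_transform g (s * cis t)" and ?b = "\<lambda>t. cauchy_transform (\<lambda>t. cnj (g t)) (s * cis t)"
  have cc: "continuous_on {0..2*pi} (\<lambda>t. cnj (?a t))" "continuous_on {0..2*pi} (\<lambda>t. cnj (?b t))"
    using A(4) B(4) by (auto intro: continuous_on_cnj)
  have ka: "koebe_transform ?a z = koebe_transform g (s * z)" "koebe_transform (\<lambda>t. cnj (?a t)) z = 0"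
    using koebe_transform_cis[OF A(1,2) z] A(3) koebe_transform_cnj_cis[OF A(1,2) z] by auto
  have kb: "koebe_transform ?b z = koebe_transform (\<lambda>t. cnj (g t)) (s * z)" "koebe_transform (\<lambda>t. cnj (?b t)) z = 0"
    using koebe_transform_cis[OF B(1,2) z] B(3) koebe_transform_cnj_cis[OF B(1,2) z] by auto
  let ?v = "\<lambda>t. - \<i> * ?a t + \<i> * cnj (?b t)" and ?v' = "\<lambda>t. \<i> * cnj (?a t) + - \<i> * ?b t"
  have "koebe_transform ?v z = - \<i> * koebe_transform g (s * z)"
    by (simp only: koebe_transform_linear[OF A(4) cc(2) z] ka kb) simp
  moreover have "koebe_transform ?v' z = - \<i> * koebe_transform (\<lambda>t. cnj (g t)) (s * z)"
    by (simp only: koebe_transform_linear[OF cc(1) B(4) z] ka kb) simp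
  moreover have "koebe_transform (\<lambda>t. 1 * ?v t + (- c) * 1) z = 1 * koebe_transform ?v z + (- c) * koebe_transform (\<lambda>_. 1) z"
    by (rule koebe_transform_linear) (use A(4) cc z in \<open>auto intro!: continuous_intros\<close>)
  moreover have "koebe_transform (\<lambda>t. 1 * ?v' t + (- cnj c) * 1) z = 1 * koebe_transform ?v' z + (- cnj c) * koebe_transform (\<lambda>_. 1) z"
    by (rule koebe_transform_linear) (use B(4) cc z in \<open>auto intro!: continuous_intros\<close>)
  moreover have "(\<lambda>t. conjugate_transform g (s * cis t) - c) = (\<lambda>t. 1 * ?v t + (- c) * 1)"
    by (simp add: conjugate_transform_def fun_eq_iff)
  moreover have "(\<lambda>t. cnj (conjugate_transform g (s * cis t) - c)) = (\<lambda>t. 1 * ?v' t + (- cnj c) * 1)"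
    by (simp add: conjugate_transform_def fun_eq_iff)
  ultimately have "angular_op (\<lambda>t. conjugate_transform g (s * cis t) - c) z
     = \<i> * ((- \<i>) * koebe_transform g (s * z) - cnj ((- \<i>) * koebe_transform (\<lambda>t. cnj (g t)) (s * z)))"
    unfolding angular_op_def by (simp only: koebe_transform_const[OF z]) simp
  then show ?thesis by (simp add: radial_op_def algebra_simps)
qed

lemma lipschitz_of_bounded_vector_derivative:
  fixes g :: "real \<Rightarrow> 'a::real_normed_vector"
  assumes d: "\<And>t. (g has_vector_derivative \<psi> t) (at t)" and M: "\<And>t. norm (\<psi> t) \<le> M"
  shows "M-lipschitz_on UNIV g"
proof (rule lipschitz_onI)
  have M0: "0 \<le> M" using order_trans[OF norm_ge_zero M] .
  show "dist (g x) (g y) \<le> M * dist x y" for x y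
    unfolding dist_norm
  proof (rule differentiable_bound[of UNIV g "\<lambda>t h. h *\<^sub>R \<psi> t"])
    show "(g has_derivative (\<lambda>h. h *\<^sub>R \<psi> t)) (at t within UNIV)" for t
      using d[of t] by (simp add: has_vector_derivative_def)
    show "onorm (\<lambda>h. h *\<^sub>R \<psi> t) \<le> M" for t
      using M[of t] M0 by (intro onorm_le) (simp add: mult.commute[of M] mult_left_mono)
  qed auto
  show "0 \<le> M" by (rule M0)
qed

text \<open>Bounded convergence: differentiability of \<open>g\<close> everywhere gives the radial
  limit at every angle, and \<open>3 * M\<close> combines the bound \<open>2 * M\<close> of
  \<open>angular_op_bounded\<close> with \<open>M\<close> for \<open>\<psi>\<close>.\<close>

lemma angular_op_L2_tendsto:
  fixes g :: "real \<Rightarrow> complex" and \<rho> :: "nat \<Rightarrow> real"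
  assumes per: "\<And>t. g (t + 2 * pi) = g t" and d: "\<And>t. (g has_vector_derivative \<psi> t) (at t)"
    and M: "\<And>t. cmod (\<psi> t) \<le> M"
    and \<rho>: "\<And>n. 0 \<le> \<rho> n" "\<And>n. \<rho> n < 1" "\<rho> \<longlonglongrightarrow> 1"
  shows "\<And>n. (\<lambda>t. (cmod (angular_op g (\<rho> n * cis t) - \<psi> t))\<^sup>2) integrable_on {0..2*pi}"
    and "(\<lambda>n. integral {0..2*pi} (\<lambda>t. (cmod (angular_op g (\<rho> n * cis t) - \<psi> t))\<^sup>2)) \<longlonglongrightarrow> 0"
proof -
  have lip: "M-lipschitz_on UNIV g" by (rule lipschitz_of_bounded_vector_derivative[OF d M])
  have g: "continuous_on UNIV g" using lip by (rule lipschitz_on_continuous_on)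
  have M0: "0 \<le> M" using lip by (rule lipschitz_on_nonneg)
  have ca: "continuous_on A (\<lambda>t. angular_op g (\<rho> n * cis t))" for A n
  proof -
    have "continuous_on (ball 0 1) (koebe_transform g)" "continuous_on (ball 0 1) (koebe_transform (\<lambda>t. cnj (g t)))"
      by (intro holomorphic_on_imp_continuous_on koebe_transform_holomorphic continuous_on_cnj continuous_on_subset[OF g]; simp)+
    then have "continuous_on (ball 0 1) (angular_op g)"
      unfolding angular_op_def by (intro continuous_intros)
    then show ?thesis
      by (rule continuous_on_compose2) (use \<rho> in \<open>auto intro!: continuous_intros simp: norm_mult\<close>)
  qed
  \<comment> \<open>A derivative need not be continuous; its measurability is obtained from gauge
    integrability, by the fundamental theorem.\<close>
  have \<psi>i: "\<psi> integrable_on {0..2*pi}"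
    using fundamental_theorem_of_calculus[of 0 "2*pi" g \<psi>] d by (auto intro: has_vector_derivative_at_within)
  have ab: "cmod (angular_op g (\<rho> n * cis t)) \<le> 2 * M" for n t
    by (rule angular_op_bounded[OF per lip \<rho>(1,2)])
  have bound: "(cmod (angular_op g (\<rho> n * cis t) - \<psi> t))\<^sup>2 \<le> (3 * M)\<^sup>2" for n t
    using norm_triangle_ineq4[of "angular_op g (\<rho> n * cis t)" "\<psi> t"] ab[of n t] M[of t]
    by (intro power_mono) auto
  have int: "(\<lambda>t. (cmod (angular_op g (\<rho> n * cis t) - \<psi> t))\<^sup>2) integrable_on {0..2*pi}" for n
  proof (rule measurable_bounded_by_integrable_imp_integrable)
    have "(\<lambda>t. angular_op g (\<rho> n * cis t)) \<in> borel_measurable (lebesgue_on {0..2*pi})"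
      by (rule continuous_imp_measurable_on_sets_lebesgue[OF ca]) auto
    moreover have "\<psi> \<in> borel_measurable (lebesgue_on {0..2*pi})"
      by (rule integrable_imp_measurable[OF \<psi>i])
    ultimately show "(\<lambda>t. (cmod (angular_op g (\<rho> n * cis t) - \<psi> t))\<^sup>2) \<in> borel_measurable (lebesgue_on {0..2*pi})"
      by measurable
    show "(\<lambda>t. (3 * M)\<^sup>2) integrable_on {0..2*pi}" by (rule integrable_const_ivl)
  qed (use bound in auto)
  show "(\<lambda>t. (cmod (angular_op g (\<rho> n * cis t) - \<psi> t))\<^sup>2) integrable_on {0..2*pi}" for n by (rule int)
  have fl: "filterlim \<rho> (at_left 1) sequentially"
    unfolding filterlim_at using \<rho>(2,3) by (auto intro!: always_eventually simp: less_imp_neq)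
  have "(\<lambda>n. integral {0..2*pi} (\<lambda>t. (cmod (angular_op g (\<rho> n * cis t) - \<psi> t))\<^sup>2)) \<longlonglongrightarrow> integral {0..2*pi} (\<lambda>t. 0::real)"
  proof (rule dominated_convergence(2)[OF int])
    show "(\<lambda>t. (3 * M)\<^sup>2) integrable_on {0..2*pi}" by (rule integrable_const_ivl)
    show "(\<lambda>n. (cmod (angular_op g (\<rho> n * cis t) - \<psi> t))\<^sup>2) \<longlonglongrightarrow> 0" for t
    proof -
      have "(\<lambda>n. angular_op g (\<rho> n * cis t)) \<longlonglongrightarrow> \<psi> t"
        by (rule filterlim_compose[OF angular_op_tendsto[OF g per d] fl])
      then have "(\<lambda>n. (cmod (angular_op g (\<rho> n * cis t) - \<psi> t))\<^sup>2) \<longlonglongrightarrow> (cmod (\<psi> t - \<psi> t))\<^sup>2"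
        by (intro tendsto_intros)
      then show ?thesis by simp
    qed
  qed (use bound in auto)
  then show "(\<lambda>n. integral {0..2*pi} (\<lambda>t. (cmod (angular_op g (\<rho> n * cis t) - \<psi> t))\<^sup>2)) \<longlonglongrightarrow> 0" by simp
qed

lemma continuous_radial_op:
  assumes "continuous_on {0..2*pi} g"
  shows "continuous_on (ball 0 1) (radial_op g)"
  unfolding radial_op_def
  by (intro continuous_intros holomorphic_on_imp_continuous_on koebe_transform_holomorphic assms continuous_on_cnj)

text \<open>Along a sequence \<open>s \<rightarrow> 1\<close> the functions \<open>t \<mapsto> radial_op g (s * cis t)\<close> are Cauchy in \<open>L\<^sup>2\<close>, because
  their mutual distances are those of \<open>t \<mapsto> angular_op g (s * cis t)\<close>, which converge to \<open>\<psi>\<close>.\<close>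

lemma radial_op_L1_limit:
  fixes g :: "real \<Rightarrow> complex"
  assumes per: "\<And>t. g (t + 2 * pi) = g t" and d: "\<And>t. (g has_vector_derivative \<psi> t) (at t)"
    and M: "\<And>t. cmod (\<psi> t) \<le> M"
  obtains s :: "nat \<Rightarrow> real" and h where
    "\<And>j. 0 \<le> s j" "\<And>j. s j < 1" "s \<longlonglongrightarrow> 1" "integrable (lebesgue_on {0..2*pi}) h"
    "(\<lambda>j. \<integral>t. cmod (radial_op g (s j * cis t) - h t) \<partial>lebesgue_on {0..2*pi}) \<longlonglongrightarrow> 0"
proof -
  have g: "continuous_on UNIV g"
    using d by (meson continuous_at_imp_continuous_on has_vector_derivative_continuous)
  have g0: "continuous_on {0..2*pi} g" by (rule continuous_on_subset[OF g]) simp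
  define \<rho> where "\<rho> n = 1 - 1 / real (Suc n)" for n
  have \<rho>: "0 \<le> \<rho> n" "\<rho> n < 1" for n by (auto simp: \<rho>_def)
  have \<rho>1: "\<rho> \<longlonglongrightarrow> 1"
    unfolding \<rho>_def using tendsto_diff[OF tendsto_const LIMSEQ_Suc[OF lim_1_over_n], of 1] by simp
  define I where "I n = integral {0..2*pi} (\<lambda>t. (cmod (angular_op g (\<rho> n * cis t) - \<psi> t))\<^sup>2)" for n
  have Ii: "(\<lambda>t. (cmod (angular_op g (\<rho> n * cis t) - \<psi> t))\<^sup>2) integrable_on {0..2*pi}" for n
    by (rule angular_op_L2_tendsto(1)[OF per d M \<rho> \<rho>1])
  have I0: "I \<longlonglongrightarrow> 0" unfolding I_def by (rule angular_op_L2_tendsto(2)[OF per d M \<rho> \<rho>1])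
  \<comment> \<open>Two consecutive errors enter with factor 2 each, and 2 / 16 + 2 / 4 is below 1,
    so the squared distances of consecutive members of the subsequence are at most
    \<open>(1/4)^j\<close>.\<close>
  have "\<exists>n\<ge>j. I n \<le> (1/4)^j / 4" for j
  proof -
    have "eventually (\<lambda>n. I n < (1/4)^j / 4) sequentially" by (rule order_tendstoD(2)[OF I0]) simp
    then have "eventually (\<lambda>n. n \<ge> j \<and> I n \<le> (1/4)^j / 4) sequentially"
      using eventually_ge_at_top[of j] by eventually_elim auto
    then show ?thesis by (rule eventually_happens'[rotated]) simp
  qed
  then obtain N where N: "\<And>j. N j \<ge> j" "\<And>j. I (N j) \<le> (1/4)^j / 4" by metis
  define s where "s j = \<rho> (N j)" for j
  have s: "0 \<le> s j" "s j < 1" for j using \<rho> by (auto simp: s_def)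
  have "filterlim N at_top sequentially"
    by (rule filterlim_at_top_mono[OF filterlim_ident]) (use N(1) in auto)
  then have s1: "s \<longlonglongrightarrow> 1" unfolding s_def by (rule filterlim_compose[OF \<rho>1])
  define f where "f j t = radial_op g (s j * cis t)" for j t
  define a where "a j t = angular_op g (s j * cis t)" for j t
  have cf: "continuous_on {0..2*pi} (f j)" for j
    unfolding f_def[abs_def]
    by (rule continuous_on_compose2[OF continuous_radial_op[OF g0]]) (use s in \<open>auto intro!: continuous_intros simp: norm_mult\<close>)
  have ca: "continuous_on {0..2*pi} (a j)" for j
  proof -
    have "continuous_on (ball 0 1) (angular_op g)"
      unfolding angular_op_def
      by (intro continuous_intros holomorphic_on_imp_continuous_on koebe_transform_holomorphic g0 continuous_on_cnj)
    then show ?thesis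
      unfolding a_def[abs_def] by (rule continuous_on_compose2) (use s in \<open>auto intro!: continuous_intros simp: norm_mult\<close>)
  qed
  have L2: "integral {0..2*pi} (\<lambda>t. (cmod (f (Suc j) t - f j t))\<^sup>2) \<le> (1/4)^j" for j
  proof -
    have "integral {0..2*pi} (\<lambda>t. (cmod (f (Suc j) t - f j t))\<^sup>2) = integral {0..2*pi} (\<lambda>t. (cmod (a (Suc j) t - a j t))\<^sup>2)"
      unfolding f_def a_def by (rule radial_minus_angular_L2[OF g0 s s])
    also have "\<dots> \<le> integral {0..2*pi} (\<lambda>t. 2 * (cmod (a (Suc j) t - \<psi> t))\<^sup>2 + 2 * (cmod (a j t - \<psi> t))\<^sup>2)"
    proof (rule integral_le)
      show "(\<lambda>t. (cmod (a (Suc j) t - a j t))\<^sup>2) integrable_on {0..2*pi}"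
        by (intro integrable_continuous_interval continuous_intros ca)
      show "(\<lambda>t. 2 * (cmod (a (Suc j) t - \<psi> t))\<^sup>2 + 2 * (cmod (a j t - \<psi> t))\<^sup>2) integrable_on {0..2*pi}"
        unfolding a_def s_def
        using integrable_add[OF integrable_cmul[OF Ii, of 2] integrable_cmul[OF Ii, of 2]] by simp
      fix t
      have "cmod (a (Suc j) t - a j t) \<le> cmod (a (Suc j) t - \<psi> t) + cmod (a j t - \<psi> t)"
        using norm_triangle_ineq4[of "a (Suc j) t - \<psi> t" "a j t - \<psi> t"] by simp
      then have "(cmod (a (Suc j) t - a j t))\<^sup>2 \<le> (cmod (a (Suc j) t - \<psi> t) + cmod (a j t - \<psi> t))\<^sup>2"
        by (rule power_mono) simp
      also have "\<dots> \<le> 2 * (cmod (a (Suc j) t - \<psi> t))\<^sup>2 + 2 * (cmod (a j t - \<psi> t))\<^sup>2"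
        using zero_le_power2[of "cmod (a (Suc j) t - \<psi> t) - cmod (a j t - \<psi> t)"]
        by (simp add: power2_sum power2_diff)
      finally show "(cmod (a (Suc j) t - a j t))\<^sup>2 \<le> 2 * (cmod (a (Suc j) t - \<psi> t))\<^sup>2 + 2 * (cmod (a j t - \<psi> t))\<^sup>2" .
    qed
    also have "\<dots> = 2 * I (N (Suc j)) + 2 * I (N j)"
      unfolding a_def s_def I_def
      using integral_add[OF integrable_cmul[OF Ii, of 2] integrable_cmul[OF Ii, of 2]] by simp
    also have "\<dots> \<le> (1/4)^j"
    proof -
      have "(0::real) \<le> (1/4)^j" by (rule zero_le_power) simp
      moreover have "I (N (Suc j)) \<le> (1/4)^j / 16" using N(2)[of "Suc j"] by simp
      ultimately show ?thesis using N(2)[of j] by linarith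
    qed
    finally show ?thesis .
  qed
  have icf: "integrable (lebesgue_on {0..2*pi}) k" if "continuous_on {0..2*pi} k" for k :: "real \<Rightarrow> 'b::euclidean_space"
    using absolutely_integrable_continuous_real[OF that] by (simp add: set_integrable_def integrable_restrict_space)
  have L1: "(\<integral>t. norm (f (Suc j) t - f j t) \<partial>lebesgue_on {0..2*pi}) \<le> (pi + 1) * (1/2)^j" for j
  proof -
    have "(\<integral>t. norm (f (Suc j) t - f j t) \<partial>lebesgue_on {0..2*pi}) = integral {0..2*pi} (\<lambda>t. norm (f (Suc j) t - f j t))"
      by (rule lebesgue_integral_eq_integral) (auto intro!: icf continuous_intros cf)
    \<comment> \<open>From \<open>0 \<le> (x - (1/2)^j)^2\<close>, scaled by \<open>2^j / 2\<close>.
      This replaces the Cauchy-Schwarz inequality and is balanced so that both terms are of order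
      \<open>(1/2)^j\<close>, hence summable.\<close>
    also have "\<dots> \<le> integral {0..2*pi} (\<lambda>t. (1/2)^j / 2 + 2^j / 2 * (cmod (f (Suc j) t - f j t))\<^sup>2)"
    proof (rule integral_le)
      fix t
      define x where "x = cmod (f (Suc j) t - f j t)"
      have "0 \<le> 2^j / 2 * (x - (1/2)^j)\<^sup>2" by simp
      also have "\<dots> = 2^j / 2 * x\<^sup>2 - (2^j * (1/2)^j) * x + (2^j * (1/2)^j) * (1/2)^j / 2"
        by (simp add: power2_diff power2_eq_square algebra_simps)
      also have "(2::real)^j * (1/2)^j = 1" by (simp add: power_one_over)
      finally show "norm (f (Suc j) t - f j t) \<le> (1/2)^j / 2 + 2^j / 2 * (cmod (f (Suc j) t - f j t))\<^sup>2"
        unfolding x_def by simp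
    qed (auto intro!: integrable_continuous_interval continuous_intros cf)
    also have "\<dots> = pi * (1/2)^j + 2^j / 2 * integral {0..2*pi} (\<lambda>t. (cmod (f (Suc j) t - f j t))\<^sup>2)"
      by (subst integral_add) (auto intro!: integrable_continuous_interval continuous_intros cf simp del: times_divide_eq_left)
    also have "\<dots> \<le> pi * (1/2)^j + 2^j / 2 * (1/4)^j" using L2[of j] by (intro add_left_mono mult_left_mono) auto
    also have "(2::real)^j / 2 * (1/4)^j = (1/2)^j / 2" by (simp add: power_mult_distrib[symmetric])
    also have "pi * (1/2)^j + (1/2)^j / 2 \<le> (pi + 1) * (1/2)^j" by (simp add: algebra_simps)
    finally show ?thesis .
  qed
  have "summable (\<lambda>j. \<integral>t. norm (f (Suc j) t - f j t) \<partial>lebesgue_on {0..2*pi})"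
  proof (rule summable_comparison_test')
    show "summable (\<lambda>j. (pi + 1) * (1/2::real)^j)" by (intro summable_mult summable_geometric) simp
    show "norm (\<integral>t. norm (f (Suc j) t - f j t) \<partial>lebesgue_on {0..2*pi}) \<le> (pi + 1) * (1/2)^j" for j
      using L1[of j] by simp
  qed
  then obtain h where h: "integrable (lebesgue_on {0..2*pi}) h" "(\<lambda>j. \<integral>t. norm (f j t - h t) \<partial>lebesgue_on {0..2*pi}) \<longlonglongrightarrow> 0"
    using L1_limit[of "lebesgue_on {0..2*pi}" f] icf[OF cf] by blast
  show ?thesis by (rule that[OF s s1 h(1)]) (use h(2) in \<open>simp add: f_def\<close>)
qed

section \<open>Periodicity of the primitive and the main equivalence\<close>

lemma periodic_int_shift:
  fixes V :: "real \<Rightarrow> 'a" and k :: int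
  assumes per: "\<And>t. V (t + 2 * pi) = V t"
  shows "V (t + 2 * pi * of_int k) = V t"
proof -
  have nat: "V (t + 2 * pi * real n) = V t" for n t
  proof (induction n)
    case (Suc n)
    have "t + 2 * pi * real (Suc n) = (t + 2 * pi * real n) + 2 * pi" by (simp add: algebra_simps)
    then have "V (t + 2 * pi * real (Suc n)) = V (t + 2 * pi * real n)" by (simp only: per)
    then show ?case using Suc by simp
  qed simp
  show ?thesis
  proof (cases "k \<ge> 0")
    case True
    then show ?thesis using nat[of t "nat k"] by simp
  next
    case False
    then show ?thesis using nat[of "t + 2 * pi * of_int k" "nat (- k)"] by (simp add: algebra_simps)
  qed
qed

lemma period_reduce:
  fixes x :: real
  obtains k :: int where "0 \<le> x - 2 * pi * of_int k" "x - 2 * pi * of_int k < 2 * pi"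
proof -
  define q where "q = x / (2 * pi)"
  have x: "x = 2 * pi * q" by (simp add: q_def)
  have "2 * pi * of_int \<lfloor>q\<rfloor> \<le> 2 * pi * q" by (intro mult_left_mono) auto
  moreover have "2 * pi * q < 2 * pi * (of_int \<lfloor>q\<rfloor> + 1)" by (intro mult_strict_left_mono) auto
  ultimately show ?thesis by (intro that[of "\<lfloor>q\<rfloor>"]) (auto simp: x algebra_simps)
qed

text \<open>The constant is not enlarged: a jump from one period to another is routed through the
  identified endpoints \<open>2 * pi\<close> and 0, and the two pieces together are no longer than
  \<open>y - x\<close>.\<close>

lemma periodic_lipschitz:
  fixes V :: "real \<Rightarrow> 'a::real_normed_vector"
  assumes per: "\<And>t. V (t + 2 * pi) = V t" and lip: "C-lipschitz_on {0..2*pi} V"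
  shows "C-lipschitz_on UNIV V"
proof (rule lipschitz_on_leI)
  have C: "0 \<le> C" using lip by (rule lipschitz_on_nonneg)
  then show "0 \<le> C" .
  fix x y :: real assume xy: "x \<le> y"
  obtain k :: int where k: "0 \<le> x - 2 * pi * of_int k" "x - 2 * pi * of_int k < 2 * pi" by (rule period_reduce)
  obtain l :: int where l: "0 \<le> y - 2 * pi * of_int l" "y - 2 * pi * of_int l < 2 * pi" by (rule period_reduce)
  define x' y' where "x' = x - 2 * pi * of_int k" and "y' = y - 2 * pi * of_int l"
  have V: "V x = V x'" "V y = V y'"
    using periodic_int_shift[of V x' k, OF per] periodic_int_shift[of V y' l, OF per] by (simp_all add: x'_def y'_def)
  have d: "dist (V a) (V b) \<le> C * \<bar>a - b\<bar>" if "a \<in> {0..2*pi}" "b \<in> {0..2*pi}" for a b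
    using lipschitz_onD[OF lip that] by (simp add: dist_real_def)
  have in': "x' \<in> {0..2*pi}" "y' \<in> {0..2*pi}" using k l by (auto simp: x'_def y'_def)
  have "dist (V x') (V y') \<le> C * (y - x)"
  proof (cases "l \<le> k")
    case True
    then have "of_int l \<le> (of_int k :: real)" by simp
    moreover have "k < l + 1"
    proof -
      have "2 * pi * of_int k < 2 * pi * (of_int l + 1)" using k l xy by (simp add: algebra_simps)
      then have "(of_int k :: real) < of_int (l + 1)" by simp
      then show ?thesis by (simp only: of_int_less_iff)
    qed
    ultimately have "k = l" using True by simp
    then show ?thesis using d[OF in'] xy by (simp add: x'_def y'_def)
  next
    case False
    then have "(of_int (k + 1) :: real) \<le> of_int l" by (simp only: of_int_le_iff)
    then have kl: "2 * pi * (of_int k + 1) \<le> 2 * pi * of_int l" by (intro mult_left_mono) auto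
    have "V (2 * pi) = V 0" using per[of 0] by simp
    then have "dist (V x') (V y') \<le> dist (V x') (V (2*pi)) + dist (V 0) (V y')"
      using dist_triangle[of "V x'" "V y'" "V 0"] by simp
    also have "\<dots> \<le> C * \<bar>x' - 2 * pi\<bar> + C * \<bar>0 - y'\<bar>"
      using in' by (intro add_mono d) auto
    also have "\<dots> = C * (2 * pi - x' + y')" using in' by (simp add: algebra_simps)
    also have "\<dots> \<le> C * (y - x)" using C kl by (intro mult_left_mono) (auto simp: x'_def y'_def algebra_simps)
    finally show ?thesis .
  qed
  then show "dist (V x) (V y) \<le> C * dist x y" unfolding V using xy by (simp add: dist_real_def)
qed

text \<open>Passing to primitives turns mean convergence into uniform convergence: the conjugate
  functions \<open>v j\<close> on the circles of radius \<open>s j\<close>, normalized at angle 0,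
  have derivatives tending to \<open>h\<close> in mean, so they tend uniformly to \<open>V\<close>,
  and \<open>angular_op\<close> passes to the limit.\<close>

lemma radial_op_eq_angular_op_primitive:
  fixes g :: "real \<Rightarrow> complex"
  assumes per: "\<And>t. g (t + 2 * pi) = g t" and d: "\<And>t. (g has_vector_derivative \<psi> t) (at t)"
    and M: "\<And>t. cmod (\<psi> t) \<le> M"
  obtains h V where "h integrable_on {0..2*pi}" "continuous_on UNIV V" "\<And>t. V (t + 2 * pi) = V t"
    "\<And>x. x \<in> {0..2*pi} \<Longrightarrow> V x = integral {0..x} h"
    "\<And>z. cmod z < 1 \<Longrightarrow> radial_op g z = angular_op V z"
proof -
  have g: "continuous_on UNIV g"
    using d by (meson continuous_at_imp_continuous_on has_vector_derivative_continuous)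
  have g0: "continuous_on {0..2*pi} g" by (rule continuous_on_subset[OF g]) simp
  obtain s :: "nat \<Rightarrow> real" and h where s: "\<And>j. 0 \<le> s j" "\<And>j. s j < 1" "s \<longlonglongrightarrow> 1"
    and h: "integrable (lebesgue_on {0..2*pi}) h"
    and lim: "(\<lambda>j. \<integral>t. cmod (radial_op g (s j * cis t) - h t) \<partial>lebesgue_on {0..2*pi}) \<longlonglongrightarrow> 0"
    using radial_op_L1_limit[OF per d M] by blast
  define f where "f j t = radial_op g (s j * cis t)" for j t
  define v where "v j t = conjugate_transform g (s j * cis t) - conjugate_transform g (s j * cis 0)" for j t
  define e where "e j = (\<integral>t. cmod (f j t - h t) \<partial>lebesgue_on {0..2*pi})" for j
  have e0: "e \<longlonglongrightarrow> 0" unfolding e_def[abs_def] f_def by (rule lim)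
  have cf: "continuous_on {0..2*pi} (f j)" for j
    unfolding f_def[abs_def]
    by (rule continuous_on_compose2[OF continuous_radial_op[OF g0]]) (use s in \<open>auto intro!: continuous_intros simp: norm_mult\<close>)
  have fi: "integrable (lebesgue_on {0..2*pi}) (f j)" for j
    using absolutely_integrable_continuous_real[OF cf] by (simp add: set_integrable_def integrable_restrict_space)
  have hi: "h integrable_on {0..2*pi}" using h by (rule integrable_on_lebesgue_on) simp
  have fhi: "(\<lambda>t. cmod (f j t - h t)) integrable_on {0..2*pi}" for j
    by (rule integrable_on_lebesgue_on) (use fi h in auto)
  have e_eq: "e j = integral {0..2*pi} (\<lambda>t. cmod (f j t - h t))" for j
    unfolding e_def by (rule lebesgue_integral_eq_integral) (use fi h in auto)
  have dv: "(v j has_vector_derivative f j t) (at t)" for j t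
    unfolding v_def[abs_def] f_def
    using has_vector_derivative_diff[OF conjugate_transform_has_vector_derivative[OF g0 s(1,2)] has_vector_derivative_const] by simp
  have cv: "continuous_on A (v j)" for A j
    by (rule continuous_at_imp_continuous_on) (use has_vector_derivative_continuous[OF dv] in blast)
  have vper: "v j (t + 2 * pi) = v j t" for j t
    by (simp add: v_def cis.ctr)
  have est: "cmod (v j x - integral {0..x} h) \<le> e j" if x: "x \<in> {0..2*pi}" for j x
  proof -
    have sub: "{0..x} \<subseteq> {0..2*pi}" using x by auto
    have i: "f j integrable_on {0..x}" "h integrable_on {0..x}" "(\<lambda>t. cmod (f j t - h t)) integrable_on {0..x}"
      using integrable_continuous_interval[OF continuous_on_subset[OF cf sub]]
        integrable_on_subinterval[OF hi sub] integrable_on_subinterval[OF fhi sub] by auto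
    have "(f j has_integral v j x - v j 0) {0..x}"
      by (rule fundamental_theorem_of_calculus) (use x in \<open>auto intro: has_vector_derivative_at_within dv\<close>)
    then have "v j x = integral {0..x} (f j)" by (simp add: integral_unique v_def)
    then have "v j x - integral {0..x} h = integral {0..x} (\<lambda>t. f j t - h t)"
      using i by (simp add: integral_diff)
    also have "cmod \<dots> \<le> integral {0..x} (\<lambda>t. cmod (f j t - h t))"
      by (rule integral_norm_bound_integral) (use i in \<open>auto intro: integrable_diff\<close>)
    also have "\<dots> \<le> e j" unfolding e_eq by (rule integral_subset_le[OF sub i(3) fhi]) auto
    finally show ?thesis .
  qed
  have vconv: "(\<lambda>j. v j x) \<longlonglongrightarrow> integral {0..x} h" if x: "x \<in> {0..2*pi}" for x
    by (rule LIM_zero_cancel, rule Lim_null_comparison[OF _ e0]) (use est[OF x] in auto)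
  \<comment> \<open>Taking the limit at every real \<open>x\<close> lets \<open>V\<close> inherit
    the period of the \<open>v j\<close>; no separate argument that \<open>h\<close> has mean 0 is
    required.\<close>
  define V where "V x = lim (\<lambda>j. v j x)" for x
  have V0: "V x = integral {0..x} h" if "x \<in> {0..2*pi}" for x
    unfolding V_def by (rule limI[OF vconv[OF that]])
  have Vper: "V (t + 2 * pi) = V t" for t unfolding V_def vper ..
  have estV: "cmod (v j x - V x) \<le> e j" for j x
  proof -
    obtain k :: int where k: "0 \<le> x - 2 * pi * of_int k" "x - 2 * pi * of_int k < 2 * pi" by (rule period_reduce)
    define y where "y = x - 2 * pi * of_int k"
    have "v j x = v j y" "V x = V y"
      using periodic_int_shift[of "v j" y k, OF vper] periodic_int_shift[of V y k, OF Vper] by (simp_all add: y_def)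
    then show ?thesis using est[of y j] V0[of y] k by (simp add: y_def)
  qed
  have unif: "uniform_limit A v V sequentially" for A
  proof (rule uniform_limitI)
    fix \<epsilon> :: real assume "\<epsilon> > 0"
    then have "eventually (\<lambda>j. e j < \<epsilon>) sequentially" by (rule order_tendstoD(2)[OF e0])
    then show "eventually (\<lambda>j. \<forall>x\<in>A. dist (v j x) (V x) < \<epsilon>) sequentially"
      by eventually_elim (use estV in \<open>auto simp: dist_norm intro: le_less_trans\<close>)
  qed
  have cV: "continuous_on A V" for A
    by (rule uniform_limit_theorem[OF _ unif]) (auto intro: always_eventually cv)
  \<comment> \<open>Two limits of one sequence: \<open>radial_op g (s j * z)\<close> converges by
    continuity, and it equals \<open>angular_op (v j) z\<close>, which converges by uniform
    convergence under the integral.\<close>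
  have rad: "radial_op g z = angular_op V z" if z: "cmod z < 1" for z
  proof (rule LIMSEQ_unique)
    have "(\<lambda>j. radial_op g (s j * z)) \<longlonglongrightarrow> radial_op g (of_real 1 * z)"
    proof (rule continuous_on_tendsto_compose[OF continuous_radial_op[OF g0]])
      show "(\<lambda>j. of_real (s j) * z) \<longlonglongrightarrow> of_real 1 * z" by (intro tendsto_intros s)
      have "cmod (of_real (s j) * z) < 1" for j
      proof -
        have "s j * cmod z \<le> 1 * cmod z" using s(2)[of j] by (intro mult_right_mono) auto
        then show ?thesis using z s(1)[of j] by (simp add: norm_mult)
      qed
      then show "\<forall>\<^sub>F j in sequentially. of_real (s j) * z \<in> ball 0 1" by simp
    qed (use z in simp)
    then show "(\<lambda>j. radial_op g (s j * z)) \<longlonglongrightarrow> radial_op g z" by simp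
    let ?k = "\<lambda>t. complex_of_real (Im (koebe (z * cis (-t))))"
    have ck: "continuous_on A ?k" for A by (intro continuous_intros continuous_koebe_cis z)
    have "uniform_limit {0..2*pi} (\<lambda>j t. v j t * ?k t) (\<lambda>t. V t * ?k t) sequentially"
      by (rule uniform_lim_mult[OF unif uniform_limit_const])
         (auto intro!: compact_imp_bounded compact_continuous_image cV ck)
    then obtain I J where IJ: "\<And>j. ((\<lambda>t. v j t * ?k t) has_integral I j) {0..2*pi}"
      "((\<lambda>t. V t * ?k t) has_integral J) {0..2*pi}" "I \<longlonglongrightarrow> J"
      by (rule uniform_limit_integral) (auto intro!: continuous_intros cv ck)
    have "radial_op g (s j * z) = angular_op (v j) z" for j
      unfolding v_def[abs_def] by (rule angular_op_conjugate_transform[OF g0 s(1,2) z, symmetric])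
    also have "angular_op (v j) z = - I j / pi" for j
      using angular_op_eq[OF cv z] IJ(1) by (simp add: integral_unique)
    finally have "(\<lambda>j. radial_op g (s j * z)) = (\<lambda>j. - I j / pi)" by auto
    moreover have "(\<lambda>j. - I j / pi) \<longlonglongrightarrow> - J / pi" by (intro tendsto_intros IJ(3)) auto
    moreover have "- J / pi = angular_op V z"
      using angular_op_eq[OF cV z] IJ(2) by (simp add: integral_unique)
    ultimately show "(\<lambda>j. radial_op g (s j * z)) \<longlonglongrightarrow> angular_op V z" by simp
  qed
  show ?thesis by (rule that[OF hi cV Vper V0 rad])
qed

lemma radial_op_bounded_iff_hilbert_transform:
  fixes g :: "real \<Rightarrow> complex"
  assumes per: "\<And>t. g (t + 2 * pi) = g t" and d: "\<And>t. (g has_vector_derivative \<psi> t) (at t)"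
    and M: "\<And>t. cmod (\<psi> t) \<le> M"
  shows "(\<exists>C. \<forall>z. cmod z < 1 \<longrightarrow> cmod (radial_op g z) \<le> C) \<longleftrightarrow> Linfty_circle (hilbert_transform \<psi>)"
proof -
  obtain h V where h: "h integrable_on {0..2*pi}" and cV: "continuous_on UNIV V"
    and Vper: "\<And>t. V (t + 2 * pi) = V t" and V: "\<And>x. x \<in> {0..2*pi} \<Longrightarrow> V x = integral {0..x} h"
    and rad: "\<And>z. cmod z < 1 \<Longrightarrow> radial_op g z = angular_op V z"
    using radial_op_eq_angular_op_primitive[OF per d M] by blast
  obtain N0 where N0: "negligible N0" "\<And>x. x \<in> {0<..<2*pi} \<Longrightarrow> x \<notin> N0 \<Longrightarrow> ((\<lambda>x. integral {0..x} h) has_vector_derivative h x) (at x)"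
    using has_vector_derivative_indefinite_integral_ae[OF h] by blast
  \<comment> \<open>The endpoints are excluded because differentiability of the integral is known
    only at interior points.\<close>
  define N where "N = insert 0 (insert (2*pi) N0)"
  have N: "negligible N" unfolding N_def using N0(1) by simp
  have lim: "((\<lambda>r. radial_op g (of_real r * cis x)) \<longlongrightarrow> h x) (at_left 1)" if x: "x \<in> {0..2*pi} - N" for x
  proof -
    have x': "x \<in> {0<..<2*pi}" "x \<notin> N0" using x by (auto simp: N_def)
    have "(V has_vector_derivative h x) (at x)"
      by (rule has_vector_derivative_transform_within_open[OF N0(2)[OF x'], of "{0<..<2*pi}"]) (use x' V in auto)
    then have "((\<lambda>r. angular_op V (of_real r * cis x)) \<longlongrightarrow> h x) (at_left 1)"
      by (rule angular_op_tendsto[OF cV Vper])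
    moreover have "eventually (\<lambda>r. angular_op V (of_real r * cis x) = radial_op g (of_real r * cis x)) (at_left 1)"
      using eventually_at_left_real[OF zero_less_one] by eventually_elim (auto simp: rad norm_mult)
    ultimately show ?thesis by (rule Lim_transform_eventually)
  qed
  have H: "hilbert_transform \<psi> x = h x" if "x \<in> {0..2*pi} - N" for x
    by (rule hilbert_transform_eq[OF per d M lim[OF that]])
  have aeN: "AE x in lebesgue_on {0..2*pi}. x \<notin> N"
  proof -
    have "AE x in lebesgue. x \<notin> N"
      using N unfolding negligible_iff_null_sets by (rule AE_not_in)
    then show ?thesis by (auto simp: AE_restrict_space_iff elim: eventually_mono)
  qed
  show ?thesis
  proof
    assume "\<exists>C. \<forall>z. cmod z < 1 \<longrightarrow> cmod (radial_op g z) \<le> C"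
    then obtain C where C: "\<And>z. cmod z < 1 \<Longrightarrow> cmod (radial_op g z) \<le> C" by blast
    have hC: "cmod (h x) \<le> C" if x: "x \<in> {0..2*pi} - N" for x
    proof (rule tendsto_upperbound[OF tendsto_norm[OF lim[OF x]]])
      show "eventually (\<lambda>r. cmod (radial_op g (of_real r * cis x)) \<le> C) (at_left 1)"
        using eventually_at_left_real[OF zero_less_one] by eventually_elim (auto intro!: C simp: norm_mult)
    qed auto
    \<comment> \<open>On \<open>N\<close> the value of \<open>Lim\<close> is uncontrolled, so
      measurability is inherited from \<open>h\<close>, with which the transform agrees off
      \<open>N\<close>.\<close>
    have "(\<lambda>x. hilbert_transform \<psi> x) integrable_on {0..2*pi}"
      by (rule integrable_spike[OF h N]) (use H in auto)
    then have "hilbert_transform \<psi> \<in> borel_measurable (lebesgue_on {0..2*pi})"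
      by (rule integrable_imp_measurable)
    moreover have "AE x in lebesgue_on {0..2*pi}. norm (hilbert_transform \<psi> x) \<le> C"
      using aeN AE_space by eventually_elim (use H hC in auto)
    ultimately show "Linfty_circle (hilbert_transform \<psi>)" unfolding Linfty_circle_def by blast
  next
    assume "Linfty_circle (hilbert_transform \<psi>)"
    then obtain C where "AE x in lebesgue_on {0..2*pi}. norm (hilbert_transform \<psi> x) \<le> C"
      unfolding Linfty_circle_def by blast
    then have "AE x in lebesgue_on {0..2*pi}. norm (hilbert_transform \<psi> x) \<le> C \<and> x \<notin> N"
      using aeN by eventually_elim auto
    then have "AE x in lebesgue. x \<in> {0..2*pi} \<longrightarrow> norm (hilbert_transform \<psi> x) \<le> C \<and> x \<notin> N"
      by (subst (asm) AE_restrict_space_iff) auto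
    then obtain T where T: "negligible T" "{x. \<not> (x \<in> {0..2*pi} \<longrightarrow> norm (hilbert_transform \<psi> x) \<le> C \<and> x \<notin> N)} \<subseteq> T"
      unfolding eventually_ae_filter_negligible by blast
    have hC: "cmod (h x) \<le> \<bar>C\<bar>" if "x \<in> {0..2*pi} - T" for x
      using T(2) that H[of x] by fastforce
    \<comment> \<open>Changing \<open>h\<close> on a null set leaves its integrals alone and makes
      the bound hold everywhere.\<close>
    define h' where "h' x = (if x \<in> T then 0 else h x)" for x
    have "\<bar>C\<bar>-lipschitz_on {0..2*pi} V"
    proof (rule lipschitz_on_leI)
      fix x y :: real assume xy: "x \<in> {0..2*pi}" "y \<in> {0..2*pi}" "x \<le> y"
      have hi: "h integrable_on {a..b}" if "0 \<le> a" "b \<le> 2*pi" for a b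
        by (rule integrable_on_subinterval[OF h]) (use that in auto)
      have "integral {0..x} h + integral {x..y} h = integral {0..y} h"
        using xy by (intro Henstock_Kurzweil_Integration.integral_combine hi) auto
      then have "V y - V x = integral {x..y} h" using V xy by (simp add: algebra_simps)
      also have "\<dots> = integral {x..y} h'" by (rule integral_spike[OF T(1)]) (auto simp: h'_def)
      also have "cmod \<dots> \<le> integral {x..y} (\<lambda>_. \<bar>C\<bar>)"
      proof (rule integral_norm_bound_integral)
        show "h' integrable_on {x..y}"
          by (rule integrable_spike[OF hi T(1)]) (use xy in \<open>auto simp: h'_def\<close>)
        show "norm (h' t) \<le> \<bar>C\<bar>" if "t \<in> {x..y}" for t
          using hC[of t] that xy by (auto simp: h'_def)
      qed (rule integrable_const_ivl)
      also have "\<dots> = \<bar>C\<bar> * (y - x)" using xy by simp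
      finally show "dist (V x) (V y) \<le> \<bar>C\<bar> * dist x y"
        using xy by (simp add: dist_norm norm_minus_commute)
    qed simp
    then have lip: "\<bar>C\<bar>-lipschitz_on UNIV V" by (rule periodic_lipschitz[of V, OF Vper])
    have "cmod (radial_op g z) \<le> 2 * \<bar>C\<bar>" if z: "cmod z < 1" for z
    proof -
      have "z = of_real (cmod z) * cis (Arg z)" by (simp only: rcis_def[symmetric] rcis_cmod_Arg)
      then show ?thesis
        using angular_op_bounded[OF Vper lip, of "cmod z" "Arg z"] rad[OF z] z by simp
    qed
    then show "\<exists>C. \<forall>z. cmod z < 1 \<longrightarrow> cmod (radial_op g z) \<le> C" by blast
  qed
qed

section \<open>Return to the data on the circle and to the boundary value problem\<close>

lemma poisson_integral_lipschitz_iff_hilbert_transform: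
  assumes \<phi>: "continuous_on (sphere 0 1) \<phi>"
    and d: "\<And>\<theta>. (\<lambda>t. \<phi> (cis t)) differentiable at \<theta>"
    and b: "bounded (range (circle_deriv \<phi>))"
  shows "(\<exists>L. L-lipschitz_on (ball 0 1) (poisson_integral \<phi>)) \<longleftrightarrow> Linfty_circle (hilbert_transform (circle_deriv \<phi>))"
proof -
  define g where "g t = \<phi> (cis t)" for t
  have per: "g (t + 2 * pi) = g t" for t by (simp add: g_def cis.ctr)
  have dg: "(g has_vector_derivative circle_deriv \<phi> t) (at t)" for t
    using d[of t] unfolding g_def[abs_def] circle_deriv_def by (simp add: vector_derivative_works)
  obtain M where M: "\<And>t. cmod (circle_deriv \<phi> t) \<le> M" using b by (auto simp: bounded_iff)
  have lip: "M-lipschitz_on UNIV g" by (rule lipschitz_of_bounded_vector_derivative[OF dg M])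
  have ang: "cmod (angular_op g z) \<le> 2 * M" if z: "cmod z < 1" for z
  proof -
    have "z = of_real (cmod z) * cis (Arg z)" by (simp only: rcis_def[symmetric] rcis_cmod_Arg)
    then show ?thesis using angular_op_bounded[OF per lip, of "cmod z" "Arg z"] z by simp
  qed
  show ?thesis
    using poisson_integral_lipschitz_iff[OF \<phi>, of "2 * M"] ang radial_op_bounded_iff_hilbert_transform[OF per dg M]
    unfolding g_def[abs_def] by simp
qed

theorem proposition1p8:
  fixes n :: nat and \<phi> :: "nat \<Rightarrow> complex \<Rightarrow> complex" and f :: "complex \<Rightarrow> complex"
  assumes "n \<ge> 2"
    and "continuous_on (cball 0 1) (\<phi> n)"
    and "\<And>k. k \<in> {1..n-1} \<Longrightarrow> continuous_on (sphere 0 1) (\<phi> k)"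
    and "continuous_on (sphere 0 1) (\<phi> 0)"
    and "\<And>\<theta>. (\<lambda>t. \<phi> 0 (cis t)) differentiable at \<theta>"
    and "bounded (range (circle_deriv (\<phi> 0)))"
    and "polyharmonic_solution n \<phi> f"
  shows "(\<exists>L. L-lipschitz_on (ball 0 1) f) \<longleftrightarrow>
         Linfty_circle (hilbert_transform (circle_deriv (\<phi> 0)))"
proof -
  let ?u = "poisson_integral (\<phi> 0)"
  let ?v = "\<lambda>z. (\<Sum>k = 1..n-1. (-1) ^ k * iterated_green_potential k (poisson_integral (\<phi> k)) z)
     + (-1) ^ n * iterated_green_potential n (\<phi> n) z"
  have f: "f z = ?u z + ?v z" if "z \<in> ball 0 1" for z
    using assms(7) that by (simp add: polyharmonic_solution_def polyharmonic_representation_def add.assoc)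
  have unit: "\<exists>L. L-lipschitz_on (ball 0 1) (\<lambda>z. (-1) ^ k * F z)" if "L-lipschitz_on (ball 0 1) F" for L k and F :: "complex \<Rightarrow> complex"
    using that by (cases "even k") (auto intro!: exI[of _ L])
  have summand: "\<exists>L. L-lipschitz_on (ball 0 1) (\<lambda>z. (-1) ^ k * iterated_green_potential k (poisson_integral (\<phi> k)) z)"
    if k: "k \<in> {1..n-1}" for k
  proof -
    note \<phi> = assms(3)[OF k]
    \<comment> \<open>The maximum over the circle also bounds the Poisson integral, since its kernel
      is positive with integral 1; this is the bound that the iterated potential needs.\<close>
    have "compact (\<phi> k ` sphere 0 1)" by (intro compact_continuous_image \<phi>) auto
    then obtain B where B: "\<And>w. cmod w = 1 \<Longrightarrow> cmod (\<phi> k w) \<le> B"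
      by (metis bounded_iff compact_imp_bounded image_eqI mem_sphere_0)
    obtain L where "L-lipschitz_on (ball 0 1) (iterated_green_potential k (poisson_integral (\<phi> k)))"
      using iterated_green_potential_lipschitz[OF poisson_integral_continuous[OF \<phi>] poisson_integral_bounded[OF \<phi> _ B]] k by auto
    then show ?thesis by (rule unit)
  qed
  have sum: "\<exists>L. L-lipschitz_on (ball 0 1) (\<lambda>z. \<Sum>k\<in>A. (-1) ^ k * iterated_green_potential k (poisson_integral (\<phi> k)) z)"
    if "finite A" "A \<subseteq> {1..n-1}" for A
    using that
  proof (induction A rule: finite_induct)
    case empty
    then show ?case using lipschitz_on_constant[of "ball 0 1" 0] by auto
  next
    case (insert k A)
    then obtain L1 L2 where
      "L1-lipschitz_on (ball 0 1) (\<lambda>z. (-1) ^ k * iterated_green_potential k (poisson_integral (\<phi> k)) z)"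
      "L2-lipschitz_on (ball 0 1) (\<lambda>z. \<Sum>k\<in>A. (-1) ^ k * iterated_green_potential k (poisson_integral (\<phi> k)) z)"
      using summand[of k] insert by blast
    from lipschitz_on_add[OF this] insert show ?case by auto
  qed
  have last: "\<exists>L. L-lipschitz_on (ball 0 1) (\<lambda>z. (-1) ^ n * iterated_green_potential n (\<phi> n) z)"
  proof -
    have "compact (\<phi> n ` cball 0 1)" by (intro compact_continuous_image assms(2)) auto
    then obtain B where B: "\<And>w. cmod w \<le> 1 \<Longrightarrow> cmod (\<phi> n w) \<le> B"
      by (metis bounded_iff compact_imp_bounded image_eqI mem_cball_0)
    obtain L where "L-lipschitz_on (ball 0 1) (iterated_green_potential n (\<phi> n))"
      using iterated_green_potential_lipschitz[OF continuous_on_subset[OF assms(2)], of B n] B assms(1) by auto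
    then show ?thesis by (rule unit)
  qed
  obtain L0 where L0: "L0-lipschitz_on (ball 0 1) ?v"
    using sum[of "{1..n-1}"] last lipschitz_on_add by blast
  have "(\<exists>L. L-lipschitz_on (ball 0 1) f) \<longleftrightarrow> (\<exists>L. L-lipschitz_on (ball 0 1) ?u)"
  proof
    assume "\<exists>L. L-lipschitz_on (ball 0 1) f"
    then obtain L where L: "L-lipschitz_on (ball 0 1) f" by blast
    have "(L + L0)-lipschitz_on (ball 0 1) ?u"
      by (rule lipschitz_on_transform[OF lipschitz_on_diff[OF L L0]]) (simp add: f)
    then show "\<exists>L. L-lipschitz_on (ball 0 1) ?u" by blast
  next
    assume "\<exists>L. L-lipschitz_on (ball 0 1) ?u"
    then obtain L where L: "L-lipschitz_on (ball 0 1) ?u" by blast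
    have "(L + L0)-lipschitz_on (ball 0 1) f"
      by (rule lipschitz_on_transform[OF lipschitz_on_add[OF L L0]]) (simp add: f)
    then show "\<exists>L. L-lipschitz_on (ball 0 1) f" by blast
  qed
  also have "\<dots> \<longleftrightarrow> Linfty_circle (hilbert_transform (circle_deriv (\<phi> 0)))"
    by (rule poisson_integral_lipschitz_iff_hilbert_transform[OF assms(4,5,6)])
  finally show ?thesis .
qed

end
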